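(* Let the differential operator $L$ be such that the corresponding stiffness matrix satisfies $\mathbf A\in\mathcal D_e(\eta_L)$ for some constant $\eta_L>0$. Assume that $v\in\mathcal A^{\eta,t}_G$ for some $\eta>0$ and $t\in(0,d]$, and set $\tau=t/d$. Let one of the following two sets of conditions be satisfied. (a) If the matrix $\mathbf A$ is banded with $2p+1$ non-zero diagonals, set $\bar\eta=\dfrac{\eta}{(2p+1)^\tau}$ and $\bar t=t$. (b) If the matrix $\mathbf A$ is dense, but the coefficients $\eta_L$ and $\eta$ satisfy the inequality $\eta<\eta_L\,\omega_d^{\tau}$, set $\bar\eta=\zeta(t)\,\eta$ and $\bar t=\dfrac{t}{1+t}$. Then $Lv\in\mathcal A^{\bar\eta,\bar t}_G$, with $$\|Lv\|_{\mathcal A^{\bar\eta,\bar t}_G}\lesssim\|v\|_{\mathcal A^{\eta,t}_G},$$ where the hidden constant is independent of $v$.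
   Context: Let $d\ge1$, $\Omega=(0,2\pi)^d$, $\phi_k(x)=(2\pi)^{-d/2}e^{ik\cdot x}$ for $k\in\mathbb Z^d$, $\hat v_k=(v,\phi_k)_{L^2(\Omega)}$. $V=H^1_p(\Omega)$: $H^1$ functions $2\pi$-periodic in each direction, norm $\|v\|^2=\sum_k(1+|k|^2)|\hat v_k|^2$ ($|k|$ Euclidean). $H^{-1}_p(\Omega)$ is its (anti)dual, $\hat f_k=\langle f,\phi_k\rangle$, $\|f\|^2=\sum_k(1+|k|^2)^{-1}|\hat f_k|^2$. $P_\Lambda$ keeps only the Fourier coefficients with index in $\Lambda\subset\mathbb Z^d$. $Lu=-\nabla\cdot(\nu\nabla u)+\sigma u$ with sufficiently smooth real ($2\pi$-periodic) coefficients bounded above and below by positive constants; $a(u,v)=\int_\Omega\nu\nabla u\cdot\nabla\bar v+\int_\Omega\sigma u\bar v$. Stiffness matrix: $\mathbf A=(a_{\ell,k})_{\ell,k\in\mathbb Z^d}$, $a_{\ell,k}=\frac{a(\phi_k,\phi_\ell)}{c_\ell c_k}$, $c_k=\sqrt{1+|k|^2}$. $\mathbf A\in\mathcal D_e(\eta_L)$ means that for some $c_L>0$, $|a_{\ell,k}|\le c_Le^{-\eta_L|\ell-k|}$ for all $\ell,k\in\mathbb Z^d$. A diagonal of $\mathbf A$ is a set of entries $a_{\ell,k}$ with $\ell-k$ constant. $\omega_d$ is the measure of the Euclidean unit ball in $\mathbb R^d$, and $\zeta(t)=\Big(\frac{1+t}{\omega_d^{1+t}}\Big)^{\frac{t}{d(1+t)}}$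 for $0<t\le d$. Best $N$-term error: $E_N(v)=\inf_{|\Lambda|=N}\|v-P_\Lambda v\|$ ($E_0(v)=\|v\|$). Exponential class, for $\eta>0$, $0<t\le d$: $\mathcal A^{\eta,t}_G=\{v\in V:\ \|v\|_{\mathcal A^{\eta,t}_G}:=\sup_{N\ge0}E_N(v)\exp(\eta\,\omega_d^{-t/d}N^{t/d})<\infty\}$. The same notation is used for forms in $H^{-1}_p(\Omega)$, with $V$ and its norm replaced by $H^{-1}_p(\Omega)$ and its norm (this is the meaning for $Lv$). *)

theory Defs
  imports "HOL-Analysis.Analysis"
begin

text \<open>The dimension \<open>d\<close> is \<open>CARD('n)\<close>. Elements of \<open>L\<^sup>2\<close> and \<open>H\<^sup>1\<close> are represented by Borel
  measurable, everywhere periodic functions on the whole space; no quotient by a.e. equality is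
  taken, and all quantities below only depend on the a.e. class.\<close>

definition Omega :: "(real^'n) set" where
  "Omega = {x. \<forall>i. 0 < x $ i \<and> x $ i < 2 * pi}"

definition periodic :: "(real^'n \<Rightarrow> 'b) \<Rightarrow> bool" where
  "periodic f \<longleftrightarrow> (\<forall>x i. f (x + axis i (2 * pi)) = f x)"

definition partial :: "'n \<Rightarrow> (real^'n \<Rightarrow> 'b) \<Rightarrow> real^'n \<Rightarrow> 'b::real_normed_vector" where
  "partial i f x = frechet_derivative f (at x) (axis i 1)"

definition C1 :: "(real^'n \<Rightarrow> 'b::real_normed_vector) \<Rightarrow> bool" where
  "C1 f \<longleftrightarrow> (\<forall>x. f differentiable (at x)) \<and> (\<forall>i. continuous_on UNIV (partial i f))"

text \<open>\<open>C\<^sup>\<infinity>\<close>: all iterated partial derivatives, of any order, are differentiable everywhere.\<close>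

definition smooth :: "(real^'n \<Rightarrow> 'b::real_normed_vector) \<Rightarrow> bool" where
  "smooth f \<longleftrightarrow> (\<forall>js x. foldr partial js f differentiable (at x))"

definition multi_idx :: "int^'n \<Rightarrow> real^'n" where
  "multi_idx k = (\<chi> i. of_int (k $ i))"

definition phi :: "int^'n \<Rightarrow> real^'n \<Rightarrow> complex" where
  "phi k x = of_real ((2 * pi) powr (- real CARD('n) / 2)) * exp (\<i> * of_real (multi_idx k \<bullet> x))"

definition fcoef :: "(real^'n \<Rightarrow> complex) \<Rightarrow> int^'n \<Rightarrow> complex" where
  "fcoef v k = (LINT x:Omega|lborel. v x * cnj (phi k x))"

definition L2p :: "(real^'n \<Rightarrow> complex) set" where
  "L2p = {v. periodic v \<and> v \<in> borel_measurable borel \<and>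
             set_integrable lborel Omega (\<lambda>x. (cmod (v x))\<^sup>2)}"

text \<open>Weak derivative on the torus: the test functions are smooth and periodic rather than
  compactly supported in \<open>Omega\<close>. This forces the traces of \<open>v\<close> on opposite faces of \<open>Omega\<close> to
  agree, i.e. the periodic extension of \<open>v\<close> is weakly differentiable across the faces.\<close>

definition weak_partial :: "'n \<Rightarrow> (real^'n \<Rightarrow> complex) \<Rightarrow> (real^'n \<Rightarrow> complex) \<Rightarrow> bool" where
  "weak_partial i v g \<longleftrightarrow> g \<in> L2p \<and>
     (\<forall>\<psi>::real^'n \<Rightarrow> complex. smooth \<psi> \<and> periodic \<psi> \<longrightarrow>
        (LINT x:Omega|lborel. v x * partial i \<psi> x) = - (LINT x:Omega|lborel. g x * \<psi> x))"

definition H1p :: "(real^'n \<Rightarrow> complex) set" where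
  "H1p = {v \<in> L2p. \<forall>i. \<exists>g. weak_partial i v g}"

text \<open>The weak derivative is unique up to a null set, so the choice is immaterial.\<close>

definition wderiv :: "'n \<Rightarrow> (real^'n \<Rightarrow> complex) \<Rightarrow> real^'n \<Rightarrow> complex" where
  "wderiv i v = (SOME g. weak_partial i v g)"

definition cw :: "int^'n \<Rightarrow> real" where
  "cw k = sqrt (1 + (norm (multi_idx k))\<^sup>2)"

text \<open>On \<open>H1p\<close> and on \<open>Hm1\<close> (below), respectively, the series in the following two norms converge;
  the norms are not meant to be used for other arguments.\<close>

definition H1norm :: "(real^'n \<Rightarrow> complex) \<Rightarrow> real" where
  "H1norm v = sqrt (\<Sum>\<^sub>\<infinity>k\<in>UNIV. (1 + (norm (multi_idx k))\<^sup>2) * (cmod (fcoef v k))\<^sup>2)"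

definition Hm1norm :: "((real^'n \<Rightarrow> complex) \<Rightarrow> complex) \<Rightarrow> real" where
  "Hm1norm f = sqrt (\<Sum>\<^sub>\<infinity>k\<in>UNIV. inverse (1 + (norm (multi_idx k))\<^sup>2) * (cmod (f (phi k)))\<^sup>2)"

text \<open>The antidual of \<open>H1p\<close>; the values of a form outside \<open>H1p\<close> are irrelevant.
  The \<open>k\<close>-th Fourier coefficient of a form \<open>f\<close> is \<open>f (phi k)\<close>.\<close>

definition Hm1 :: "((real^'n \<Rightarrow> complex) \<Rightarrow> complex) set" where
  "Hm1 = {f. (\<forall>v\<in>H1p. \<forall>w\<in>H1p. f (\<lambda>x. v x + w x) = f v + f w) \<and>
             (\<forall>c. \<forall>v\<in>H1p. f (\<lambda>x. c * v x) = cnj c * f v) \<and>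
             (\<exists>C. \<forall>v\<in>H1p. cmod (f v) \<le> C * H1norm v)}"

text \<open>The projections, needed for finite \<open>\<Lambda>\<close> only.\<close>

definition proj_fun :: "(int^'n) set \<Rightarrow> (real^'n \<Rightarrow> complex) \<Rightarrow> real^'n \<Rightarrow> complex" where
  "proj_fun \<Lambda> v = (\<lambda>x. \<Sum>k\<in>\<Lambda>. fcoef v k * phi k x)"

definition proj_form ::
  "(int^'n) set \<Rightarrow> ((real^'n \<Rightarrow> complex) \<Rightarrow> complex) \<Rightarrow> (real^'n \<Rightarrow> complex) \<Rightarrow> complex" where
  "proj_form \<Lambda> f = (\<lambda>w. \<Sum>k\<in>\<Lambda>. f (phi k) * cnj (fcoef w k))"

definition omega_ball :: "'n::finite itself \<Rightarrow> real" where
  "omega_ball _ = measure lborel (ball (0 :: real^'n) 1)"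

definition zeta_exp :: "'n::finite itself \<Rightarrow> real \<Rightarrow> real" where
  "zeta_exp T t = ((1 + t) / omega_ball T powr (1 + t)) powr (t / (real CARD('n) * (1 + t)))"

text \<open>Best \<open>N\<close>-term error and exponential class, for a space \<open>X\<close> with norm \<open>nrm\<close> and projections
  \<open>P\<close>; instantiated below for \<open>H1p\<close> and for \<open>Hm1\<close>.\<close>

definition best_err ::
  "('v \<Rightarrow> real) \<Rightarrow> ((int^'n) set \<Rightarrow> 'v \<Rightarrow> 'v) \<Rightarrow> nat \<Rightarrow> 'v::minus \<Rightarrow> real" where
  "best_err nrm P N v = Inf {nrm (v - P \<Lambda> v) | \<Lambda>. finite \<Lambda> \<and> card \<Lambda> = N}"

definition exp_norm ::
  "('v \<Rightarrow> real) \<Rightarrow> ((int^'n) set \<Rightarrow> 'v \<Rightarrow> 'v) \<Rightarrow> real \<Rightarrow> real \<Rightarrow> 'v::minus \<Rightarrow> ennreal" where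
  "exp_norm nrm P \<eta> t v =
     (SUP N. ennreal (best_err nrm P N v *
        exp (\<eta> * omega_ball TYPE('n) powr (- t / real CARD('n)) *
             real N powr (t / real CARD('n)))))"

definition AG_norm :: "real \<Rightarrow> real \<Rightarrow> (real^'n \<Rightarrow> complex) \<Rightarrow> ennreal" where
  "AG_norm = exp_norm H1norm proj_fun"

definition AG :: "real \<Rightarrow> real \<Rightarrow> (real^'n \<Rightarrow> complex) set" where
  "AG \<eta> t = {v \<in> H1p. AG_norm \<eta> t v < \<infinity>}"

definition AG_form_norm :: "real \<Rightarrow> real \<Rightarrow> ((real^'n \<Rightarrow> complex) \<Rightarrow> complex) \<Rightarrow> ennreal" where
  "AG_form_norm = exp_norm Hm1norm proj_form"

definition AG_form :: "real \<Rightarrow> real \<Rightarrow> ((real^'n \<Rightarrow> complex) \<Rightarrow> complex) set" where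
  "AG_form \<eta> t = {f \<in> Hm1. AG_form_norm \<eta> t f < \<infinity>}"

text \<open>\<open>C1\<close> is the regularity that gives the divergence form of \<open>L\<close> a pointwise meaning on smooth
  functions; smoother coefficients are special cases.\<close>

definition admissible_coeff :: "(real^'n \<Rightarrow> real) \<Rightarrow> bool" where
  "admissible_coeff \<nu> \<longleftrightarrow> C1 \<nu> \<and> periodic \<nu> \<and> (\<exists>lo hi. 0 < lo \<and> (\<forall>x. lo \<le> \<nu> x \<and> \<nu> x \<le> hi))"

definition aform ::
  "(real^'n \<Rightarrow> real) \<Rightarrow> (real^'n \<Rightarrow> real) \<Rightarrow> (real^'n \<Rightarrow> complex) \<Rightarrow> (real^'n \<Rightarrow> complex) \<Rightarrow> complex" where
  "aform \<nu> \<sigma> u v =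
     (LINT x:Omega|lborel. of_real (\<nu> x) * (\<Sum>i\<in>UNIV. wderiv i u x * cnj (wderiv i v x))) +
     (LINT x:Omega|lborel. of_real (\<sigma> x) * u x * cnj (v x))"

text \<open>\<open>L\<close> as an operator from \<open>H1p\<close> to its antidual.\<close>

definition Lop ::
  "(real^'n \<Rightarrow> real) \<Rightarrow> (real^'n \<Rightarrow> real) \<Rightarrow> (real^'n \<Rightarrow> complex) \<Rightarrow> (real^'n \<Rightarrow> complex) \<Rightarrow> complex" where
  "Lop \<nu> \<sigma> u = (\<lambda>w. aform \<nu> \<sigma> u w)"

definition stiffness ::
  "(real^'n \<Rightarrow> real) \<Rightarrow> (real^'n \<Rightarrow> real) \<Rightarrow> int^'n \<Rightarrow> int^'n \<Rightarrow> complex" where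
  "stiffness \<nu> \<sigma> l k = aform \<nu> \<sigma> (phi k) (phi l) / of_real (cw l * cw k)"

definition De :: "real \<Rightarrow> (int^'n \<Rightarrow> int^'n \<Rightarrow> complex) set" where
  "De \<eta> = {A. \<exists>c>0. \<forall>l k. cmod (A l k) \<le> c * exp (- \<eta> * norm (multi_idx (l - k)))}"

text \<open>A diagonal is identified with the constant value of \<open>l - k\<close> on it.\<close>

definition nonzero_diagonals :: "(int^'n \<Rightarrow> int^'n \<Rightarrow> complex) \<Rightarrow> (int^'n) set" where
  "nonzero_diagonals A = {m. \<exists>l k. l - k = m \<and> A l k \<noteq> 0}"

definition banded :: "nat \<Rightarrow> (int^'n \<Rightarrow> int^'n \<Rightarrow> complex) \<Rightarrow> bool" where
  "banded p A \<longleftrightarrow> finite (nonzero_diagonals A) \<and> card (nonzero_diagonals A) = 2 * p + 1"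

text \<open>For a Hermitian matrix with nonzero main diagonal, such as a stiffness matrix, the number of
  nonzero diagonals is odd if finite, so that dense means not banded.\<close>

definition dense_matrix :: "(int^'n \<Rightarrow> int^'n \<Rightarrow> complex) \<Rightarrow> bool" where
  "dense_matrix A \<longleftrightarrow> infinite (nonzero_diagonals A)"

end

theory Submission
  imports Defs
begin

text \<open>Put \<open>V k = cw k * cmod (fcoef v k)\<close>, so that the \<open>H1norm\<close> of \<open>v\<close> is the \<open>l\<^sup>2\<close> norm of \<open>V\<close> and the
  weighted coefficients of \<open>Lop \<nu> \<sigma> v\<close> are those of the stiffness matrix applied to the weighted
  coefficients of \<open>v\<close>. Both cases keep an index set \<open>\<Lambda>\<close> of size \<open>N\<close> for the form and estimate its
  coefficients off \<open>\<Lambda>\<close>.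

  The analytic part justifies this matrix description. Integrals over the torus are translation
  invariant, so a partial derivative of a periodic function has integral zero; this yields
  orthonormality of the exponentials and their weak derivatives. Stone-Weierstrass on a product of
  circles and density of continuous functions yield \<open>Parseval\<close>, hence uniqueness of weak derivatives, the
  identity between the Fourier norm and the integral Sobolev norm (\<open>H1norm_has_sum\<close>), boundedness of the
  sesquilinear form, and the expansion \<open>aform_has_sum\<close> of the form along the Fourier series.

  If the matrix has \<open>B\<close> nonzero diagonals, the image of \<open>n\<close> indices consists of at most \<open>n * B\<close> indices. Off
  the image, \<open>Lop \<nu> \<sigma> v\<close> coincides with \<open>Lop \<nu> \<sigma>\<close> of the remainder of \<open>v\<close>, and boundedness transfers the
  error of \<open>v\<close> at \<open>n = N div B\<close> to the error of the form at \<open>N\<close> (\<open>best_err_banded\<close>). This division of \<open>N\<close>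
  by \<open>B\<close> is the factor \<open>(2 * p + 1) powr \<tau>\<close> in the rate.

  In the dense case, the indices are ranked by decreasing \<open>V\<close>. The coefficient of rank \<open>n\<close> is at most the
  error of \<open>v\<close> at \<open>n\<close>, that is, at most a constant times \<open>exp (- \<eta> * (n / \<omega>) powr \<tau>)\<close>, where \<open>\<omega>\<close> is the
  volume of the unit ball. Together with the decay of the matrix, the product of the entry at offset \<open>m\<close>
  from the diagonal and the coefficient of rank \<open>n\<close> has exponential weight
  \<open>\<eta>\<^sub>L * norm m + \<eta> * (n / \<omega>) powr \<tau>\<close>. The products of weight at most \<open>\<eta> * J\<close> are retained. The others sum to
  at most a constant times \<open>exp (- (1 - \<epsilon>) * \<eta> * J)\<close>, for every \<open>\<epsilon> > 0\<close> (\<open>discarded_sum_le\<close>). The number of the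
  retained ones is a sum of lattice point counts in balls of radius \<open>\<eta> / \<eta>\<^sub>L * (J - (n / \<omega>) powr \<tau>)\<close>, and
  \<open>card_retained_le\<close> bounds it asymptotically by
  \<open>\<omega>\<^sup>2 * (\<eta> / \<eta>\<^sub>L) ^ d / (d + 1) * J powr (d + d / t)\<close>. Solving for \<open>J\<close> gives the exponent \<open>t / (1 + t)\<close>. As
  \<open>t \<le> d\<close> and \<open>(\<eta> / \<eta>\<^sub>L) ^ d < \<omega> powr t\<close>, the coefficient is strictly smaller than \<open>\<omega> powr (2 + t) / (1 + t)\<close>,
  which is the one that corresponds to \<open>zeta_exp\<close>. The gap absorbs \<open>\<epsilon>\<close> and all terms of lower order.\<close>


section \<open>Integration over the torus\<close>

abbreviation tor :: "(real^'n) measure" where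
  "tor \<equiv> restrict_space lborel Omega"

lemma Omega_eq_box: "(Omega :: (real^'n) set) = box 0 (\<chi> i. 2 * pi)"
  by (auto simp: Omega_def mem_box_cart)

lemma Omega_measurable [measurable, simp]: "Omega \<in> sets borel" "Omega \<in> sets lborel"
  by (simp_all add: Omega_eq_box)

lemma space_tor [simp]: "space tor = Omega"
  by simp

lemma finite_measure_tor: "finite_measure (tor :: (real^'n) measure)"
  using emeasure_lborel_box_finite[of 0 "(\<chi> i. 2 * pi)::real^'n"]
  by (intro finite_measureI) (simp add: emeasure_restrict_space Omega_eq_box less_top)

interpretation tor: finite_measure tor
  by (rule finite_measure_tor)

lemma measurable_tor: "f \<in> borel_measurable borel \<Longrightarrow> f \<in> borel_measurable tor"
  by (rule measurable_restrict_space1) simp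

lemma set_integrable_tor_iff:
  fixes f :: "real^'n \<Rightarrow> 'b::{banach, second_countable_topology}"
  shows "set_integrable lborel Omega f \<longleftrightarrow> integrable tor f"
  by (simp add: set_integrable_def integrable_restrict_space)

lemma set_integral_tor:
  fixes f :: "real^'n \<Rightarrow> 'b::{banach, second_countable_topology}"
  shows "(LINT x:Omega|lborel. f x) = (LINT x|tor. f x)"
  by (simp add: set_lebesgue_integral_def integral_restrict_space)

lemma integrable_tor_bounded:
  fixes f :: "real^'n \<Rightarrow> 'b::{banach, second_countable_topology}"
  assumes "f \<in> borel_measurable borel" "\<And>x. x \<in> Omega \<Longrightarrow> norm (f x) \<le> B"
  shows "integrable tor f"
  by (rule tor.integrable_const_bound[where B = B])
     (use assms in \<open>auto intro: measurable_tor\<close>)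

lemma continuous_bounded_Omega:
  fixes f :: "real^'n \<Rightarrow> 'b::real_normed_vector"
  assumes "continuous_on UNIV f"
  obtains B where "B > 0" "\<And>x. x \<in> Omega \<Longrightarrow> norm (f x) \<le> B"
proof -
  have "bounded (f ` cbox 0 (\<chi> i. 2 * pi))"
    using assms by (intro compact_imp_bounded compact_continuous_image compact_cbox)
      (auto intro: continuous_on_subset)
  then obtain B where "B > 0" "\<forall>y\<in>f ` cbox 0 (\<chi> i. 2 * pi). norm y \<le> B"
    by (auto simp: bounded_pos)
  then show ?thesis
    using that[of B] box_subset_cbox[of 0 "(\<chi> i. 2 * pi)::real^'n"] by (auto simp: Omega_eq_box)
qed

lemma integrable_tor_continuous:
  fixes f :: "real^'n \<Rightarrow> 'b::{banach, second_countable_topology}"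
  assumes "continuous_on UNIV f"
  shows "integrable tor f"
proof -
  obtain B where "B > 0" "\<And>x. x \<in> Omega \<Longrightarrow> norm (f x) \<le> B"
    using continuous_bounded_Omega[OF assms] by blast
  then show ?thesis
    using assms by (intro integrable_tor_bounded[where B = B] borel_measurable_continuous_onI) auto
qed

text \<open>The half-open cube is an exact fundamental domain of the translation lattice, so cutting and
  translating its pieces needs no exceptional null sets.\<close>

definition torus_cell :: "(real^'n) set" where
  "torus_cell = {x. \<forall>i. 0 \<le> x $ i \<and> x $ i < 2 * pi}"

lemma torus_cell_measurable [measurable]: "torus_cell \<in> sets borel"
  unfolding torus_cell_def by measurable

lemma AE_torus_cell: "AE x in lborel. (x \<in> (Omega :: (real^'n) set)) = (x \<in> torus_cell)"
proof -
  have "AE x in lborel. x \<notin> cbox 0 (\<chi> i. 2 * pi) - box 0 ((\<chi> i. 2 * pi)::real^'n)"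
  proof (rule AE_not_in)
    show "cbox 0 (\<chi> i. 2 * pi) - box 0 ((\<chi> i. 2 * pi)::real^'n) \<in> null_sets lborel"
      using negligible_frontier_interval[of "0::real^'n" "\<chi> i. 2 * pi"]
      by (auto simp: negligible_iff_null_sets null_sets_completion_iff)
  qed
  then show ?thesis
    by eventually_elim (auto simp: torus_cell_def Omega_eq_box mem_box_cart less_imp_le)
qed

lemma integral_tor_torus_cell:
  fixes f :: "real^'n \<Rightarrow> 'b::{banach, second_countable_topology}"
  assumes [measurable]: "f \<in> borel_measurable borel"
  shows "(LINT x|tor. f x) = (LINT x|lborel. indicator torus_cell x *\<^sub>R f x)"
proof -
  have "(LINT x|tor. f x) = (LINT x|lborel. indicator Omega x *\<^sub>R f x)"
    by (simp add: integral_restrict_space)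
  also have "\<dots> = (LINT x|lborel. indicator torus_cell x *\<^sub>R f x)"
    by (rule integral_cong_AE) (use AE_torus_cell in \<open>auto elim!: eventually_mono simp: indicator_def\<close>)
  finally show ?thesis .
qed

lemma integral_lborel_translate:
  fixes g :: "'a::euclidean_space \<Rightarrow> 'b::{banach, second_countable_topology}"
  assumes "g \<in> borel_measurable borel"
  shows "(LINT x|lborel. g (x + a)) = (LINT x|lborel. g x)"
    and "integrable lborel g \<Longrightarrow> integrable lborel (\<lambda>x. g (x + a))"
proof -
  have "(LINT x|lborel. g x) = (LINT x|distr lborel borel ((+) a). g x)"
    by (simp add: lborel_distr_plus)
  also have "\<dots> = (LINT x|lborel. g (x + a))"
    using assms by (subst integral_distr) (auto simp: add.commute)
  finally show "(LINT x|lborel. g (x + a)) = (LINT x|lborel. g x)" ..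
  assume "integrable lborel g"
  then have "integrable (distr lborel borel ((+) a)) g"
    by (simp add: lborel_distr_plus)
  then show "integrable lborel (\<lambda>x. g (x + a))"
    using assms by (subst (asm) integrable_distr_eq) (auto simp: add.commute)
qed

text \<open>Translation pushes a slab of the cell out through one face; periodicity brings it back through the
  opposite face, so the pieces fill the cell again.\<close>

lemma integral_tor_shift:
  fixes f :: "real^'n \<Rightarrow> 'b::{banach, second_countable_topology}"
  assumes per: "periodic f" and cont: "continuous_on UNIV f" and s: "0 \<le> s" "s \<le> 2 * pi"
  shows "(LINT x|tor. f (x + axis i s)) = (LINT x|tor. f x)"
proof -
  have [measurable]: "f \<in> borel_measurable borel"
    by (rule borel_measurable_continuous_onI[OF cont])
  have intf: "integrable lborel (\<lambda>x. indicator torus_cell x *\<^sub>R f x)"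
  proof -
    have "integrable lborel (\<lambda>x. indicator (cbox 0 (\<chi> i. 2 * pi)) x *\<^sub>R f x)"
      using cont by (intro borel_integrable_compact compact_cbox) (auto intro: continuous_on_subset)
    then have "integrable lborel (\<lambda>x. indicator torus_cell x *\<^sub>R (indicator (cbox 0 (\<chi> i. 2 * pi)) x *\<^sub>R f x))"
      by (rule integrable_mult_indicator[rotated]) measurable
    also have "(\<lambda>x. indicator torus_cell x *\<^sub>R (indicator (cbox 0 (\<chi> i. 2 * pi)) x *\<^sub>R f x)) =
        (\<lambda>x. indicator torus_cell x *\<^sub>R f x)"
      by (auto simp: fun_eq_iff indicator_def torus_cell_def mem_box_cart less_imp_le)
    finally show ?thesis .
  qed
  define A where "A = {x::real^'n. s \<le> x $ i}"
  define B where "B = {x::real^'n. x $ i < s}"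
  have [measurable]: "A \<in> sets borel" "B \<in> sets borel"
    unfolding A_def B_def by measurable
  \<comment> \<open>The part of the cell reached without wrapping around, and the part reached after wrapping.\<close>
  define g1 where "g1 x = indicator A x *\<^sub>R (indicator torus_cell x *\<^sub>R f x)" for x
  define g2 where "g2 x = indicator B x *\<^sub>R (indicator torus_cell x *\<^sub>R f x)" for x
  have [measurable]: "g1 \<in> borel_measurable borel" "g2 \<in> borel_measurable borel"
    unfolding g1_def g2_def by measurable
  have int: "integrable lborel g1" "integrable lborel g2"
    unfolding g1_def g2_def by (intro integrable_mult_indicator intf; simp)+
  have split: "indicator torus_cell x *\<^sub>R f (x + axis i s) =
      g1 (x + axis i s) + g2 (x + axis i (s - 2 * pi))" for x
  proof -
    have "f (x + axis i (s - 2 * pi)) = f (x + axis i (s - 2 * pi) + axis i (2 * pi))"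
      using per by (simp add: periodic_def)
    also have "x + axis i (s - 2 * pi) + axis i (2 * pi) = x + axis i s"
      by (auto simp: vec_eq_iff axis_def)
    finally have 1: "f (x + axis i (s - 2 * pi)) = f (x + axis i s)" .
    have 2: "x + axis i s \<in> A \<inter> torus_cell \<longleftrightarrow> x \<in> torus_cell \<and> x $ i + s < 2 * pi"
      using s by (force simp: A_def torus_cell_def axis_def)
    have 3: "x + axis i (s - 2 * pi) \<in> B \<inter> torus_cell \<longleftrightarrow> x \<in> torus_cell \<and> \<not> x $ i + s < 2 * pi"
    proof -
      have "(\<forall>j. 0 \<le> (x + axis i (s - 2 * pi)) $ j \<and> (x + axis i (s - 2 * pi)) $ j < 2 * pi) \<and>
        (x + axis i (s - 2 * pi)) $ i < s \<longleftrightarrow>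
        (\<forall>j. 0 \<le> x $ j \<and> x $ j < 2 * pi) \<and> \<not> x $ i + s < 2 * pi" (is "?l \<longleftrightarrow> ?r")
      proof
        assume ?l
        then have *: "0 \<le> x $ j + (if j = i then s - 2 * pi else 0)"
          "x $ j + (if j = i then s - 2 * pi else 0) < 2 * pi" for j
          by (auto simp: axis_def)
        moreover have "x $ i < 2 * pi"
          using \<open>?l\<close> by (auto simp: axis_def)
        ultimately have "0 \<le> x $ j \<and> x $ j < 2 * pi" for j
          using *[of j] *[of i] s by (cases "j = i") auto
        then show ?r using *[of i] by auto
      next
        assume ?r
        then have x: "0 \<le> x $ j" "x $ j < 2 * pi" and xi: "\<not> x $ i + s < 2 * pi" for j
          by auto
        have "0 \<le> x $ j + (if j = i then s - 2 * pi else 0) \<and>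
          x $ j + (if j = i then s - 2 * pi else 0) < 2 * pi" for j
          using s x[of j] xi by auto
        moreover have "x $ i + (s - 2 * pi) < s"
          using x(2)[of i] by linarith
        ultimately show ?l by (auto simp: axis_def)
      qed
      then show ?thesis by (auto simp: B_def torus_cell_def)
    qed
    have "g1 (x + axis i s) = (if x + axis i s \<in> A \<inter> torus_cell then f (x + axis i s) else 0)"
      "g2 (x + axis i (s - 2 * pi)) =
        (if x + axis i (s - 2 * pi) \<in> B \<inter> torus_cell then f (x + axis i (s - 2 * pi)) else 0)"
      by (simp_all add: g1_def g2_def indicator_def)
    then show ?thesis
      unfolding 1 2 3 by (simp add: indicator_def)
  qed
  have "(\<lambda>x. f (x + axis i s)) \<in> borel_measurable borel"
    by measurable
  then have "(LINT x|tor. f (x + axis i s)) = (LINT x|lborel. indicator torus_cell x *\<^sub>R f (x + axis i s))"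
    by (rule integral_tor_torus_cell)
  also have "\<dots> = (LINT x|lborel. g1 (x + axis i s)) + (LINT x|lborel. g2 (x + axis i (s - 2 * pi)))"
    unfolding split using int by (intro Bochner_Integration.integral_add integral_lborel_translate) auto
  also have "\<dots> = (LINT x|lborel. g1 x) + (LINT x|lborel. g2 x)"
    by (simp add: integral_lborel_translate)
  also have "\<dots> = (LINT x|lborel. g1 x + g2 x)"
    using int by simp
  also have "(\<lambda>x. g1 x + g2 x) = (\<lambda>x. indicator torus_cell x *\<^sub>R f x)"
    by (auto simp: fun_eq_iff g1_def g2_def A_def B_def indicator_def)
  also have "(LINT x|lborel. indicator torus_cell x *\<^sub>R f x) = (LINT x|tor. f x)"
    by (simp add: integral_tor_torus_cell)
  finally show ?thesis .
qed

lemma has_derivative_imp_partial: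
  "(F has_derivative D) (at x) \<Longrightarrow> partial i F x = D (axis i 1)"
  by (simp add: partial_def frechet_derivative_at[symmetric])

text \<open>The integral of \<open>F\<close> over the torus does not change under translation, so its difference
  quotients integrate to zero; dominated convergence passes this on to the derivative.\<close>

lemma integral_partial_eq_0:
  fixes F :: "real^'n \<Rightarrow> complex"
  assumes per: "periodic F" and diff: "\<And>x. F differentiable (at x)"
    and cont: "continuous_on UNIV (partial i F)"
  shows "(LINT x|tor. partial i F x) = 0"
proof -
  have contF: "continuous_on UNIV F"
    using diff by (auto intro!: continuous_at_imp_continuous_on differentiable_imp_continuous_within)
  have [measurable]: "F \<in> borel_measurable borel" "partial i F \<in> borel_measurable borel"
    by (auto intro!: borel_measurable_continuous_onI contF cont)
  define s where "s n = inverse (real (Suc n))" for n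
  have s: "0 < s n" "s n \<le> 1" "s n \<le> 2 * pi" for n
  proof -
    show "0 < s n" by (simp add: s_def)
    show "s n \<le> 1" by (simp add: s_def field_simps)
    then show "s n \<le> 2 * pi" using pi_gt3 by linarith
  qed
  have ax: "axis i r = r *\<^sub>R axis i (1::real)" for r :: real
    by (simp add: vec_eq_iff axis_def)
  define g where "g x r = F (x + axis i r)" for x r
  have dg: "(g x has_vector_derivative partial i F (x + axis i r)) (at r within S)" for x r S
  proof -
    have "((\<lambda>r. x + r *\<^sub>R axis i 1) has_derivative (\<lambda>h. h *\<^sub>R axis i 1)) (at r within S)"
      by (auto intro!: derivative_eq_intros)
    then have dax: "((\<lambda>r. x + axis i r) has_derivative axis i) (at r within S)"
      by (simp only: ax[symmetric])
    have "(F has_derivative frechet_derivative F (at (x + axis i r))) (at (x + axis i r))"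
      using diff by (simp add: frechet_derivative_works)
    then have "((\<lambda>r. F (x + axis i r)) has_derivative
        (\<lambda>h. frechet_derivative F (at (x + axis i r)) (axis i h))) (at r within S)"
      by (rule has_derivative_compose[rotated, OF _ dax])
    moreover have "frechet_derivative F (at (x + axis i r)) (axis i h) =
        h *\<^sub>R partial i F (x + axis i r)" for h
      unfolding partial_def
      by (subst ax) (rule linear_scale[OF linear_frechet_derivative[OF diff]])
    ultimately show ?thesis
      by (simp add: g_def[abs_def] has_vector_derivative_def)
  qed
  \<comment> \<open>The translated points leave the cell by at most \<open>1\<close>, hence the larger box.\<close>
  have "bounded (partial i F ` cbox 0 (\<chi> i. 2 * pi + 1))"
    using cont by (intro compact_imp_bounded compact_continuous_image compact_cbox)
      (auto intro: continuous_on_subset)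
  then obtain B where B: "\<And>y. y \<in> cbox 0 (\<chi> i. 2 * pi + 1) \<Longrightarrow> norm (partial i F y) \<le> B"
    by (auto simp: bounded_iff)
  define D where "D n x = (F (x + axis i (s n)) - F x) /\<^sub>R s n" for n x
  have [measurable]: "D n \<in> borel_measurable borel" for n
    unfolding D_def by measurable
  have "(\<lambda>n. LINT x|tor. D n x) \<longlonglongrightarrow> (LINT x|tor. partial i F x)"
  proof (rule integral_dominated_convergence[where w = "\<lambda>_. B"])
    show "AE x in tor. (\<lambda>n. D n x) \<longlonglongrightarrow> partial i F x"
    proof (rule AE_I2)
      fix x :: "real^'n"
      have "((\<lambda>r. (g x (0 + r) - g x 0) /\<^sub>R r) \<longlongrightarrow> partial i F (x + axis i 0)) (at 0)"
      proof -
        have "((\<lambda>r. norm (g x (0 + r) - g x 0 - r *\<^sub>R partial i F (x + axis i 0)) / norm r) \<longlongrightarrow> 0) (at 0)"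
          using dg[of x 0 UNIV] by (simp add: has_vector_derivative_def has_derivative_at)
        moreover have "eventually (\<lambda>r. norm (g x (0 + r) - g x 0 - r *\<^sub>R partial i F (x + axis i 0)) / norm r =
            norm ((g x (0 + r) - g x 0) /\<^sub>R r - partial i F (x + axis i 0))) (at 0)"
        proof (rule eventually_at_filter[THEN iffD2, OF always_eventually], intro allI impI)
          fix r :: real assume "r \<noteq> 0"
          then have "(g x (0 + r) - g x 0) /\<^sub>R r - partial i F (x + axis i 0) =
              (g x (0 + r) - g x 0 - r *\<^sub>R partial i F (x + axis i 0)) /\<^sub>R r"
            by (simp add: scaleR_diff_right)
          then show "norm (g x (0 + r) - g x 0 - r *\<^sub>R partial i F (x + axis i 0)) / norm r =
            norm ((g x (0 + r) - g x 0) /\<^sub>R r - partial i F (x + axis i 0))"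
            by (simp add: divide_inverse mult.commute)
        qed
        ultimately have "((\<lambda>r. norm ((g x (0 + r) - g x 0) /\<^sub>R r - partial i F (x + axis i 0))) \<longlongrightarrow> 0) (at 0)"
          by (rule Lim_transform_eventually)
        then show ?thesis
          by (simp add: tendsto_norm_zero_iff Lim_null[symmetric])
      qed
      moreover have "filterlim s (at 0) sequentially"
      proof (rule filterlim_atI)
        show "s \<longlonglongrightarrow> 0"
          unfolding s_def by (rule LIMSEQ_inverse_real_of_nat)
        show "eventually (\<lambda>n. s n \<noteq> 0) sequentially"
          using s(1) by (intro always_eventually) (metis less_irrefl)
      qed
      ultimately have "((\<lambda>n. (g x (0 + s n) - g x 0) /\<^sub>R s n) \<longlonglongrightarrow> partial i F (x + axis i 0))"
        by (rule filterlim_compose)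
      moreover have "axis i 0 = (0::real^'n)"
        by (simp add: vec_eq_iff axis_def)
      ultimately show "(\<lambda>n. D n x) \<longlonglongrightarrow> partial i F x"
        by (simp add: D_def g_def)
    qed
    show "AE x in tor. norm (D n x) \<le> B" for n
    proof (rule AE_I2)
      fix x :: "real^'n" assume "x \<in> space tor"
      then have x: "0 < x $ j" "x $ j < 2 * pi" for j
        by (auto simp: Omega_def)
      have "norm (g x (s n) - g x 0) \<le> B * norm (s n - 0)"
      proof (rule differentiable_bound[where S = "{0..1}"])
        fix r :: real assume r: "r \<in> {0..1}"
        show "(g x has_derivative (\<lambda>h. h *\<^sub>R partial i F (x + axis i r))) (at r within {0..1})"
          using dg by (simp add: has_vector_derivative_def)
        have "x + axis i r \<in> cbox 0 (\<chi> i. 2 * pi + 1)"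
        proof -
          have "0 \<le> x $ j + (if j = i then r else 0) \<and> x $ j + (if j = i then r else 0) \<le> 2 * pi + 1" for j
            using x[of j] r by auto
          then show ?thesis
            by (simp add: mem_box_cart axis_def)
        qed
        then show "onorm (\<lambda>h. h *\<^sub>R partial i F (x + axis i r)) \<le> B"
          using B by (simp add: onorm_scaleR_left onorm_id)
      qed (use s[of n] in auto)
      moreover have "axis i 0 = (0::real^'n)"
        by (simp add: vec_eq_iff axis_def)
      ultimately have "norm (F (x + axis i (s n)) - F x) \<le> B * s n"
        using s[of n] by (simp add: g_def)
      moreover have "norm (D n x) = norm (F (x + axis i (s n)) - F x) / s n"
        using s[of n] by (simp add: D_def divide_inverse mult.commute)
      ultimately show "norm (D n x) \<le> B"
        using s[of n] by (simp add: divide_le_eq)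
    qed
  qed (auto intro!: measurable_tor)
  moreover have "(LINT x|tor. D n x) = 0" for n
  proof -
    have "continuous_on UNIV (\<lambda>x. F (x + axis i (s n)))"
      by (rule continuous_on_compose2[OF contF]) (auto intro!: continuous_intros)
    then have "integrable tor (\<lambda>x. F (x + axis i (s n)))" "integrable tor F"
      using contF by (auto intro: integrable_tor_continuous)
    then show ?thesis
      using integral_tor_shift[OF per contF, of "s n" i] s[of n]
      by (simp add: D_def)
  qed
  ultimately show ?thesis
    by (simp add: LIMSEQ_const_iff)
qed


section \<open>The trigonometric system\<close>

lemma multi_idx_simps [simp]:
  "multi_idx 0 = 0" "multi_idx (k + l) = multi_idx k + multi_idx l"
  "multi_idx (k - l) = multi_idx k - multi_idx l" "multi_idx (- k) = - multi_idx k"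
  "multi_idx k $ i = of_int (k $ i)"
  by (simp_all add: multi_idx_def vec_eq_iff)

lemma phi_0: "phi (0 :: int^'n) x = of_real ((2 * pi) powr (- real CARD('n) / 2))"
  by (simp add: phi_def)

lemma phi_mult:
  "phi (k :: int^'n) x * phi l x = of_real ((2 * pi) powr (- real CARD('n) / 2)) * phi (k + l) x"
  by (simp add: phi_def inner_add_left exp_add[symmetric] algebra_simps)

lemma cnj_phi: "cnj (phi k x) = phi (- k) x"
  by (simp add: phi_def exp_cnj)

lemma has_derivative_phi:
  "(phi (k :: int^'n) has_derivative (\<lambda>h. \<i> * of_real (multi_idx k \<bullet> h) * phi k x)) (at x)"
proof -
  have "((\<lambda>x. exp (\<i> * of_real (multi_idx k \<bullet> x))) has_derivative
      (\<lambda>h. (\<i> * of_real (multi_idx k \<bullet> h)) * exp (\<i> * of_real (multi_idx k \<bullet> x)))) (at x)"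
  proof -
    have "((\<lambda>x. \<i> * complex_of_real (multi_idx k \<bullet> x)) has_derivative
        (\<lambda>h. \<i> * of_real (multi_idx k \<bullet> h))) (at x)"
      by (intro has_derivative_mult_right has_derivative_of_real has_derivative_inner_right has_derivative_ident)
    from has_derivative_compose[OF this DERIV_exp[unfolded has_field_derivative_def]]
    show ?thesis by (simp add: mult.commute)
  qed
  from has_derivative_mult_right[OF this, of "of_real ((2 * pi) powr (- real CARD('n) / 2))"]
  show ?thesis
    by (simp add: phi_def[abs_def] mult_ac)
qed

lemma continuous_on_phi: "continuous_on S (phi k)"
  unfolding phi_def[abs_def] by (intro continuous_intros)

lemma borel_measurable_phi [measurable]: "phi k \<in> borel_measurable borel"
  by (rule borel_measurable_continuous_onI[OF continuous_on_phi])

lemma partial_phi: "partial i (\<lambda>x. c * phi k x) = (\<lambda>x. c * (\<i> * of_int (k $ i)) * phi k x)"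
proof
  fix x
  have "((\<lambda>x. c * phi k x) has_derivative (\<lambda>h. c * (\<i> * of_real (multi_idx k \<bullet> h) * phi k x))) (at x)"
    by (rule has_derivative_mult_right[OF has_derivative_phi])
  then show "partial i (\<lambda>x. c * phi k x) x = c * (\<i> * of_int (k $ i)) * phi k x"
    by (simp add: has_derivative_imp_partial inner_axis)
qed

lemma partial_phi': "partial i (phi k) = (\<lambda>x. \<i> * of_int (k $ i) * phi k x)"
  using partial_phi[of i 1 k] by simp

lemma periodic_phi: "periodic (phi k)"
proof -
  have "exp (\<i> * of_real (multi_idx k \<bullet> (x + axis i (2 * pi)))) = exp (\<i> * of_real (multi_idx k \<bullet> x))" for x i
  proof -
    have "\<i> * complex_of_real (multi_idx k \<bullet> (x + axis i (2 * pi))) =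
        \<i> * of_real (multi_idx k \<bullet> x) + 2 * of_int (k $ i) * of_real pi * \<i>"
      by (simp add: inner_add_right inner_axis algebra_simps)
    moreover have "exp (2 * of_int (k $ i) * complex_of_real pi * \<i>) = 1"
      using exp_2pi_1_int[of "k $ i"] by (simp add: mult_ac)
    ultimately show ?thesis
      by (simp only: exp_add mult_1_right)
  qed
  then show ?thesis
    by (simp add: periodic_def phi_def)
qed

lemma phi_differentiable: "phi k differentiable (at x)"
  using has_derivative_phi differentiable_def by blast

lemma smooth_phi: "smooth (phi k)"
proof -
  have "\<exists>c. foldr partial js (phi k) = (\<lambda>x. c * phi k x)" for js
  proof (induction js)
    case Nil
    show ?case by (rule exI[of _ 1]) simp
  next
    case (Cons j js)
    then show ?case by (auto simp: partial_phi)
  qed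
  then show ?thesis
    unfolding smooth_def by (metis differentiable_cmult_left_iff phi_differentiable)
qed

text \<open>A nonzero frequency makes \<open>phi m\<close> a multiple of one of its own partial derivatives.\<close>

lemma integral_phi:
  assumes "m \<noteq> 0"
  shows "(LINT x|tor. phi m x) = 0"
proof -
  obtain i where i: "m $ i \<noteq> 0"
    using assms by (auto simp: vec_eq_iff)
  have "(LINT x|tor. partial i (phi m) x) = 0"
    by (rule integral_partial_eq_0)
      (auto simp: periodic_phi phi_differentiable partial_phi' intro!: continuous_intros continuous_on_phi)
  then show ?thesis
    using i by (simp add: partial_phi')
qed

lemma measure_tor: "measure tor (Omega :: (real^'n) set) = (2 * pi) ^ CARD('n)"
proof -
  have "measure tor (Omega :: (real^'n) set) = measure lborel (Omega :: (real^'n) set)"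
    by (simp add: measure_restrict_space)
  also have "\<dots> = (\<Prod>b\<in>Basis. ((\<chi> i. 2 * pi)::real^'n) \<bullet> b)"
    unfolding Omega_eq_box
    by (subst measure_lborel_box_eq) (auto simp: Basis_vec_def inner_axis less_imp_le)
  also have "\<dots> = (\<Prod>b\<in>(Basis :: (real^'n) set). 2 * pi)"
    by (rule prod.cong) (auto simp: Basis_vec_def inner_axis)
  finally show ?thesis by simp
qed

lemma phi_orthonormal:
  "(LINT x|tor. phi k x * cnj (phi l x)) = of_bool (k = (l :: int^'n))"
proof -
  have eq: "phi k x * cnj (phi l x) = of_real ((2 * pi) powr (- real CARD('n) / 2)) * phi (k - l) x" for x
    by (simp add: cnj_phi phi_mult)
  show ?thesis
  proof (cases "k = l")
    case True
    have "(2 * pi) powr (- real CARD('n) / 2) * (2 * pi) powr (- real CARD('n) / 2) * (2 * pi) ^ CARD('n) = 1"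
    proof -
      have "(2 * pi) ^ CARD('n) = (2 * pi) powr real CARD('n)"
        by (rule powr_realpow[symmetric]) simp
      moreover have "- real CARD('n) / 2 + - real CARD('n) / 2 + real CARD('n) = 0"
        by simp
      ultimately show ?thesis
        by (simp only: powr_add[symmetric]) simp
    qed
    then have "complex_of_real ((2 * pi) powr (- real CARD('n) / 2)) * of_real ((2 * pi) powr (- real CARD('n) / 2)) *
        of_real ((2 * pi) ^ CARD('n)) = 1"
      by (metis of_real_1 of_real_mult)
    then show ?thesis
      unfolding eq using True by (simp add: phi_0 measure_tor scaleR_conv_of_real mult_ac)
  next
    case False
    then show ?thesis
      unfolding eq by (simp add: integral_phi)
  qed
qed

section \<open>Square integrable functions\<close>

definition sq_integrable :: "(real^'n \<Rightarrow> complex) \<Rightarrow> bool" where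
  "sq_integrable f \<longleftrightarrow> f \<in> borel_measurable borel \<and> integrable tor (\<lambda>x. (cmod (f x))\<^sup>2)"

definition sqnorm :: "(real^'n \<Rightarrow> complex) \<Rightarrow> real" where
  "sqnorm f = (LINT x|tor. (cmod (f x))\<^sup>2)"

lemma L2p_iff: "v \<in> L2p \<longleftrightarrow> periodic v \<and> sq_integrable v"
  by (auto simp: L2p_def sq_integrable_def set_integrable_tor_iff)

lemma fcoef_tor: "fcoef v k = (LINT x|tor. v x * cnj (phi k x))"
  by (simp add: fcoef_def set_integral_tor)

lemma sqnorm_nonneg: "sqnorm f \<ge> 0"
  by (simp add: sqnorm_def)

lemma sq_integrable_measurable: "sq_integrable f \<Longrightarrow> f \<in> borel_measurable borel" "sq_integrable f \<Longrightarrow> f \<in> borel_measurable tor"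
  by (auto simp: sq_integrable_def intro: measurable_tor)

lemma sq_integrable_bounded:
  assumes "f \<in> borel_measurable borel" "\<And>x. x \<in> Omega \<Longrightarrow> cmod (f x) \<le> B"
  shows "sq_integrable f"
  unfolding sq_integrable_def
proof
  have [measurable]: "f \<in> borel_measurable borel" by fact
  show "integrable tor (\<lambda>x. (cmod (f x))\<^sup>2)"
    by (rule integrable_tor_bounded[where B = "B\<^sup>2"]) (auto intro!: power_mono assms(2))
qed fact

lemma sq_integrable_continuous:
  assumes "continuous_on UNIV f" shows "sq_integrable f"
  using continuous_bounded_Omega[OF assms] sq_integrable_bounded borel_measurable_continuous_onI[OF assms]
  by metis

lemma sq_integrable_phi: "sq_integrable (phi k)"
  by (rule sq_integrable_continuous[OF continuous_on_phi])

lemma sq_integrable_cnj: "sq_integrable f \<Longrightarrow> sq_integrable (\<lambda>x. cnj (f x))"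
  using measurable_compose[of f borel borel cnj borel, OF _ borel_measurable_continuous_onI]
  by (auto simp: sq_integrable_def continuous_on_cnj)

lemma sq_integrable_cmult: "sq_integrable f \<Longrightarrow> sq_integrable (\<lambda>x. c * f x)"
  by (auto simp: sq_integrable_def norm_mult power_mult_distrib)

lemma sq_norm_add_le: "(cmod (a + b))\<^sup>2 \<le> 2 * (cmod a)\<^sup>2 + 2 * (cmod b)\<^sup>2"
proof -
  have "(cmod (a + b))\<^sup>2 \<le> (cmod a + cmod b)\<^sup>2"
    by (rule power_mono[OF norm_triangle_ineq]) simp
  also have "\<dots> \<le> 2 * (cmod a)\<^sup>2 + 2 * (cmod b)\<^sup>2"
    using sum_squares_bound[of "cmod a" "cmod b"] by (simp add: power2_sum)
  finally show ?thesis .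
qed

lemma sq_integrable_add:
  assumes "sq_integrable f" "sq_integrable g" shows "sq_integrable (\<lambda>x. f x + g x)"
  unfolding sq_integrable_def
proof
  have [measurable]: "f \<in> borel_measurable borel" "g \<in> borel_measurable borel"
    using assms by (auto simp: sq_integrable_def)
  show "(\<lambda>x. f x + g x) \<in> borel_measurable borel" by measurable
  show "integrable tor (\<lambda>x. (cmod (f x + g x))\<^sup>2)"
  proof (rule Bochner_Integration.integrable_bound)
    show "integrable tor (\<lambda>x. 2 * (cmod (f x))\<^sup>2 + 2 * (cmod (g x))\<^sup>2)"
      using assms by (auto simp: sq_integrable_def)
  qed (auto intro!: measurable_tor sq_norm_add_le)
qed

lemma sq_integrable_diff: "sq_integrable f \<Longrightarrow> sq_integrable g \<Longrightarrow> sq_integrable (\<lambda>x. f x - g x)"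
  using sq_integrable_add[of f "\<lambda>x. (- 1) * g x"] sq_integrable_cmult[of g "- 1"] by simp

lemma sq_integrable_sum: "(\<And>k. k \<in> A \<Longrightarrow> sq_integrable (f k)) \<Longrightarrow> sq_integrable (\<lambda>x. \<Sum>k\<in>A. f k x)"
  by (induction A rule: infinite_finite_induct) (auto intro: sq_integrable_add sq_integrable_continuous)

lemma sq_integrable_mult_bounded:
  assumes f: "sq_integrable f" and b [measurable]: "b \<in> borel_measurable borel" and B: "\<And>x. cmod (b x) \<le> B"
  shows "sq_integrable (\<lambda>x. b x * f x)"
  unfolding sq_integrable_def
proof
  have [measurable]: "f \<in> borel_measurable borel"
    using f by (auto simp: sq_integrable_def)
  show "(\<lambda>x. b x * f x) \<in> borel_measurable borel" by measurable
  have "(cmod (b x * f x))\<^sup>2 \<le> B\<^sup>2 * (cmod (f x))\<^sup>2" for x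
    using B[of x] by (auto simp: norm_mult power_mult_distrib intro!: mult_right_mono power_mono)
  moreover have "integrable tor (\<lambda>x. B\<^sup>2 * (cmod (f x))\<^sup>2)"
    using f by (auto simp: sq_integrable_def)
  ultimately show "integrable tor (\<lambda>x. (cmod (b x * f x))\<^sup>2)"
    by (elim Bochner_Integration.integrable_bound) (auto intro!: measurable_tor)
qed

lemma sqnorm_cmult: "sqnorm (\<lambda>x. c * f x) = (cmod c)\<^sup>2 * sqnorm f"
  by (simp add: sqnorm_def norm_mult power_mult_distrib)

lemma sqnorm_add_le:
  assumes "sq_integrable f" "sq_integrable g"
  shows "sqnorm (\<lambda>x. f x + g x) \<le> 2 * sqnorm f + 2 * sqnorm g"
proof -
  have "sqnorm (\<lambda>x. f x + g x) \<le> (LINT x|tor. 2 * (cmod (f x))\<^sup>2 + 2 * (cmod (g x))\<^sup>2)"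
    unfolding sqnorm_def
    using assms sq_integrable_add[OF assms] by (intro integral_mono) (auto simp: sq_integrable_def sq_norm_add_le)
  then show ?thesis
    using assms by (simp add: sqnorm_def sq_integrable_def)
qed

lemma integrable_norm_prod:
  assumes "sq_integrable f" "sq_integrable g"
  shows "integrable tor (\<lambda>x. cmod (f x) * cmod (g x))"
proof (rule Bochner_Integration.integrable_bound)
  have [measurable]: "f \<in> borel_measurable borel" "g \<in> borel_measurable borel"
    using assms by (auto simp: sq_integrable_def)
  show "integrable tor (\<lambda>x. (cmod (f x))\<^sup>2 + (cmod (g x))\<^sup>2)"
    using assms by (auto simp: sq_integrable_def)
  show "(\<lambda>x. cmod (f x) * cmod (g x)) \<in> borel_measurable tor"
    by (rule measurable_tor) measurable
  have "cmod (f x) * cmod (g x) \<le> (cmod (f x))\<^sup>2 + (cmod (g x))\<^sup>2" for x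
  proof -
    have "2 * (cmod (f x) * cmod (g x)) \<le> (cmod (f x))\<^sup>2 + (cmod (g x))\<^sup>2"
      using sum_squares_bound[of "cmod (f x)" "cmod (g x)"] by (simp only: mult.assoc)
    moreover have "0 \<le> cmod (f x) * cmod (g x)" by simp
    ultimately show ?thesis by linarith
  qed
  then show "AE x in tor. norm (cmod (f x) * cmod (g x)) \<le> norm ((cmod (f x))\<^sup>2 + (cmod (g x))\<^sup>2)"
    by auto
qed

lemma integrable_prod:
  assumes "sq_integrable f" "sq_integrable g"
  shows "integrable tor (\<lambda>x. f x * g x)"
proof (rule Bochner_Integration.integrable_bound[OF integrable_norm_prod[OF assms]])
  have [measurable]: "f \<in> borel_measurable borel" "g \<in> borel_measurable borel"
    using assms by (auto simp: sq_integrable_def)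
  show "(\<lambda>x. f x * g x) \<in> borel_measurable tor"
    by (rule measurable_tor) measurable
qed (simp add: norm_mult)

text \<open>The discriminant of a quadratic polynomial in \<open>s\<close> that is nonnegative for all real \<open>s\<close>.\<close>

lemma Cauchy_Schwarz_tor:
  assumes "sq_integrable f" "sq_integrable g"
  shows "(LINT x|tor. cmod (f x) * cmod (g x)) \<le> sqrt (sqnorm f) * sqrt (sqnorm g)"
proof -
  define c where "c = (LINT x|tor. cmod (f x) * cmod (g x))"
  have c0: "c \<ge> 0" by (simp add: c_def)
  have quad: "2 * s * c \<le> s\<^sup>2 * sqnorm f + sqnorm g" for s
  proof -
    have "(LINT x|tor. 2 * s * (cmod (f x) * cmod (g x))) \<le> (LINT x|tor. s\<^sup>2 * (cmod (f x))\<^sup>2 + (cmod (g x))\<^sup>2)"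
    proof (rule integral_mono)
      show "2 * s * (cmod (f x) * cmod (g x)) \<le> s\<^sup>2 * (cmod (f x))\<^sup>2 + (cmod (g x))\<^sup>2" for x
        using sum_squares_bound[of "s * cmod (f x)" "cmod (g x)"] by (simp add: power_mult_distrib mult_ac)
    qed (use assms integrable_norm_prod[OF assms] in \<open>auto simp: sq_integrable_def\<close>)
    then show ?thesis
      using assms by (simp add: c_def sqnorm_def sq_integrable_def)
  qed
  have "c\<^sup>2 \<le> sqnorm f * sqnorm g"
  proof (cases "sqnorm f = 0")
    case True
    have "c = 0"
    proof (rule ccontr)
      assume "c \<noteq> 0"
      then show False
        using quad[of "(sqnorm g + 1) / (2 * c)"] True by simp
    qed
    then show ?thesis using True by simp
  next
    case False
    then have "sqnorm f > 0" using sqnorm_nonneg[of f] by simp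
    then show ?thesis
      using quad[of "c / sqnorm f"] by (simp add: field_simps power2_eq_square)
  qed
  then show ?thesis
    using c0 by (simp add: c_def[symmetric] real_le_rsqrt real_sqrt_mult[symmetric])
qed

lemma fcoef_add: "sq_integrable f \<Longrightarrow> sq_integrable g \<Longrightarrow> fcoef (\<lambda>x. f x + g x) k = fcoef f k + fcoef g k"
  using integrable_prod[of f "\<lambda>x. cnj (phi k x)"] integrable_prod[of g "\<lambda>x. cnj (phi k x)"]
  by (simp add: fcoef_tor distrib_right sq_integrable_cnj sq_integrable_phi)

lemma fcoef_cmult: "fcoef (\<lambda>x. c * f x) k = c * fcoef f k"
  by (simp add: fcoef_tor mult.assoc)

lemma fcoef_diff: "sq_integrable f \<Longrightarrow> sq_integrable g \<Longrightarrow> fcoef (\<lambda>x. f x - g x) k = fcoef f k - fcoef g k"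
  using fcoef_add[of f "\<lambda>x. (- 1) * g x" k] sq_integrable_cmult[of g "- 1"] fcoef_cmult[of "- 1" g k] by simp

lemma fcoef_phi: "fcoef (phi k) l = of_bool (k = l)"
  by (simp add: fcoef_tor phi_orthonormal)

lemma sq_integrable_trig: "sq_integrable (\<lambda>x. \<Sum>k\<in>\<Lambda>. a k * phi k x)"
  by (intro sq_integrable_sum sq_integrable_cmult sq_integrable_phi)

lemma fcoef_trig:
  assumes "finite \<Lambda>"
  shows "fcoef (\<lambda>x. \<Sum>k\<in>\<Lambda>. a k * phi k x) l = (if l \<in> \<Lambda> then a l else 0)"
  using assms
proof (induction \<Lambda>)
  case empty
  then show ?case by (simp add: fcoef_tor)
next
  case (insert k \<Lambda>)
  then show ?case
    by (auto simp: fcoef_add fcoef_cmult fcoef_phi sq_integrable_trig sq_integrable_cmult sq_integrable_phi)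
qed

text \<open>Pythagoras: among trigonometric polynomials with frequencies in \<open>\<Lambda>\<close>, the partial Fourier sum
  is the best approximation in mean square.\<close>

lemma sqnorm_diff_trig:
  assumes f: "sq_integrable f" and "finite \<Lambda>"
  shows "sqnorm (\<lambda>x. f x - (\<Sum>k\<in>\<Lambda>. a k * phi k x)) =
    sqnorm f - (\<Sum>k\<in>\<Lambda>. (cmod (fcoef f k))\<^sup>2) + (\<Sum>k\<in>\<Lambda>. (cmod (fcoef f k - a k))\<^sup>2)"
proof -
  have sqnorm_complex: "complex_of_real (sqnorm g) = (LINT x|tor. g x * cnj (g x))" if "sq_integrable g" for g :: "real^'n \<Rightarrow> complex"
    by (simp only: sqnorm_def complex_norm_square integral_complex_of_real[symmetric])
  define T where "T x = (\<Sum>k\<in>\<Lambda>. a k * phi k x)" for x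
  have T: "sq_integrable T" unfolding T_def by (rule sq_integrable_trig)
  have fT: "(LINT x|tor. g x * cnj (T x)) = (\<Sum>k\<in>\<Lambda>. cnj (a k) * fcoef g k)" if g: "sq_integrable g" for g
  proof -
    have "(LINT x|tor. g x * cnj (T x)) = (LINT x|tor. (\<Sum>k\<in>\<Lambda>. cnj (a k) * (g x * cnj (phi k x))))"
      by (simp add: T_def sum_distrib_left mult_ac)
    also have "\<dots> = (\<Sum>k\<in>\<Lambda>. (LINT x|tor. cnj (a k) * (g x * cnj (phi k x))))"
      using integrable_prod[OF g sq_integrable_cnj[OF sq_integrable_phi]] by (intro Bochner_Integration.integral_sum) simp
    finally show ?thesis by (simp add: fcoef_tor)
  qed
  have TT: "(\<Sum>k\<in>\<Lambda>. cnj (a k) * fcoef T k) = (\<Sum>k\<in>\<Lambda>. cnj (a k) * a k)"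
    using assms by (intro sum.cong) (auto simp: T_def[abs_def] fcoef_trig)
  have Tf: "(LINT x|tor. T x * cnj (f x)) = cnj (LINT x|tor. f x * cnj (T x))"
  proof -
    have "(LINT x|tor. T x * cnj (f x)) = (LINT x|tor. cnj (f x * cnj (T x)))"
      by (simp add: mult.commute)
    also have "\<dots> = cnj (LINT x|tor. f x * cnj (T x))"
      by (rule Bochner_Integration.integral_cnj)
    finally show ?thesis .
  qed
  have "complex_of_real (sqnorm (\<lambda>x. f x - T x)) = (LINT x|tor. (f x - T x) * cnj (f x - T x))"
    using f T by (intro sqnorm_complex sq_integrable_diff)
  also have "\<dots> = (LINT x|tor. f x * cnj (f x) - f x * cnj (T x) - T x * cnj (f x) + T x * cnj (T x))"
    by (rule Bochner_Integration.integral_cong) (auto simp: algebra_simps)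
  also have "\<dots> = (LINT x|tor. f x * cnj (f x)) - (LINT x|tor. f x * cnj (T x))
      - (LINT x|tor. T x * cnj (f x)) + (LINT x|tor. T x * cnj (T x))"
    using integrable_prod[OF f sq_integrable_cnj[OF f]] integrable_prod[OF f sq_integrable_cnj[OF T]]
      integrable_prod[OF T sq_integrable_cnj[OF f]] integrable_prod[OF T sq_integrable_cnj[OF T]] by simp
  also have "\<dots> = sqnorm f - (\<Sum>k\<in>\<Lambda>. cnj (a k) * fcoef f k) - cnj (\<Sum>k\<in>\<Lambda>. cnj (a k) * fcoef f k)
      + (\<Sum>k\<in>\<Lambda>. cnj (a k) * a k)"
    unfolding sqnorm_complex[OF f] Tf fT[OF f] fT[OF T] TT ..
  also have "\<dots> = of_real (sqnorm f - (\<Sum>k\<in>\<Lambda>. (cmod (fcoef f k))\<^sup>2) + (\<Sum>k\<in>\<Lambda>. (cmod (fcoef f k - a k))\<^sup>2))"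
    by (simp del: of_real_power add: complex_norm_square sum_subtractf[symmetric] sum.distrib[symmetric] algebra_simps)
  finally show ?thesis
    unfolding T_def by (simp only: of_real_eq_iff)
qed


section \<open>Completeness of the trigonometric system\<close>

text \<open>Generating trigonometric polynomials from single exponentials makes closure under products an
  induction, without bookkeeping of index sets.\<close>

inductive trig_poly :: "(real^'n \<Rightarrow> complex) \<Rightarrow> bool" where
  single: "trig_poly (\<lambda>x. c * phi k x)"
| add: "trig_poly f \<Longrightarrow> trig_poly g \<Longrightarrow> trig_poly (\<lambda>x. f x + g x)"

lemma trig_poly_repr:
  assumes "trig_poly f"
  shows "\<exists>\<Lambda> a. finite \<Lambda> \<and> f = (\<lambda>x. \<Sum>k\<in>\<Lambda>. a k * phi k x)"
  using assms
proof induction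
  case (single c k)
  show ?case
    by (rule exI[of _ "{k}"], rule exI[of _ "\<lambda>_. c"]) simp
next
  case (add f g)
  then obtain A a B b where *: "finite A" "f = (\<lambda>x. \<Sum>k\<in>A. a k * phi k x)"
    "finite B" "g = (\<lambda>x. \<Sum>k\<in>B. b k * phi k x)" by blast
  define c where "c k = (if k \<in> A then a k else 0) + (if k \<in> B then b k else 0)" for k
  have "f x + g x = (\<Sum>k\<in>A \<union> B. c k * phi k x)" for x
  proof -
    have "f x = (\<Sum>k\<in>A \<union> B. (if k \<in> A then a k else 0) * phi k x)"
      unfolding * by (rule sum.mono_neutral_cong_left) (use * in auto)
    moreover have "g x = (\<Sum>k\<in>A \<union> B. (if k \<in> B then b k else 0) * phi k x)"
      unfolding * by (rule sum.mono_neutral_cong_left) (use * in auto)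
    ultimately show ?thesis
      by (simp add: c_def distrib_right sum.distrib)
  qed
  with * show ?case
    by (intro exI[of _ "A \<union> B"] exI[of _ c]) auto
qed

lemma trig_poly_sq_integrable: "trig_poly f \<Longrightarrow> sq_integrable f"
  by (induction rule: trig_poly.induct) (auto intro: sq_integrable_add sq_integrable_cmult sq_integrable_phi)

lemma trig_poly_phi_mult: "trig_poly f \<Longrightarrow> trig_poly (\<lambda>x. (c * phi k x) * f x)"
proof (induction rule: trig_poly.induct)
  case (single c' k')
  have "c * phi k x * (c' * phi k' x) =
      (c * c' * of_real ((2 * pi) powr (- real CARD('a) / 2))) * phi (k + k') x" for x
    using phi_mult[of k x k'] by (simp add: mult_ac)
  then show ?case
    by (simp only: trig_poly.single)
next
  case (add f g)
  then show ?case
    by (simp only: distrib_left trig_poly.add)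
qed

lemma trig_poly_mult: "trig_poly f \<Longrightarrow> trig_poly g \<Longrightarrow> trig_poly (\<lambda>x. f x * g x)"
proof (induction rule: trig_poly.induct)
  case (single c k)
  then show ?case by (rule trig_poly_phi_mult)
next
  case (add f h)
  then show ?case
    by (simp only: distrib_right trig_poly.add)
qed

lemma trig_poly_const: "trig_poly (\<lambda>x :: real^'n. c)"
  using trig_poly.single[of "c / of_real ((2 * pi) powr (- real CARD('n) / 2))" "0 :: int^'n"]
  by (simp add: phi_0)

lemma trig_poly_sum: "(\<And>j. j \<in> A \<Longrightarrow> trig_poly (f j)) \<Longrightarrow> trig_poly (\<lambda>x. \<Sum>j\<in>A. f j x)"
  by (induction A rule: infinite_finite_induct) (auto intro: trig_poly_const trig_poly.add)

lemma trig_poly_exp: "trig_poly (\<lambda>x :: real^'n. exp (\<i> * of_int m * of_real (x $ j)))"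
proof -
  have "multi_idx (axis j m :: int^'n) = axis j (of_int m)"
    by (simp add: vec_eq_iff multi_idx_def axis_def)
  then have "exp (\<i> * of_int m * of_real (x $ j)) =
      (1 / of_real ((2 * pi) powr (- real CARD('n) / 2))) * phi (axis j m) x" for x :: "real^'n"
    by (simp add: phi_def inner_axis' mult_ac)
  then show ?thesis
    by (simp only: trig_poly.single)
qed

lemma trig_poly_cos_sin:
  shows "trig_poly (\<lambda>x :: real^'n. of_real (cos (x $ j)))" "trig_poly (\<lambda>x :: real^'n. of_real (sin (x $ j)))"
proof -
  have e: "exp (\<i> * of_int m * of_real r) = cis (of_int m * r)" for m r
    by (simp add: cis_conv_exp mult_ac)
  have "complex_of_real (cos r) = 1/2 * exp (\<i> * of_int 1 * of_real r) + 1/2 * exp (\<i> * of_int (-1) * of_real r)" for r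
    unfolding e by (simp add: complex_eq_iff)
  then show "trig_poly (\<lambda>x :: real^'n. of_real (cos (x $ j)))"
    by (simp only:) (intro trig_poly.add trig_poly_mult trig_poly_const trig_poly_exp)
  have "complex_of_real (sin r) = (- \<i>/2) * exp (\<i> * of_int 1 * of_real r) + (\<i>/2) * exp (\<i> * of_int (-1) * of_real r)" for r
    unfolding e by (simp add: complex_eq_iff)
  then show "trig_poly (\<lambda>x :: real^'n. of_real (sin (x $ j)))"
    by (simp only:) (intro trig_poly.add trig_poly_mult trig_poly_const trig_poly_exp)
qed

text \<open>The embedding of the torus as a product of unit circles.\<close>

definition torus_map :: "real^'n \<Rightarrow> complex^'n" where
  "torus_map x = (\<chi> j. cis (x $ j))"

text \<open>The coordinates of \<open>torus_map x\<close> have real and imaginary parts \<open>cos (x $ j)\<close> and \<open>sin (x $ j)\<close>,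
  which are trigonometric polynomials.\<close>

lemma trig_poly_real_polynomial:
  assumes "real_polynomial_function h"
  shows "trig_poly (\<lambda>x :: real^'n. of_real (h (torus_map x)))"
  using assms
proof induction
  case (linear h)
  interpret bounded_linear h by fact
  have "h (torus_map x) = (\<Sum>j\<in>UNIV. cos (x $ j) * h (axis j 1) + sin (x $ j) * h (axis j \<i>))" for x :: "real^'n"
  proof -
    have "torus_map x = (\<Sum>j\<in>UNIV. cos (x $ j) *\<^sub>R axis j 1 + sin (x $ j) *\<^sub>R axis j \<i>)"
      by (simp add: vec_eq_iff torus_map_def complex_eq_iff axis_def if_distrib if_distribR sum.distrib cong: if_cong)
    then show ?thesis
      by (simp add: sum add scaleR)
  qed
  then show ?case
    by (simp only: of_real_sum of_real_add of_real_mult)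
      (intro trig_poly_sum trig_poly.add trig_poly_mult trig_poly_cos_sin trig_poly_const)
next
  case (const c)
  then show ?case by (rule trig_poly_const)
next
  case (add f g)
  then show ?case by (simp only: of_real_add trig_poly.add)
next
  case (mult f g)
  then show ?case by (simp only: of_real_mult trig_poly_mult)
qed

lemma trig_poly_polynomial:
  assumes "polynomial_function (p :: complex^'n \<Rightarrow> complex)"
  shows "trig_poly (\<lambda>x :: real^'n. p (torus_map x))"
proof -
  have "real_polynomial_function (Re \<circ> p)" "real_polynomial_function (Im \<circ> p)"
    using assms bounded_linear_Re bounded_linear_Im by (auto simp: polynomial_function_def)
  note * = this[THEN trig_poly_real_polynomial]
  have "p z = of_real ((Re \<circ> p) z) + \<i> * of_real ((Im \<circ> p) z)" for z
    by (simp add: complex_eq_iff)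
  then show ?thesis
    by (simp only:) (intro trig_poly.add trig_poly_mult * trig_poly_const)
qed

lemma Arg2pi_cis: "0 \<le> r \<Longrightarrow> r < 2 * pi \<Longrightarrow> Arg2pi (cis r) = r"
  by (rule Arg2pi_unique[of 1]) (auto simp: cis_conv_exp)

text \<open>A function supported away from the faces of the cube descends to a continuous function on the
  product of unit circles, where Stone-Weierstrass applies; polynomials in the coordinates of the
  circles are trigonometric polynomials. The jump of the argument at \<open>1\<close> is harmless, since the
  function vanishes near it.\<close>

lemma trig_poly_approx_uniform:
  fixes f :: "real^'n \<Rightarrow> complex"
  assumes f: "continuous_on UNIV f" and \<delta>: "0 < \<delta>" "\<delta> < pi"
    and supp: "\<And>x i. x $ i < \<delta> \<or> x $ i > 2 * pi - \<delta> \<Longrightarrow> f x = 0" and "e > 0"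
  shows "\<exists>T. trig_poly T \<and> (\<forall>x\<in>Omega. cmod (f x - T x) < e)"
proof -
  define S where "S = {z :: complex^'n. \<forall>i. cmod (z $ i) = 1}"
  define F where "F z = f (\<chi> i. Arg2pi (z $ i))" for z :: "complex^'n"
  have "closed S"
    unfolding S_def by (intro closed_Collect_all closed_Collect_eq continuous_intros)
  moreover have "bounded S"
    unfolding bounded_iff
  proof (intro exI ballI)
    fix z :: "complex^'n" assume "z \<in> S"
    then show "norm z \<le> real CARD('n)"
      using L2_set_le_sum[of UNIV "\<lambda>i. norm (z $ i)"] by (simp add: norm_vec_def S_def)
  qed
  ultimately have "compact S"
    by (simp add: compact_eq_bounded_closed)
  have near: "F z = 0" if "z \<in> S" "Re (z $ i) > cos \<delta>" for z i
  proof -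
    define r where "r = Arg2pi (z $ i)"
    have r: "0 \<le> r" "r < 2 * pi" using Arg2pi[of "z $ i"] by (auto simp: r_def)
    have "cos r = Re (z $ i)"
      using cos_Arg2pi[of "z $ i"] that by (simp add: S_def r_def)
    then have "cos r > cos \<delta>" using that by simp
    have "r < \<delta> \<or> r > 2 * pi - \<delta>"
    proof (rule ccontr)
      assume "\<not> ?thesis"
      then have *: "\<delta> \<le> r" "r \<le> 2 * pi - \<delta>" by auto
      have "cos r \<le> cos \<delta>"
      proof (cases "r \<le> pi")
        case True
        then show ?thesis using * \<delta> by (intro cos_monotone_0_pi_le) auto
      next
        case False
        then have "cos (2 * pi - r) \<le> cos \<delta>" using * \<delta> by (intro cos_monotone_0_pi_le) auto
        then show ?thesis by simp
      qed
      then show False using \<open>cos r > cos \<delta>\<close> by simp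
    qed
    then show ?thesis
      unfolding F_def by (intro supp[of _ i]) (auto simp: r_def)
  qed
  have "continuous (at z within S) F" if z: "z \<in> S" for z
  proof (cases "\<exists>i. z $ i \<in> \<real>\<^sub>\<ge>\<^sub>0")
    case True
    then obtain i where "z $ i \<in> \<real>\<^sub>\<ge>\<^sub>0" by blast
    then have "z $ i = 1" 
    proof (rule nonneg_Reals_cases)
      fix r assume r: "z $ i = of_real r" "r \<ge> 0"
      have "cmod (z $ i) = 1" using z by (simp add: S_def)
      then show ?thesis using r by simp
    qed
    then have zi: "Re (z $ i) > cos \<delta>"
      using \<delta> cos_monotone_0_pi[of 0 \<delta>] by simp
    have "open {w :: complex^'n. cos \<delta> < Re (w $ i)}"
      by (intro open_Collect_less continuous_intros)
    then have "eventually (\<lambda>w. w \<in> {w. cos \<delta> < Re (w $ i)}) (at z within S)"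
      using zi by (intro eventually_at_topological[THEN iffD2] exI[of _ "{w. cos \<delta> < Re (w $ i)}"]) auto
    moreover have "eventually (\<lambda>w. w \<in> S) (at z within S)"
      by (simp add: eventually_at_filter)
    ultimately have "eventually (\<lambda>w. 0 = F w) (at z within S)"
      by eventually_elim (auto simp: near)
    then have "(F \<longlongrightarrow> 0) (at z within S)"
      by (rule Lim_transform_eventually[OF tendsto_const])
    then show ?thesis
      using near[OF z zi] by (simp add: continuous_within)
  next
    case False
    have "isCont (\<lambda>w. Arg2pi (w $ i)) z" for i
    proof (rule isCont_o2[where g = Arg2pi])
      show "isCont (\<lambda>w. w $ i) z"
        by (rule linear_continuous_at) (rule bounded_linear_vec_nth)
      show "isCont Arg2pi (z $ i)"
        using False by (intro continuous_at_Arg2pi) blast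
    qed
    then have "((\<lambda>w. \<chi> i. Arg2pi (w $ i)) \<longlongrightarrow> (\<chi> i. Arg2pi (z $ i))) (at z)"
      by (intro tendsto_vec_lambda) (simp add: continuous_at)
    then have "isCont (\<lambda>w. \<chi> i. Arg2pi (w $ i)) z"
      by (simp add: continuous_at)
    moreover have "isCont f (\<chi> i. Arg2pi (z $ i))"
      using f by (simp add: continuous_on_eq_continuous_at)
    ultimately have "isCont F z"
      unfolding F_def[abs_def] by (rule isCont_o2)
    then show ?thesis by (rule continuous_at_imp_continuous_at_within)
  qed
  then have "continuous_on S F"
    by (simp add: continuous_on_eq_continuous_within)
  from Stone_Weierstrass_polynomial_function[OF \<open>compact S\<close> this \<open>e > 0\<close>]
  obtain p where p: "polynomial_function p" "\<And>z. z \<in> S \<Longrightarrow> cmod (F z - p z) < e"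
    by auto
  have "cmod (f x - p (torus_map x)) < e" if x: "x \<in> Omega" for x
  proof -
    have "(\<chi> i. Arg2pi (torus_map x $ i)) = x"
      using x by (simp add: vec_eq_iff torus_map_def Omega_def Arg2pi_cis less_imp_le)
    moreover have "torus_map x \<in> S"
      by (simp add: S_def torus_map_def)
    ultimately show ?thesis
      using p(2)[of "torus_map x"] by (simp add: F_def)
  qed
  then show ?thesis
    using trig_poly_polynomial[OF p(1)] by blast
qed

text \<open>Membership in the mean-square closure of the trigonometric polynomials.\<close>

definition approximable :: "(real^'n \<Rightarrow> complex) \<Rightarrow> bool" where
  "approximable f \<longleftrightarrow> sq_integrable f \<and> (\<forall>e>0. \<exists>T. trig_poly T \<and> sqnorm (\<lambda>x. f x - T x) < e)"

lemma approximable_uniform: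
  fixes f :: "real^'n \<Rightarrow> complex"
  assumes f: "sq_integrable f" and *: "\<And>e. e > 0 \<Longrightarrow> \<exists>T. trig_poly T \<and> (\<forall>x\<in>Omega. cmod (f x - T x) < e)"
  shows "approximable f"
  unfolding approximable_def
proof (intro conjI allI impI f)
  fix e :: real assume e: "e > 0"
  define m where "m = measure tor (Omega :: (real^'n) set)"
  have m: "m > 0" by (simp add: m_def measure_tor)
  define e' where "e' = sqrt (e / (2 * m))"
  have "e' > 0" using e m by (simp add: e'_def)
  then obtain T where T: "trig_poly T" "\<And>x. x \<in> Omega \<Longrightarrow> cmod (f x - T x) < e'"
    using * by blast
  have "sqnorm (\<lambda>x. f x - T x) \<le> (LINT x|(tor :: (real^'n) measure). e'\<^sup>2)"
    unfolding sqnorm_def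
  proof (rule integral_mono_AE)
    show "integrable tor (\<lambda>x. (cmod (f x - T x))\<^sup>2)"
      using sq_integrable_diff[OF f trig_poly_sq_integrable[OF T(1)]] by (simp add: sq_integrable_def)
    show "AE x in tor. (cmod (f x - T x))\<^sup>2 \<le> e'\<^sup>2"
      using T(2) by (intro AE_I2 power_mono) (auto intro: less_imp_le)
  qed simp
  also have "\<dots> = e / 2"
    using e m by (simp add: e'_def m_def[symmetric] field_simps)
  also have "\<dots> < e" using e by simp
  finally show "\<exists>T. trig_poly T \<and> sqnorm (\<lambda>x. f x - T x) < e"
    using T(1) by blast
qed

lemma approximable_limit:
  fixes f :: "real^'n \<Rightarrow> complex"
  assumes f: "sq_integrable f" and g: "\<And>n. approximable (g n)"
    and lim: "AE x in tor. (\<lambda>n. g n x) \<longlonglongrightarrow> f x"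
    and bd: "\<And>n x. x \<in> Omega \<Longrightarrow> cmod (g n x - f x) \<le> w x" and w: "integrable tor (\<lambda>x. (w x)\<^sup>2)"
  shows "approximable f"
  unfolding approximable_def
proof (intro conjI allI impI f)
  fix e :: real assume e: "e > 0"
  have gs: "sq_integrable (g n)" for n using g by (simp add: approximable_def)
  have "(\<lambda>n. LINT x|tor. (cmod (g n x - f x))\<^sup>2) \<longlonglongrightarrow> (LINT x|(tor :: (real^'n) measure). 0)"
  proof (rule integral_dominated_convergence[where w = "\<lambda>x. (w x)\<^sup>2"])
    show "AE x in tor. (\<lambda>n. (cmod (g n x - f x))\<^sup>2) \<longlonglongrightarrow> 0"
      using lim
    proof eventually_elim
      case (elim x)
      then have "(\<lambda>n. (cmod (g n x - f x))\<^sup>2) \<longlonglongrightarrow> (cmod (f x - f x))\<^sup>2"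
        by (intro tendsto_intros)
      then show ?case by simp
    qed
    show "AE x in tor. norm ((cmod (g n x - f x))\<^sup>2) \<le> (w x)\<^sup>2" for n
      using bd by (intro AE_I2) (auto intro!: power_mono)
    show "(\<lambda>x. (cmod (g n x - f x))\<^sup>2) \<in> borel_measurable tor" for n
      using sq_integrable_diff[OF gs[of n] f] by (auto simp: sq_integrable_def)
  qed (use w in auto)
  then have "(\<lambda>n. sqnorm (\<lambda>x. g n x - f x)) \<longlonglongrightarrow> 0"
    by (simp add: sqnorm_def)
  then have "eventually (\<lambda>n. sqnorm (\<lambda>x. g n x - f x) < e / 4) sequentially"
    by (rule order_tendstoD) (use e in simp)
  then obtain n where n: "sqnorm (\<lambda>x. g n x - f x) < e / 4"
    by (auto simp: eventually_sequentially)
  obtain T where T: "trig_poly T" "sqnorm (\<lambda>x. g n x - T x) < e / 4"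
    using g[of n] e unfolding approximable_def by (metis divide_pos_pos zero_less_numeral)
  have "sqnorm (\<lambda>x. (g n x - T x) + (- 1) * (g n x - f x)) \<le>
      2 * sqnorm (\<lambda>x. g n x - T x) + 2 * sqnorm (\<lambda>x. (- 1) * (g n x - f x))"
    by (intro sqnorm_add_le sq_integrable_cmult sq_integrable_diff gs f trig_poly_sq_integrable T)
  also have "sqnorm (\<lambda>x. (- 1) * (g n x - f x)) = sqnorm (\<lambda>x. g n x - f x)"
    by (subst sqnorm_cmult) simp
  finally have "sqnorm (\<lambda>x. (g n x - T x) + (- 1) * (g n x - f x)) < e"
    using n T by linarith
  then show "\<exists>T. trig_poly T \<and> sqnorm (\<lambda>x. f x - T x) < e"
    using T(1) by (intro exI[of _ T]) simp
qed

text \<open>Cutting off near the faces of the cube leaves the function unchanged in the limit and makes the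
  uniform approximation available.\<close>

lemma approximable_continuous:
  fixes f :: "real^'n \<Rightarrow> complex"
  assumes f: "continuous_on UNIV f" and "\<And>x. cmod (f x) \<le> B"
  shows "approximable f"
proof -
  \<comment> \<open>A piecewise linear bump: zero within \<open>1 / (n + 1)\<close> of the faces, one beyond twice that distance.\<close>
  define c where "c n r = max 0 (min 1 (real (Suc n) * r - 1)) * max 0 (min 1 (real (Suc n) * (2 * pi - r) - 1))"
    for n and r :: real
  define cut where "cut n x = (\<Prod>i\<in>UNIV. c n (x $ i))" for n and x :: "real^'n"
  have c01: "0 \<le> c n r" "c n r \<le> 1" for n r
    unfolding c_def by (auto intro!: mult_le_one)
  then have cut_01: "0 \<le> cut n x" "cut n x \<le> 1" for n x
    unfolding cut_def by (auto intro: prod_nonneg prod_le_1)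
  have cut_cont: "continuous_on UNIV (cut n)" for n
    unfolding cut_def[abs_def] c_def by (intro continuous_intros)
  have cut_0: "cut n x = 0" if "x $ i < inverse (Suc n) \<or> x $ i > 2 * pi - inverse (Suc n)" for n x i
  proof -
    have "real (Suc n) * (x $ i) < 1 \<or> real (Suc n) * (2 * pi - x $ i) < 1"
      using that by (auto simp: field_simps)
    then have "c n (x $ i) = 0"
      unfolding c_def by (elim disjE) (simp_all add: max_def min_def)
    then show ?thesis
      unfolding cut_def by (auto intro: prod_zero)
  qed
  have cut_lim: "(\<lambda>n. cut n x) \<longlonglongrightarrow> 1" if x: "x \<in> Omega" for x
  proof -
    have "(\<lambda>n. c n r) \<longlonglongrightarrow> 1" if "0 < r" "r < 2 * pi" for r
    proof -
      have *: "eventually (\<lambda>n. real (Suc n) * s \<ge> 2) sequentially" if "s > 0" for s :: real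
        using that by real_asymp
      have "eventually (\<lambda>n. 1 = c n r) sequentially"
        using *[OF that(1)] *[of "2 * pi - r", simplified, OF that(2)]
      proof eventually_elim
        case (elim n)
        have aux: "max 0 (min 1 (u - 1)) = 1" if "2 \<le> u" for u :: real
          using that by simp
        show ?case
          unfolding c_def using aux[OF elim(1)] aux[OF elim(2)] by simp
      qed
      then show ?thesis
        by (rule Lim_transform_eventually[OF tendsto_const])
    qed
    then have "(\<lambda>n. cut n x) \<longlonglongrightarrow> (\<Prod>i::'n\<in>UNIV. 1)"
      unfolding cut_def using x by (intro tendsto_prod) (auto simp: Omega_def)
    then show ?thesis by simp
  qed
  show ?thesis
  proof (rule approximable_limit)
    show "sq_integrable f" by (rule sq_integrable_continuous[OF f])
    show "approximable (\<lambda>x. of_real (cut n x) * f x)" for n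
    proof (rule approximable_uniform)
      have cont: "continuous_on UNIV (\<lambda>x. of_real (cut n x) * f x)"
        by (intro continuous_intros f cut_cont)
      then show "sq_integrable (\<lambda>x. of_real (cut n x) * f x)"
        by (rule sq_integrable_continuous)
      have "inverse (real (Suc n)) < pi"
      proof -
        have "inverse (real (Suc n)) \<le> 1" by (simp add: field_simps)
        then show ?thesis using pi_gt3 by linarith
      qed
      then show "\<exists>T. trig_poly T \<and> (\<forall>x\<in>Omega. cmod (of_real (cut n x) * f x - T x) < e)" if "e > 0" for e
        using cut_0 that by (intro trig_poly_approx_uniform[OF cont, of "inverse (real (Suc n))"]) auto
    qed
    show "AE x in tor. (\<lambda>n. of_real (cut n x) * f x) \<longlonglongrightarrow> f x"
    proof (rule AE_I2)
      fix x :: "real^'n" assume "x \<in> space tor"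
      then have "(\<lambda>n. of_real (cut n x) * f x) \<longlonglongrightarrow> of_real 1 * f x"
        by (intro tendsto_intros cut_lim) simp
      then show "(\<lambda>n. of_real (cut n x) * f x) \<longlonglongrightarrow> f x" by simp
    qed
    show "cmod (of_real (cut n x) * f x - f x) \<le> B" for n x
    proof -
      have "of_real (cut n x) * f x - f x = of_real (cut n x - 1) * f x"
        by (simp add: algebra_simps)
      then have "cmod (of_real (cut n x) * f x - f x) = (1 - cut n x) * cmod (f x)"
        using cut_01[of n x] by (simp only: norm_mult norm_of_real) simp
      also have "\<dots> \<le> 1 * B"
        using cut_01[of n x] assms(2)[of x] by (intro mult_mono) auto
      finally show ?thesis by simp
    qed
  qed simp
qed

lemma AE_tor_negligible:
  assumes "negligible (N :: (real^'n) set)"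
  shows "AE x in tor. x \<notin> N"
proof -
  have "AE x in lebesgue. x \<notin> N"
    using assms by (intro AE_not_in) (simp add: negligible_iff_null_sets)
  then have "AE x in lborel. x \<notin> N"
    by (simp add: AE_completion_iff)
  then show ?thesis
    by (auto simp: AE_restrict_space_iff)
qed

text \<open>Radial truncation reduces to bounded functions, which are almost everywhere limits of
  uniformly bounded continuous ones.\<close>

lemma approximable_sq_integrable:
  fixes f :: "real^'n \<Rightarrow> complex"
  assumes f: "sq_integrable f"
  shows "approximable f"
proof -
  have [measurable]: "f \<in> borel_measurable borel"
    using f by (rule sq_integrable_measurable)
  define c where "c M z = of_real (M / max M (cmod z)) * z" for M and z :: complex
  have c_cont: "continuous_on UNIV (c M)" if "M > 0" for M
    unfolding c_def[abs_def] using that by (intro continuous_intros) (auto simp: max_def)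
  have c_bd: "cmod (c M z) \<le> M" if "M > 0" for M z
    using that by (auto simp: c_def norm_mult norm_divide max_def)
  have c_diff: "cmod (c M z - z) \<le> cmod z" if "M > 0" for M z
  proof -
    have "c M z - z = of_real (M / max M (cmod z) - 1) * z"
      by (simp add: c_def algebra_simps)
    moreover have "\<bar>M / max M (cmod z) - 1\<bar> \<le> 1"
    proof -
      have "0 \<le> M / max M (cmod z)" "M / max M (cmod z) \<le> 1"
        using that by (simp_all add: le_max_iff_disj)
      then show ?thesis by linarith
    qed
    ultimately show ?thesis
      by (simp only: norm_mult norm_of_real) (simp add: mult_left_le_one_le)
  qed
  have c_id: "c M z = z" if "M > 0" "cmod z \<le> M" for M z
    using that by (simp add: c_def max_def)
  have "f \<in> borel_measurable lebesgue"
    by (simp add: measurable_completion)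
  then have "f measurable_on UNIV"
    by (rule lebesgue_measurable_imp_measurable_on) simp
  then obtain N g where N: "negligible N" and g: "\<And>n. continuous_on UNIV (g n)"
    and gf: "\<And>x. x \<notin> N \<Longrightarrow> (\<lambda>n. g n x) \<longlonglongrightarrow> f x"
    unfolding measurable_on_def by auto
  have trunc: "approximable (\<lambda>x. c M (f x))" if M: "M > 0" for M
  proof (rule approximable_limit)
    have [measurable]: "c M \<in> borel_measurable borel"
      by (rule borel_measurable_continuous_onI[OF c_cont[OF M]])
    show "sq_integrable (\<lambda>x. c M (f x))"
      by (rule sq_integrable_bounded[where B = M]) (use c_bd M in auto)
    have "continuous_on UNIV (\<lambda>x. c M (g n x))" for n
      by (rule continuous_on_compose2[OF c_cont[OF M] g]) simp
    then show "approximable (\<lambda>x. c M (g n x))" for n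
      by (rule approximable_continuous) (rule c_bd[OF M])
    show "AE x in tor. (\<lambda>n. c M (g n x)) \<longlonglongrightarrow> c M (f x)"
      using AE_tor_negligible[OF N]
    proof eventually_elim
      case (elim x)
      show ?case
        by (rule continuous_on_tendsto_compose[OF c_cont[OF M] gf[OF elim]]) auto
    qed
    show "cmod (c M (g n x) - c M (f x)) \<le> 2 * M" for n x
      using norm_triangle_ineq4[of "c M (g n x)" "c M (f x)"] c_bd[OF M, of "g n x"] c_bd[OF M, of "f x"]
      by linarith
  qed simp
  show ?thesis
  proof (rule approximable_limit[OF f])
    show "approximable (\<lambda>x. c (real (Suc n)) (f x))" for n
      by (rule trunc) simp
    show "AE x in tor. (\<lambda>n. c (real (Suc n)) (f x)) \<longlonglongrightarrow> f x"
    proof (rule AE_I2)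
      fix x :: "real^'n"
      have "eventually (\<lambda>n. real (Suc n) \<ge> cmod (f x)) sequentially"
        by real_asymp
      then have "eventually (\<lambda>n. f x = c (real (Suc n)) (f x)) sequentially"
        by eventually_elim (simp add: c_id)
      then show "(\<lambda>n. c (real (Suc n)) (f x)) \<longlonglongrightarrow> f x"
        by (rule Lim_transform_eventually[OF tendsto_const])
    qed
    show "cmod (c (real (Suc n)) (f x) - f x) \<le> cmod (f x)" for n x
      by (rule c_diff) simp
    show "integrable tor (\<lambda>x. (cmod (f x))\<^sup>2)"
      using f by (simp add: sq_integrable_def)
  qed
qed

text \<open>Bessel's inequality bounds the partial sums, and the defect is arbitrarily small because the
  partial Fourier sums are best approximations.\<close>

lemma Parseval:
  assumes f: "sq_integrable f"
  shows "((\<lambda>k. (cmod (fcoef f k))\<^sup>2) has_sum sqnorm f) UNIV"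
proof -
  have Bessel: "(\<Sum>k\<in>\<Lambda>. (cmod (fcoef f k))\<^sup>2) \<le> sqnorm f" if "finite \<Lambda>" for \<Lambda>
    using sqnorm_diff_trig[OF f that, of "fcoef f"] sqnorm_nonneg[of "\<lambda>x. f x - (\<Sum>k\<in>\<Lambda>. fcoef f k * phi k x)"]
    by simp
  show ?thesis
    unfolding has_sum_def
  proof (rule tendstoI)
    fix e :: real assume "e > 0"
    then obtain T where "trig_poly T" and T: "sqnorm (\<lambda>x. f x - T x) < e"
      using approximable_sq_integrable[OF f] unfolding approximable_def by blast
    then obtain \<Lambda> a where \<Lambda>: "finite \<Lambda>" and Ta: "T = (\<lambda>x. \<Sum>k\<in>\<Lambda>. a k * phi k x)"
      using trig_poly_repr by blast
    have "dist (\<Sum>k\<in>Y. (cmod (fcoef f k))\<^sup>2) (sqnorm f) < e" if Y: "finite Y" "\<Lambda> \<subseteq> Y" for Y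
    proof -
      have "0 \<le> (\<Sum>k\<in>\<Lambda>. (cmod (fcoef f k - a k))\<^sup>2)"
        by (simp add: sum_nonneg)
      then have "sqnorm f - e < (\<Sum>k\<in>\<Lambda>. (cmod (fcoef f k))\<^sup>2)"
        using T sqnorm_diff_trig[OF f \<Lambda>, of a] by (simp add: Ta)
      also have "\<dots> \<le> (\<Sum>k\<in>Y. (cmod (fcoef f k))\<^sup>2)"
        using Y by (intro sum_mono2) auto
      finally show ?thesis
        using Bessel[OF Y(1)] by (simp add: dist_real_def)
    qed
    then show "eventually (\<lambda>Y. dist (\<Sum>k\<in>Y. (cmod (fcoef f k))\<^sup>2) (sqnorm f) < e) (finite_subsets_at_top UNIV)"
      using \<Lambda> by (auto simp: eventually_finite_subsets_at_top)
  qed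
qed

lemma AE_0_if_fcoef_0:
  assumes f: "sq_integrable f" and "\<And>k. fcoef f k = 0"
  shows "AE x in tor. f x = 0"
proof -
  have "((\<lambda>k. (cmod (fcoef f k))\<^sup>2) has_sum 0) UNIV"
    by (rule has_sum_0) (simp add: assms)
  then have "sqnorm f = 0"
    using Parseval[OF f] has_sum_unique by blast
  then show ?thesis
    using f by (auto simp: sqnorm_def sq_integrable_def integral_nonneg_eq_0_iff_AE)
qed


section \<open>Weak derivatives and the Sobolev norm\<close>

lemma smooth_differentiable: "smooth \<psi> \<Longrightarrow> \<psi> differentiable (at x)"
  unfolding smooth_def by (metis foldr.simps(1) id_apply)

lemma smooth_continuous_partial:
  assumes "smooth \<psi>" shows "continuous_on UNIV (partial i \<psi>)"
proof -
  have "foldr partial [i] \<psi> differentiable (at x)" for x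
    using assms unfolding smooth_def by blast
  then show ?thesis
    by (auto intro!: continuous_at_imp_continuous_on differentiable_imp_continuous_within)
qed

lemma smooth_continuous: "smooth \<psi> \<Longrightarrow> continuous_on UNIV \<psi>"
  by (auto intro!: continuous_at_imp_continuous_on differentiable_imp_continuous_within smooth_differentiable)

lemma L2p_sq_integrable: "v \<in> L2p \<Longrightarrow> sq_integrable v"
  by (simp add: L2p_iff)

lemma L2p_add: "v \<in> L2p \<Longrightarrow> w \<in> L2p \<Longrightarrow> (\<lambda>x. v x + w x) \<in> L2p"
  by (auto simp: L2p_iff periodic_def sq_integrable_add)

lemma L2p_cmult: "v \<in> L2p \<Longrightarrow> (\<lambda>x. c * v x) \<in> L2p"
  by (auto simp: L2p_iff periodic_def sq_integrable_cmult)

lemma L2p_phi: "phi k \<in> L2p"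
  by (simp add: L2p_iff periodic_phi sq_integrable_phi)

lemma weak_partial_L2p: "weak_partial i v g \<Longrightarrow> g \<in> L2p"
  by (simp add: weak_partial_def)

lemma weak_partial_tor:
  "weak_partial i v g \<longleftrightarrow> g \<in> L2p \<and> (\<forall>\<psi>. smooth \<psi> \<and> periodic \<psi> \<longrightarrow>
    (LINT x|tor. v x * partial i \<psi> x) = - (LINT x|tor. g x * \<psi> x))"
  by (simp add: weak_partial_def set_integral_tor)

lemma weak_partial_add:
  assumes v: "v \<in> L2p" "weak_partial i v g" and w: "w \<in> L2p" "weak_partial i w h"
  shows "weak_partial i (\<lambda>x. v x + w x) (\<lambda>x. g x + h x)"
  unfolding weak_partial_tor
proof (intro conjI allI impI)
  show "(\<lambda>x. g x + h x) \<in> L2p"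
    using assms by (intro L2p_add) (auto intro: weak_partial_L2p)
  fix \<psi> :: "real^'a \<Rightarrow> complex" assume \<psi>: "smooth \<psi> \<and> periodic \<psi>"
  have \<psi>s: "sq_integrable \<psi>" "sq_integrable (partial i \<psi>)"
    using \<psi> by (auto intro: sq_integrable_continuous smooth_continuous smooth_continuous_partial)
  have "sq_integrable g" "sq_integrable h" "sq_integrable v" "sq_integrable w"
    using assms by (auto intro: L2p_sq_integrable weak_partial_L2p)
  note int = this[THEN integrable_prod, OF \<psi>s(1)] this[THEN integrable_prod, OF \<psi>s(2)]
  show "(LINT x|tor. (v x + w x) * partial i \<psi> x) = - (LINT x|tor. (g x + h x) * \<psi> x)"
    using v(2) w(2) \<psi> int by (simp add: weak_partial_tor distrib_right)
qed

lemma weak_partial_cmult: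
  assumes "weak_partial i v g" shows "weak_partial i (\<lambda>x. c * v x) (\<lambda>x. c * g x)"
  using assms by (simp add: weak_partial_tor L2p_cmult mult.assoc)

text \<open>Integration by parts on the torus: the derivative of the periodic product \<open>phi k x * \<psi> x\<close> has
  integral zero.\<close>

lemma weak_partial_phi: "weak_partial i (phi k) (\<lambda>x. \<i> * of_int (k $ i) * phi k x)"
  unfolding weak_partial_tor
proof (intro conjI allI impI)
  show "(\<lambda>x. \<i> * of_int (k $ i) * phi k x) \<in> L2p"
    by (intro L2p_cmult L2p_phi)
  fix \<psi> :: "real^'a \<Rightarrow> complex" assume \<psi>: "smooth \<psi> \<and> periodic \<psi>"
  have part: "partial i (\<lambda>x. phi k x * \<psi> x) x = phi k x * partial i \<psi> x + (\<i> * of_int (k $ i) * phi k x) * \<psi> x" for x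
  proof -
    have "(\<psi> has_derivative frechet_derivative \<psi> (at x)) (at x)"
      using smooth_differentiable \<psi> by (auto simp: frechet_derivative_works)
    from has_derivative_mult[OF has_derivative_phi this]
    show ?thesis
      by (subst has_derivative_imp_partial, assumption) (simp add: partial_def inner_axis)
  qed
  have "(LINT x|tor. partial i (\<lambda>x. phi k x * \<psi> x) x) = 0"
  proof (rule integral_partial_eq_0)
    show "periodic (\<lambda>x. phi k x * \<psi> x)"
      using \<psi> periodic_phi[of k] by (simp add: periodic_def)
    show "(\<lambda>x. phi k x * \<psi> x) differentiable (at x)" for x
      using \<psi> by (intro differentiable_mult phi_differentiable smooth_differentiable) auto
    show "continuous_on UNIV (partial i (\<lambda>x. phi k x * \<psi> x))"
      unfolding part[abs_def] using \<psi>
      by (intro continuous_intros continuous_on_phi smooth_continuous smooth_continuous_partial) auto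
  qed
  moreover have "sq_integrable \<psi>" "sq_integrable (partial i \<psi>)"
    using \<psi> by (auto intro: sq_integrable_continuous smooth_continuous smooth_continuous_partial)
  then have "integrable tor (\<lambda>x. phi k x * partial i \<psi> x)"
    "integrable tor (\<lambda>x. (\<i> * of_int (k $ i) * phi k x) * \<psi> x)"
    by (intro integrable_prod sq_integrable_cmult sq_integrable_phi; simp)+
  ultimately show "(LINT x|tor. phi k x * partial i \<psi> x) = - (LINT x|tor. (\<i> * of_int (k $ i) * phi k x) * \<psi> x)"
    unfolding part by (simp only: Bochner_Integration.integral_add add_eq_0_iff2)
qed

text \<open>The complex conjugate of an exponential is again an exponential, and so an admissible test function.\<close>

lemma fcoef_weak_partial:
  assumes "weak_partial i v g"
  shows "fcoef g k = \<i> * of_int (k $ i) * fcoef v k"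
proof -
  have "(LINT x|tor. v x * partial i (phi (- k)) x) = - (LINT x|tor. g x * phi (- k) x)"
    using assms smooth_phi periodic_phi unfolding weak_partial_tor by blast
  moreover have "(LINT x|tor. v x * partial i (phi (- k)) x) = - (\<i> * of_int (k $ i)) * fcoef v k"
  proof -
    have "(LINT x|tor. v x * partial i (phi (- k)) x) = (LINT x|tor. - (\<i> * of_int (k $ i)) * (v x * cnj (phi k x)))"
      by (simp add: partial_phi' cnj_phi mult_ac)
    then show ?thesis
      by (simp only: integral_mult_right_zero fcoef_tor)
  qed
  ultimately show ?thesis
    by (simp add: fcoef_tor cnj_phi)
qed

text \<open>Two weak derivatives have the same Fourier coefficients, so completeness identifies them. This
  makes the arbitrary choice in \<open>wderiv\<close> harmless.\<close>

lemma weak_partial_unique: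
  assumes "weak_partial i v g" "weak_partial i v h"
  shows "AE x in tor. g x = h x"
proof -
  have s: "sq_integrable g" "sq_integrable h"
    using assms by (auto intro: L2p_sq_integrable weak_partial_L2p)
  have "AE x in tor. g x - h x = 0"
    using assms s by (intro AE_0_if_fcoef_0 sq_integrable_diff) (auto simp: fcoef_diff fcoef_weak_partial)
  then show ?thesis by simp
qed

lemma H1p_L2p: "v \<in> H1p \<Longrightarrow> v \<in> L2p"
  by (simp add: H1p_def)

lemma H1p_sq_integrable: "v \<in> H1p \<Longrightarrow> sq_integrable v"
  by (simp add: H1p_L2p L2p_sq_integrable)

lemma weak_partial_wderiv: "v \<in> H1p \<Longrightarrow> weak_partial i v (wderiv i v)"
proof -
  assume "v \<in> H1p"
  then have "\<exists>g. weak_partial i v g" by (simp add: H1p_def)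
  then show ?thesis unfolding wderiv_def by (rule someI_ex)
qed

lemma sq_integrable_wderiv: "v \<in> H1p \<Longrightarrow> sq_integrable (wderiv i v)"
  by (meson L2p_sq_integrable weak_partial_L2p weak_partial_wderiv)

lemma H1p_add: "v \<in> H1p \<Longrightarrow> w \<in> H1p \<Longrightarrow> (\<lambda>x. v x + w x) \<in> H1p"
  unfolding H1p_def by (blast intro: L2p_add weak_partial_add)

lemma H1p_cmult: "v \<in> H1p \<Longrightarrow> (\<lambda>x. c * v x) \<in> H1p"
  unfolding H1p_def by (blast intro: L2p_cmult weak_partial_cmult)

lemma H1p_phi: "phi k \<in> H1p"
  unfolding H1p_def using L2p_phi weak_partial_phi by blast

lemma H1p_trig:
  assumes "finite \<Lambda>" shows "(\<lambda>x. \<Sum>k\<in>\<Lambda>. c k * phi k x) \<in> H1p"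
  using assms
proof (induction \<Lambda>)
  case empty
  then show ?case using H1p_cmult[OF H1p_phi, of 0] by simp
next
  case (insert k \<Lambda>)
  then show ?case by (simp add: H1p_add H1p_cmult H1p_phi)
qed

lemma norm_multi_idx_sq: "(norm (multi_idx k))\<^sup>2 = (\<Sum>i\<in>UNIV. (of_int (k $ i))\<^sup>2)"
  unfolding power2_norm_eq_inner inner_vec_def by (simp add: power2_eq_square)

lemma cw_sq: "(cw k)\<^sup>2 = 1 + (norm (multi_idx k))\<^sup>2"
  by (simp add: cw_def add_nonneg_nonneg)

lemma cw_pos: "cw k > 0"
  by (simp add: cw_def add_pos_nonneg)

lemma has_sum_sum_finite:
  fixes f :: "'i \<Rightarrow> 'a \<Rightarrow> real"
  assumes "finite I" "\<And>i. i \<in> I \<Longrightarrow> (f i has_sum s i) A"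
  shows "((\<lambda>x. \<Sum>i\<in>I. f i x) has_sum (\<Sum>i\<in>I. s i)) A"
  using assms by (induction I) (auto intro: has_sum_add)

text \<open>Parseval for the function and for each of its weak derivatives identifies the Fourier norm
  with the integral Sobolev norm.\<close>

lemma H1norm_has_sum:
  assumes v: "v \<in> H1p"
  shows "((\<lambda>k. (cw k * cmod (fcoef v k))\<^sup>2) has_sum (H1norm v)\<^sup>2) UNIV"
    and "(H1norm v)\<^sup>2 = sqnorm v + (\<Sum>i\<in>UNIV. sqnorm (wderiv i v))"
proof -
  have "((\<lambda>k. (cmod (fcoef v k))\<^sup>2 + (\<Sum>i\<in>UNIV. (cmod (fcoef (wderiv i v) k))\<^sup>2)) has_sum
      (sqnorm v + (\<Sum>i\<in>UNIV. sqnorm (wderiv i v)))) UNIV"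
    using v by (intro has_sum_add has_sum_sum_finite Parseval H1p_sq_integrable sq_integrable_wderiv) auto
  moreover have "(cmod (fcoef v k))\<^sup>2 + (\<Sum>i\<in>UNIV. (cmod (fcoef (wderiv i v) k))\<^sup>2) = (cw k * cmod (fcoef v k))\<^sup>2" for k
    using fcoef_weak_partial[OF weak_partial_wderiv[OF v], of _ k]
    by (simp add: power_mult_distrib cw_sq norm_multi_idx_sq norm_mult distrib_right sum_distrib_right)
  ultimately have *: "((\<lambda>k. (cw k * cmod (fcoef v k))\<^sup>2) has_sum (sqnorm v + (\<Sum>i\<in>UNIV. sqnorm (wderiv i v)))) UNIV"
    by simp
  have "(\<lambda>k. (1 + (norm (multi_idx k))\<^sup>2) * (cmod (fcoef v k))\<^sup>2) = (\<lambda>k. (cw k * cmod (fcoef v k))\<^sup>2)"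
    by (simp add: cw_sq power_mult_distrib)
  then have "H1norm v = sqrt (sqnorm v + (\<Sum>i\<in>UNIV. sqnorm (wderiv i v)))"
    using infsumI[OF *] by (simp add: H1norm_def)
  then show "(H1norm v)\<^sup>2 = sqnorm v + (\<Sum>i\<in>UNIV. sqnorm (wderiv i v))"
    by (simp add: sqnorm_nonneg add_nonneg_nonneg sum_nonneg)
  with * show "((\<lambda>k. (cw k * cmod (fcoef v k))\<^sup>2) has_sum (H1norm v)\<^sup>2) UNIV"
    by simp
qed

lemma H1norm_nonneg: "H1norm v \<ge> 0"
  by (simp add: H1norm_def infsum_nonneg)

lemma sqrt_sqnorm_le_H1norm:
  assumes "v \<in> H1p"
  shows "sqrt (sqnorm v) \<le> H1norm v" "sqrt (sqnorm (wderiv i v)) \<le> H1norm v"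
proof -
  have "sqnorm (wderiv i v) \<le> (\<Sum>i\<in>UNIV. sqnorm (wderiv i v))"
    by (rule member_le_sum) (auto simp: sqnorm_nonneg)
  moreover have "0 \<le> (\<Sum>i\<in>UNIV. sqnorm (wderiv i v))"
    by (simp add: sqnorm_nonneg sum_nonneg)
  ultimately show "sqrt (sqnorm v) \<le> H1norm v" "sqrt (sqnorm (wderiv i v)) \<le> H1norm v"
    using H1norm_has_sum(2)[OF assms] sqnorm_nonneg[of v] sqnorm_nonneg[of "wderiv i v"]
    by (auto intro!: real_le_lsqrt H1norm_nonneg)
qed

section \<open>The sesquilinear form\<close>

text \<open>The weighted inner product from which the sesquilinear form is assembled, once for each weak
  derivative and once for the function itself.\<close>

definition wprod :: "(real^'n \<Rightarrow> real) \<Rightarrow> (real^'n \<Rightarrow> complex) \<Rightarrow> (real^'n \<Rightarrow> complex) \<Rightarrow> complex" where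
  "wprod b f g = (LINT x|tor. of_real (b x) * (f x * cnj (g x)))"

lemma admissible_coeff_bounded:
  assumes "admissible_coeff b"
  obtains B where "B > 0" "b \<in> borel_measurable borel" "\<And>x. \<bar>b x\<bar> \<le> B"
proof -
  from assms obtain lo hi where *: "0 < lo" "\<And>x. lo \<le> b x \<and> b x \<le> hi" and c: "C1 b"
    unfolding admissible_coeff_def by blast
  have "continuous_on UNIV b"
    using c by (auto simp: C1_def intro!: continuous_at_imp_continuous_on differentiable_imp_continuous_within)
  moreover have "\<bar>b x\<bar> \<le> hi" for x using *(1) *(2)[of x] by auto
  moreover have "hi > 0" using *(1) *(2)[of undefined] by auto
  ultimately show ?thesis
    using that borel_measurable_continuous_onI by blast
qed

lemma integrable_wprod:
  assumes b: "admissible_coeff b" and fg: "sq_integrable f" "sq_integrable g"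
  shows "integrable tor (\<lambda>x. of_real (b x) * (f x * cnj (g x)))"
proof -
  obtain B where B: "B > 0" "b \<in> borel_measurable borel" "\<And>x. \<bar>b x\<bar> \<le> B"
    using admissible_coeff_bounded[OF b] by blast
  then have "sq_integrable (\<lambda>x. of_real (b x) * f x)"
    using fg by (intro sq_integrable_mult_bounded[where B = B]) auto
  from integrable_prod[OF this sq_integrable_cnj[OF fg(2)]] show ?thesis
    by (simp add: mult.assoc)
qed

lemma wprod_bound:
  assumes b: "b \<in> borel_measurable borel" "\<And>x. \<bar>b x\<bar> \<le> B" and fg: "sq_integrable f" "sq_integrable g"
  shows "cmod (wprod b f g) \<le> B * (sqrt (sqnorm f) * sqrt (sqnorm g))"
proof -
  have B0: "B \<ge> 0" using b(2)[of undefined] by linarith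
  have "cmod (wprod b f g) \<le> (LINT x|tor. cmod (of_real (b x) * (f x * cnj (g x))))"
    unfolding wprod_def by simp
  also have "\<dots> \<le> (LINT x|tor. B * (cmod (f x) * cmod (g x)))"
  proof (rule Bochner_Integration.integral_mono')
    show "integrable tor (\<lambda>x. B * (cmod (f x) * cmod (g x)))"
      using integrable_norm_prod[OF fg] by simp
    show "cmod (of_real (b x) * (f x * cnj (g x))) \<le> B * (cmod (f x) * cmod (g x))" for x
      using b(2)[of x] by (auto simp: norm_mult intro!: mult_right_mono)
  qed (use B0 in simp)
  also have "\<dots> \<le> B * (sqrt (sqnorm f) * sqrt (sqnorm g))"
    using Cauchy_Schwarz_tor[OF fg] B0 by (simp add: mult_left_mono)
  finally show ?thesis .
qed

lemma wprod_cong_AE: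
  assumes "b \<in> borel_measurable borel" "sq_integrable f" "sq_integrable f'" "sq_integrable g" "sq_integrable g'"
    and "AE x in tor. f x = f' x" "AE x in tor. g x = g' x"
  shows "wprod b f g = wprod b f' g'"
  unfolding wprod_def
proof (rule integral_cong_AE)
  have [measurable]: "b \<in> borel_measurable borel" "f \<in> borel_measurable borel" "f' \<in> borel_measurable borel"
    "g \<in> borel_measurable borel" "g' \<in> borel_measurable borel"
    using assms by (auto intro: sq_integrable_measurable)
  have [measurable]: "(\<lambda>x. cnj (g x)) \<in> borel_measurable borel" "(\<lambda>x. cnj (g' x)) \<in> borel_measurable borel"
    using assms by (auto intro: sq_integrable_measurable sq_integrable_cnj)
  have "(\<lambda>x. of_real (b x) * (f x * cnj (g x))) \<in> borel_measurable borel" by measurable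
  then show "(\<lambda>x. of_real (b x) * (f x * cnj (g x))) \<in> borel_measurable tor"
    by (rule measurable_tor)
  have "(\<lambda>x. of_real (b x) * (f' x * cnj (g' x))) \<in> borel_measurable borel" by measurable
  then show "(\<lambda>x. of_real (b x) * (f' x * cnj (g' x))) \<in> borel_measurable tor"
    by (rule measurable_tor)
  show "AE x in tor. of_real (b x) * (f x * cnj (g x)) = of_real (b x) * (f' x * cnj (g' x))"
    using assms(6,7) by eventually_elim simp
qed

context
  fixes b :: "real^'n \<Rightarrow> real"
  assumes b: "admissible_coeff b"
begin

lemma wprod_add_left:
  assumes "sq_integrable f" "sq_integrable f'" "sq_integrable g"
  shows "wprod b (\<lambda>x. f x + f' x) g = wprod b f g + wprod b f' g"
  using integrable_wprod[OF b, of f g] integrable_wprod[OF b, of f' g] assms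
  by (simp add: wprod_def distrib_right distrib_left)

lemma wprod_add_right:
  assumes "sq_integrable f" "sq_integrable g" "sq_integrable g'"
  shows "wprod b f (\<lambda>x. g x + g' x) = wprod b f g + wprod b f g'"
  using integrable_wprod[OF b, of f g] integrable_wprod[OF b, of f g'] assms
  by (simp add: wprod_def distrib_right distrib_left)

end

lemma wprod_cmult_left: "wprod b (\<lambda>x. c * f x) g = c * wprod b f g"
proof -
  have "wprod b (\<lambda>x. c * f x) g = (LINT x|tor. c * (of_real (b x) * (f x * cnj (g x))))"
    unfolding wprod_def by (simp add: mult_ac)
  then show ?thesis by (simp add: wprod_def)
qed

lemma wprod_cmult_right: "wprod b f (\<lambda>x. c * g x) = cnj c * wprod b f g"
proof -
  have "wprod b f (\<lambda>x. c * g x) = (LINT x|tor. cnj c * (of_real (b x) * (f x * cnj (g x))))"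
    unfolding wprod_def by (simp add: mult_ac)
  then show ?thesis by (simp add: wprod_def)
qed

locale torus_form =
  fixes \<nu> \<sigma> :: "real^'n \<Rightarrow> real"
  assumes \<nu>: "admissible_coeff \<nu>" and \<sigma>: "admissible_coeff \<sigma>"
begin

text \<open>Sums and multiples of chosen weak derivatives are weak derivatives, but need not be the chosen
  ones; this formula for arbitrary weak derivatives is what makes the form sesquilinear.\<close>

lemma aform_wprod:
  assumes u: "u \<in> L2p" "\<And>i. weak_partial i u (du i)" and v: "v \<in> L2p" "\<And>i. weak_partial i v (dv i)"
  shows "aform \<nu> \<sigma> u v = (\<Sum>i\<in>UNIV. wprod \<nu> (du i) (dv i)) + wprod \<sigma> u v"
proof -
  have uv: "u \<in> H1p" "v \<in> H1p"
    using assms by (auto simp: H1p_def)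
  have meas: "\<nu> \<in> borel_measurable borel"
    using admissible_coeff_bounded[OF \<nu>] by blast
  have s: "sq_integrable (du i)" "sq_integrable (dv i)" for i
    using assms by (auto intro: L2p_sq_integrable weak_partial_L2p)
  have eq: "wprod \<nu> (wderiv i u) (wderiv i v) = wprod \<nu> (du i) (dv i)" for i
    by (intro wprod_cong_AE meas sq_integrable_wderiv uv s weak_partial_unique[OF weak_partial_wderiv[OF uv(1)] u(2)]
        weak_partial_unique[OF weak_partial_wderiv[OF uv(2)] v(2)])
  have "aform \<nu> \<sigma> u v = (LINT x|tor. (\<Sum>i\<in>UNIV. of_real (\<nu> x) * (wderiv i u x * cnj (wderiv i v x)))) + wprod \<sigma> u v"
    unfolding aform_def set_integral_tor wprod_def by (simp add: sum_distrib_left mult.assoc)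
  also have "\<dots> = (\<Sum>i\<in>UNIV. wprod \<nu> (wderiv i u) (wderiv i v)) + wprod \<sigma> u v"
    unfolding wprod_def using uv
    by (subst Bochner_Integration.integral_sum) (auto intro!: integrable_wprod[OF \<nu>] sq_integrable_wderiv)
  finally show ?thesis by (simp add: eq)
qed

lemma aform_wderiv:
  assumes "u \<in> H1p" "v \<in> H1p"
  shows "aform \<nu> \<sigma> u v = (\<Sum>i\<in>UNIV. wprod \<nu> (wderiv i u) (wderiv i v)) + wprod \<sigma> u v"
  using assms by (intro aform_wprod H1p_L2p weak_partial_wderiv)

lemma aform_add_left:
  assumes "u \<in> H1p" "u' \<in> H1p" "v \<in> H1p"
  shows "aform \<nu> \<sigma> (\<lambda>x. u x + u' x) v = aform \<nu> \<sigma> u v + aform \<nu> \<sigma> u' v"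
proof -
  have "aform \<nu> \<sigma> (\<lambda>x. u x + u' x) v =
      (\<Sum>i\<in>UNIV. wprod \<nu> (\<lambda>x. wderiv i u x + wderiv i u' x) (wderiv i v)) + wprod \<sigma> (\<lambda>x. u x + u' x) v"
    using assms by (intro aform_wprod L2p_add H1p_L2p weak_partial_add weak_partial_wderiv)
  then show ?thesis
    using assms by (simp add: aform_wderiv wprod_add_left[OF \<nu>] wprod_add_left[OF \<sigma>] sq_integrable_wderiv H1p_sq_integrable sum.distrib)
qed

lemma aform_add_right:
  assumes "u \<in> H1p" "v \<in> H1p" "v' \<in> H1p"
  shows "aform \<nu> \<sigma> u (\<lambda>x. v x + v' x) = aform \<nu> \<sigma> u v + aform \<nu> \<sigma> u v'"
proof -
  have "aform \<nu> \<sigma> u (\<lambda>x. v x + v' x) =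
      (\<Sum>i\<in>UNIV. wprod \<nu> (wderiv i u) (\<lambda>x. wderiv i v x + wderiv i v' x)) + wprod \<sigma> u (\<lambda>x. v x + v' x)"
    using assms by (intro aform_wprod L2p_add H1p_L2p weak_partial_add weak_partial_wderiv)
  then show ?thesis
    using assms by (simp add: aform_wderiv wprod_add_right[OF \<nu>] wprod_add_right[OF \<sigma>] sq_integrable_wderiv H1p_sq_integrable sum.distrib)
qed

lemma aform_cmult_left:
  assumes "u \<in> H1p" "v \<in> H1p"
  shows "aform \<nu> \<sigma> (\<lambda>x. c * u x) v = c * aform \<nu> \<sigma> u v"
proof -
  have "aform \<nu> \<sigma> (\<lambda>x. c * u x) v =
      (\<Sum>i\<in>UNIV. wprod \<nu> (\<lambda>x. c * wderiv i u x) (wderiv i v)) + wprod \<sigma> (\<lambda>x. c * u x) v"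
    using assms by (intro aform_wprod L2p_cmult H1p_L2p weak_partial_cmult weak_partial_wderiv)
  then show ?thesis
    using assms by (simp add: aform_wderiv wprod_cmult_left sum_distrib_left distrib_left)
qed

lemma aform_cmult_right:
  assumes "u \<in> H1p" "v \<in> H1p"
  shows "aform \<nu> \<sigma> u (\<lambda>x. c * v x) = cnj c * aform \<nu> \<sigma> u v"
proof -
  have "aform \<nu> \<sigma> u (\<lambda>x. c * v x) =
      (\<Sum>i\<in>UNIV. wprod \<nu> (wderiv i u) (\<lambda>x. c * wderiv i v x)) + wprod \<sigma> u (\<lambda>x. c * v x)"
    using assms by (intro aform_wprod L2p_cmult H1p_L2p weak_partial_cmult weak_partial_wderiv)
  then show ?thesis
    using assms by (simp add: aform_wderiv wprod_cmult_right sum_distrib_left distrib_left)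
qed

lemma aform_trig_left:
  assumes "finite \<Lambda>" "v \<in> H1p"
  shows "aform \<nu> \<sigma> (\<lambda>x. \<Sum>k\<in>\<Lambda>. c k * phi k x) v = (\<Sum>k\<in>\<Lambda>. c k * aform \<nu> \<sigma> (phi k) v)"
  using assms(1)
proof (induction \<Lambda>)
  case empty
  show ?case using aform_cmult_left[OF H1p_phi assms(2), of 0] by simp
next
  case (insert k \<Lambda>)
  then show ?case
    using assms(2) by (simp add: aform_add_left aform_cmult_left H1p_cmult H1p_phi H1p_trig)
qed

lemma aform_trig_right:
  assumes "finite \<Lambda>" "u \<in> H1p"
  shows "aform \<nu> \<sigma> u (\<lambda>x. \<Sum>k\<in>\<Lambda>. c k * phi k x) = (\<Sum>k\<in>\<Lambda>. cnj (c k) * aform \<nu> \<sigma> u (phi k))"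
  using assms(1)
proof (induction \<Lambda>)
  case empty
  show ?case using aform_cmult_right[OF assms(2) H1p_phi, of 0] by simp
next
  case (insert k \<Lambda>)
  then show ?case
    using assms(2) by (simp add: aform_add_right aform_cmult_right H1p_cmult H1p_phi H1p_trig)
qed

lemma aform_bounded:
  obtains M where "M > 0"
    "\<And>u v. u \<in> H1p \<Longrightarrow> v \<in> H1p \<Longrightarrow> cmod (aform \<nu> \<sigma> u v) \<le> M * (H1norm u * H1norm v)"
proof -
  obtain N where N: "N > 0" "\<nu> \<in> borel_measurable borel" "\<And>x. \<bar>\<nu> x\<bar> \<le> N"
    using admissible_coeff_bounded[OF \<nu>] by blast
  obtain S where S: "S > 0" "\<sigma> \<in> borel_measurable borel" "\<And>x. \<bar>\<sigma> x\<bar> \<le> S"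
    using admissible_coeff_bounded[OF \<sigma>] by blast
  define M where "M = real CARD('n) * N + S"
  have "cmod (aform \<nu> \<sigma> u v) \<le> M * (H1norm u * H1norm v)" if uv: "u \<in> H1p" "v \<in> H1p" for u v
  proof -
    have 1: "cmod (wprod \<nu> (wderiv i u) (wderiv i v)) \<le> N * (H1norm u * H1norm v)" for i
      using N uv sqrt_sqnorm_le_H1norm(2)[of u i] sqrt_sqnorm_le_H1norm(2)[of v i]
      by (intro order_trans[OF wprod_bound[of \<nu> N]] mult_left_mono mult_mono H1norm_nonneg sq_integrable_wderiv)
        (auto simp: sqnorm_nonneg)
    have 2: "cmod (wprod \<sigma> u v) \<le> S * (H1norm u * H1norm v)"
      using S uv sqrt_sqnorm_le_H1norm(1)[of u] sqrt_sqnorm_le_H1norm(1)[of v]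
      by (intro order_trans[OF wprod_bound[of \<sigma> S]] mult_left_mono mult_mono H1norm_nonneg H1p_sq_integrable)
        (auto simp: sqnorm_nonneg)
    have "cmod (aform \<nu> \<sigma> u v) \<le> (\<Sum>i\<in>UNIV. cmod (wprod \<nu> (wderiv i u) (wderiv i v))) + cmod (wprod \<sigma> u v)"
      unfolding aform_wderiv[OF uv]
      by (rule norm_triangle_le[OF add_mono[OF norm_sum order_refl]])
    also have "\<dots> \<le> (\<Sum>i\<in>(UNIV :: 'n set). N * (H1norm u * H1norm v)) + S * (H1norm u * H1norm v)"
      by (intro add_mono sum_mono 1 2)
    finally show ?thesis by (simp add: M_def algebra_simps)
  qed
  moreover have "M > 0" using N S by (simp add: M_def add_pos_pos)
  ultimately show ?thesis using that by blast
qed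

lemma Lop_Hm1:
  assumes "v \<in> H1p" shows "Lop \<nu> \<sigma> v \<in> Hm1"
proof -
  obtain M where "M > 0"
    "\<And>u v. u \<in> H1p \<Longrightarrow> v \<in> H1p \<Longrightarrow> cmod (aform \<nu> \<sigma> u v) \<le> M * (H1norm u * H1norm v)"
    using aform_bounded by blast
  then have "\<exists>C. \<forall>w\<in>H1p. cmod (aform \<nu> \<sigma> v w) \<le> C * H1norm w"
    using assms by (intro exI[of _ "M * H1norm v"]) (simp add: mult.assoc)
  then show ?thesis
    using assms by (simp add: Hm1_def Lop_def aform_add_right aform_cmult_right)
qed

end

section \<open>Fourier projections\<close>

lemma proj_fun_remainder:
  assumes v: "v \<in> H1p" and \<Lambda>: "finite \<Lambda>"
  shows "v - proj_fun \<Lambda> v \<in> H1p" "fcoef (v - proj_fun \<Lambda> v) k = (if k \<in> \<Lambda> then 0 else fcoef v k)"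
proof -
  have eq: "v - proj_fun \<Lambda> v = (\<lambda>x. v x + (- 1) * (\<Sum>k\<in>\<Lambda>. fcoef v k * phi k x))"
    by (simp add: fun_eq_iff proj_fun_def)
  show "v - proj_fun \<Lambda> v \<in> H1p"
    unfolding eq by (intro H1p_add H1p_cmult H1p_trig v \<Lambda>)
  show "fcoef (v - proj_fun \<Lambda> v) k = (if k \<in> \<Lambda> then 0 else fcoef v k)"
    unfolding eq using v \<Lambda>
    by (subst fcoef_add) (auto simp: fcoef_cmult[of "- 1", simplified] fcoef_trig H1p_sq_integrable intro!: sq_integrable_trig sq_integrable_cmult[of _ "- 1", simplified])
qed

lemma H1norm_remainder:
  assumes v: "v \<in> H1p" and \<Lambda>: "finite \<Lambda>"
  shows "(H1norm (v - proj_fun \<Lambda> v))\<^sup>2 = (H1norm v)\<^sup>2 - (\<Sum>k\<in>\<Lambda>. (cw k * cmod (fcoef v k))\<^sup>2)"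
    and "k \<notin> \<Lambda> \<Longrightarrow> cw k * cmod (fcoef v k) \<le> H1norm (v - proj_fun \<Lambda> v)"
proof -
  let ?w = "v - proj_fun \<Lambda> v"
  have w: "((\<lambda>k. (cw k * cmod (fcoef ?w k))\<^sup>2) has_sum (H1norm ?w)\<^sup>2) UNIV"
    by (rule H1norm_has_sum[OF proj_fun_remainder(1)[OF v \<Lambda>]])
  have "((\<lambda>k. if k \<in> \<Lambda> then (cw k * cmod (fcoef v k))\<^sup>2 else 0) has_sum (\<Sum>k\<in>\<Lambda>. (cw k * cmod (fcoef v k))\<^sup>2)) UNIV"
    using has_sum_finite[OF \<Lambda>, of "\<lambda>k. (cw k * cmod (fcoef v k))\<^sup>2"]
    by (subst has_sum_cong_neutral[where T = \<Lambda>]) auto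
  from has_sum_add[OF w this] have "((\<lambda>k. (cw k * cmod (fcoef v k))\<^sup>2) has_sum
      ((H1norm ?w)\<^sup>2 + (\<Sum>k\<in>\<Lambda>. (cw k * cmod (fcoef v k))\<^sup>2))) UNIV"
    by (rule back_subst[where P = "\<lambda>f. (f has_sum _) _"]) (auto simp: fun_eq_iff proj_fun_remainder[OF v \<Lambda>])
  with H1norm_has_sum(1)[OF v] have "(H1norm v)\<^sup>2 = (H1norm ?w)\<^sup>2 + (\<Sum>k\<in>\<Lambda>. (cw k * cmod (fcoef v k))\<^sup>2)"
    by (rule has_sum_unique)
  then show "(H1norm ?w)\<^sup>2 = (H1norm v)\<^sup>2 - (\<Sum>k\<in>\<Lambda>. (cw k * cmod (fcoef v k))\<^sup>2)"
    by simp
  assume "k \<notin> \<Lambda>"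
  have "(\<Sum>k\<in>{k}. (cw k * cmod (fcoef ?w k))\<^sup>2) \<le> (H1norm ?w)\<^sup>2"
    by (rule has_sum_mono_neutral[OF has_sum_finite w]) auto
  then have "(cw k * cmod (fcoef v k))\<^sup>2 \<le> (H1norm ?w)\<^sup>2"
    using \<open>k \<notin> \<Lambda>\<close> by (simp add: proj_fun_remainder[OF v \<Lambda>])
  then show "cw k * cmod (fcoef v k) \<le> H1norm ?w"
    by (rule power2_le_imp_le) (rule H1norm_nonneg)
qed

lemma form_remainder:
  assumes "finite \<Lambda>"
  shows "(f - proj_form \<Lambda> f) (phi l) = (if l \<in> \<Lambda> then 0 else f (phi l))"
proof -
  have "proj_form \<Lambda> f (phi l) = (\<Sum>k\<in>\<Lambda>. if k = l then f (phi k) else 0)"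
    unfolding proj_form_def by (rule sum.cong) (auto simp: fcoef_phi)
  also have "\<dots> = (if l \<in> \<Lambda> then f (phi l) else 0)"
    using assms by (simp add: sum.delta)
  finally show ?thesis by simp
qed

lemma infsum_le_if_finite_sums_le:
  fixes f :: "'a \<Rightarrow> real"
  assumes nn: "\<And>x. 0 \<le> f x" and B: "\<And>F. finite F \<Longrightarrow> (\<Sum>x\<in>F. f x) \<le> B"
  shows "(\<Sum>\<^sub>\<infinity>x\<in>UNIV. f x) \<le> B"
proof -
  have "f summable_on UNIV"
    using assms by (intro nonneg_bdd_above_summable_on) (auto intro!: bdd_aboveI2[where M = B])
  then show ?thesis
    using B by (intro infsum_le_finite_sums) auto
qed

text \<open>The remainder has coefficient zero on \<open>\<Lambda>\<close>, and the norm is an unconditional sum of nonnegative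
  terms, so bounds for finite partial sums off \<open>\<Lambda>\<close> are enough.\<close>

lemma Hm1norm_remainder_le:
  fixes f :: "(real^'n \<Rightarrow> complex) \<Rightarrow> complex"
  assumes \<Lambda>: "finite \<Lambda>" and "B \<ge> 0"
    and B: "\<And>F. finite F \<Longrightarrow> F \<inter> \<Lambda> = {} \<Longrightarrow> (\<Sum>l\<in>F. (cmod (f (phi l)) / cw l)\<^sup>2) \<le> B\<^sup>2"
  shows "Hm1norm (f - proj_form \<Lambda> f) \<le> B"
proof -
  have eq: "inverse (1 + (norm (multi_idx l))\<^sup>2) * (cmod ((f - proj_form \<Lambda> f) (phi l)))\<^sup>2 =
      (if l \<in> \<Lambda> then 0 else (cmod (f (phi l)) / cw l)\<^sup>2)" for l
    unfolding form_remainder[OF \<Lambda>] by (simp add: power_divide cw_sq) (simp add: divide_inverse mult.commute)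
  have "(\<Sum>\<^sub>\<infinity>l\<in>UNIV. if l \<in> \<Lambda> then 0 else (cmod (f (phi l)) / cw l)\<^sup>2) \<le> B\<^sup>2"
  proof (rule infsum_le_if_finite_sums_le)
    fix F :: "(int^'n) set" assume "finite F"
    then have "(\<Sum>l\<in>F. if l \<in> \<Lambda> then 0 else (cmod (f (phi l)) / cw l)\<^sup>2) = (\<Sum>l\<in>F - \<Lambda>. (cmod (f (phi l)) / cw l)\<^sup>2)"
      by (intro sum.mono_neutral_cong_right) auto
    also have "\<dots> \<le> B\<^sup>2"
      using \<open>finite F\<close> by (intro B) auto
    finally show "(\<Sum>l\<in>F. if l \<in> \<Lambda> then 0 else (cmod (f (phi l)) / cw l)\<^sup>2) \<le> B\<^sup>2" .
  qed simp
  then show ?thesis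
    unfolding Hm1norm_def eq using \<open>B \<ge> 0\<close> by (simp add: real_le_lsqrt)
qed

context torus_form
begin

text \<open>Duality: the form is tested against the trigonometric polynomial whose coefficients represent the
  form on \<open>F\<close>, for which the Cauchy-Schwarz inequality is an equality.\<close>

lemma aform_dual_bound:
  assumes M: "M > 0" "\<And>u v. u \<in> H1p \<Longrightarrow> v \<in> H1p \<Longrightarrow> cmod (aform \<nu> \<sigma> u v) \<le> M * (H1norm u * H1norm v)"
    and u: "u \<in> H1p" and F: "finite F"
  shows "(\<Sum>l\<in>F. (cmod (aform \<nu> \<sigma> u (phi l)) / cw l)\<^sup>2) \<le> (M * H1norm u)\<^sup>2"
proof -
  define s where "s = (\<Sum>l\<in>F. (cmod (aform \<nu> \<sigma> u (phi l)) / cw l)\<^sup>2)"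
  define c where "c l = aform \<nu> \<sigma> u (phi l) / of_real ((cw l)\<^sup>2)" for l
  define w where "w x = (\<Sum>l\<in>F. c l * phi l x)" for x
  have w: "w \<in> H1p"
    unfolding w_def[abs_def] by (rule H1p_trig[OF F])
  have s0: "s \<ge> 0" unfolding s_def by (simp add: sum_nonneg)
  have "aform \<nu> \<sigma> u w = (\<Sum>l\<in>F. cnj (c l) * aform \<nu> \<sigma> u (phi l))"
    unfolding w_def[abs_def] by (rule aform_trig_right[OF F u])
  also have "\<dots> = of_real s"
    unfolding s_def of_real_sum
  proof (rule sum.cong)
    fix l
    have "cnj (c l) * aform \<nu> \<sigma> u (phi l) = aform \<nu> \<sigma> u (phi l) * cnj (aform \<nu> \<sigma> u (phi l)) / of_real ((cw l)\<^sup>2)"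
      by (simp add: c_def)
    also have "\<dots> = of_real ((cmod (aform \<nu> \<sigma> u (phi l)))\<^sup>2) / of_real ((cw l)\<^sup>2)"
      by (simp only: complex_norm_square)
    finally show "cnj (c l) * aform \<nu> \<sigma> u (phi l) = of_real ((cmod (aform \<nu> \<sigma> u (phi l)) / cw l)\<^sup>2)"
      by (simp add: power_divide)
  qed simp
  finally have aw: "cmod (aform \<nu> \<sigma> u w) = s"
    using s0 by simp
  have "((\<lambda>k. (cw k * cmod (fcoef w k))\<^sup>2) has_sum (H1norm w)\<^sup>2) UNIV"
    by (rule H1norm_has_sum(1)[OF w])
  moreover have "(cw k * cmod (fcoef w k))\<^sup>2 = (if k \<in> F then (cmod (aform \<nu> \<sigma> u (phi k)) / cw k)\<^sup>2 else 0)" for k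
  proof -
    have "fcoef w k = (if k \<in> F then c k else 0)"
      unfolding w_def[abs_def] by (rule fcoef_trig[OF F])
    then show ?thesis
      using cw_pos[of k] by (simp add: c_def norm_divide norm_mult power_divide power_mult_distrib power2_eq_square)
  qed
  ultimately have "((\<lambda>k. if k \<in> F then (cmod (aform \<nu> \<sigma> u (phi k)) / cw k)\<^sup>2 else 0) has_sum (H1norm w)\<^sup>2) UNIV"
    by simp
  moreover have "((\<lambda>k. if k \<in> F then (cmod (aform \<nu> \<sigma> u (phi k)) / cw k)\<^sup>2 else 0) has_sum s) UNIV"
    using has_sum_finite[OF F, of "\<lambda>k. (cmod (aform \<nu> \<sigma> u (phi k)) / cw k)\<^sup>2"]
    unfolding s_def by (subst has_sum_cong_neutral[where T = F]) auto
  ultimately have "(H1norm w)\<^sup>2 = s"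
    by (rule has_sum_unique)
  then have Hw: "H1norm w = sqrt s"
    using H1norm_nonneg[of w] by (simp add: real_sqrt_unique)
  have "s \<le> M * (H1norm u * sqrt s)"
    using M(2)[OF u w] by (simp add: aw Hw)
  then have "sqrt s * sqrt s \<le> (M * H1norm u) * sqrt s"
    using s0 by (simp add: mult.assoc)
  then have "sqrt s \<le> M * H1norm u"
  proof (cases "s = 0")
    case True
    then show ?thesis using M(1) H1norm_nonneg[of u] by simp
  next
    case False
    then have "sqrt s > 0" using s0 by simp
    then show ?thesis
      using \<open>sqrt s * sqrt s \<le> (M * H1norm u) * sqrt s\<close> by (rule mult_right_le_imp_le[rotated])
  qed
  then have "(sqrt s)\<^sup>2 \<le> (M * H1norm u)\<^sup>2"
    using s0 by (intro power_mono) auto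
  then show ?thesis
    using s0 by (simp add: s_def)
qed

lemma aform_remainder:
  assumes v: "v \<in> H1p" and w: "w \<in> H1p" and \<Lambda>: "finite \<Lambda>"
  shows "aform \<nu> \<sigma> (v - proj_fun \<Lambda> v) w = aform \<nu> \<sigma> v w - (\<Sum>k\<in>\<Lambda>. fcoef v k * aform \<nu> \<sigma> (phi k) w)"
proof -
  have "v - proj_fun \<Lambda> v = (\<lambda>x. v x + (- 1) * (\<Sum>k\<in>\<Lambda>. fcoef v k * phi k x))"
    by (simp add: fun_eq_iff proj_fun_def)
  then show ?thesis
    using v w \<Lambda> aform_add_left[OF v H1p_cmult[OF H1p_trig[OF \<Lambda>], of "- 1"] w]
      aform_cmult_left[OF H1p_trig[OF \<Lambda>] w, of "- 1"]
    by (simp add: aform_trig_left)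
qed

text \<open>Fourier sums converge in the Sobolev norm, so the form acts through the stiffness matrix.\<close>

lemma aform_has_sum:
  assumes v: "v \<in> H1p" and w: "w \<in> H1p"
  shows "((\<lambda>k. fcoef v k * aform \<nu> \<sigma> (phi k) w) has_sum aform \<nu> \<sigma> v w) UNIV"
proof -
  obtain M where M: "M > 0"
    "\<And>u v. u \<in> H1p \<Longrightarrow> v \<in> H1p \<Longrightarrow> cmod (aform \<nu> \<sigma> u v) \<le> M * (H1norm u * H1norm v)"
    using aform_bounded by blast
  have "((\<lambda>\<Lambda>. (H1norm v)\<^sup>2 - (\<Sum>k\<in>\<Lambda>. (cw k * cmod (fcoef v k))\<^sup>2)) \<longlongrightarrow> (H1norm v)\<^sup>2 - (H1norm v)\<^sup>2) (finite_subsets_at_top UNIV)"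
    using H1norm_has_sum(1)[OF v] unfolding has_sum_def by (intro tendsto_diff tendsto_const)
  then have "((\<lambda>\<Lambda>. M * (sqrt ((H1norm v)\<^sup>2 - (\<Sum>k\<in>\<Lambda>. (cw k * cmod (fcoef v k))\<^sup>2)) * H1norm w)) \<longlongrightarrow> M * (sqrt 0 * H1norm w)) (finite_subsets_at_top UNIV)"
    by (intro tendsto_intros) simp
  then have lim: "((\<lambda>\<Lambda>. M * (sqrt ((H1norm v)\<^sup>2 - (\<Sum>k\<in>\<Lambda>. (cw k * cmod (fcoef v k))\<^sup>2)) * H1norm w)) \<longlongrightarrow> 0) (finite_subsets_at_top UNIV)"
    by simp
  have bd: "cmod ((\<Sum>k\<in>\<Lambda>. fcoef v k * aform \<nu> \<sigma> (phi k) w) - aform \<nu> \<sigma> v w) \<le>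
      M * (sqrt ((H1norm v)\<^sup>2 - (\<Sum>k\<in>\<Lambda>. (cw k * cmod (fcoef v k))\<^sup>2)) * H1norm w)" if \<Lambda>: "finite \<Lambda>" for \<Lambda>
  proof -
    have "cmod ((\<Sum>k\<in>\<Lambda>. fcoef v k * aform \<nu> \<sigma> (phi k) w) - aform \<nu> \<sigma> v w) = cmod (aform \<nu> \<sigma> (v - proj_fun \<Lambda> v) w)"
      by (simp add: aform_remainder[OF v w \<Lambda>] norm_minus_commute)
    also have "\<dots> \<le> M * (H1norm (v - proj_fun \<Lambda> v) * H1norm w)"
      by (rule M(2)[OF proj_fun_remainder(1)[OF v \<Lambda>] w])
    also have "H1norm (v - proj_fun \<Lambda> v) = sqrt ((H1norm v)\<^sup>2 - (\<Sum>k\<in>\<Lambda>. (cw k * cmod (fcoef v k))\<^sup>2))"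
      unfolding H1norm_remainder(1)[OF v \<Lambda>, symmetric] by (simp add: H1norm_nonneg)
    finally show ?thesis .
  qed
  have "((\<lambda>\<Lambda>. (\<Sum>k\<in>\<Lambda>. fcoef v k * aform \<nu> \<sigma> (phi k) w) - aform \<nu> \<sigma> v w) \<longlongrightarrow> 0) (finite_subsets_at_top UNIV)"
    by (rule Lim_null_comparison[OF _ lim]) (auto intro!: eventually_finite_subsets_at_top_weakI bd)
  then show ?thesis
    unfolding has_sum_def by (simp add: Lim_null[symmetric])
qed

end


section \<open>Counting lattice points\<close>

lemma omega_ball_pos: "omega_ball TYPE('n::finite) > 0"
  by (simp add: omega_ball_def content_ball)

lemma measure_ball_omega:
  assumes "r \<ge> 0"
  shows "measure lborel (ball (0 :: real^'n) r) = omega_ball TYPE('n) * r ^ CARD('n)"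
  using assms by (simp add: omega_ball_def content_ball)

text \<open>The unit cubes attached to the lattice points of a ball are disjoint and lie in a slightly
  larger ball.\<close>

lemma card_lattice_ball:
  fixes r :: real
  assumes r: "r \<ge> 0"
  shows "finite {m :: int^'n. norm (multi_idx m) \<le> r}"
    and "real (card {m :: int^'n. norm (multi_idx m) \<le> r}) \<le>
      omega_ball TYPE('n) * (r + real CARD('n)) ^ CARD('n)"
proof -
  define B where "B = omega_ball TYPE('n) * (r + real CARD('n)) ^ CARD('n)"
  define Q where "Q m = box (multi_idx m) (multi_idx m + (\<chi> i. 1))" for m :: "int^'n"
  have le: "real (card F) \<le> B" if F: "F \<subseteq> {m :: int^'n. norm (multi_idx m) \<le> r}" "finite F" for F
  proof -
    have disj: "disjoint_family_on Q F"
      unfolding disjoint_family_on_def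
    proof (intro ballI impI)
      fix m m' :: "int^'n" assume "m \<noteq> m'"
      then obtain i where i: "m $ i \<noteq> m' $ i" by (auto simp: vec_eq_iff)
      show "Q m \<inter> Q m' = {}"
      proof (rule ccontr)
        assume "Q m \<inter> Q m' \<noteq> {}"
        then obtain x where "x \<in> Q m" "x \<in> Q m'" by blast
        then have "of_int (m $ i) < x $ i" "x $ i < of_int (m $ i) + 1"
          "of_int (m' $ i) < x $ i" "x $ i < of_int (m' $ i) + (1::real)"
          by (auto simp: Q_def mem_box_cart multi_idx_def)
        then have "m $ i = m' $ i" by linarith
        with i show False by simp
      qed
    qed
    have vol: "measure lborel (Q m) = 1" for m
    proof -
      have "(\<Prod>b\<in>Basis. ((\<chi> i. 1) :: real^'n) \<bullet> b) = 1"
        by (rule prod.neutral) (auto simp: Basis_vec_def inner_axis)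
      then show ?thesis
        unfolding Q_def by (subst measure_lborel_box_eq) (auto simp: Basis_vec_def inner_axis)
    qed
    have sub: "(\<Union>m\<in>F. Q m) \<subseteq> ball 0 (r + real CARD('n))"
    proof
      fix x assume "x \<in> (\<Union>m\<in>F. Q m)"
      then obtain m where m: "m \<in> F" "x \<in> Q m" by blast
      have "\<bar>(x - multi_idx m) $ i\<bar> < 1" for i
      proof -
        have "multi_idx m $ i < x $ i" "x $ i < multi_idx m $ i + 1"
          using m(2) by (auto simp: Q_def mem_box_cart)
        then show ?thesis by (simp add: abs_less_iff)
      qed
      then have "(\<Sum>i\<in>UNIV. \<bar>(x - multi_idx m) $ i\<bar>) < (\<Sum>i\<in>(UNIV :: 'n set). 1)"
        by (intro sum_strict_mono) auto
      then have "norm (x - multi_idx m) < real CARD('n)"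
        using norm_le_l1_cart[of "x - multi_idx m"] by simp
      moreover have "norm (multi_idx m) \<le> r" using m F by blast
      ultimately have "norm x < r + real CARD('n)"
        using norm_triangle_sub[of x "multi_idx m"] by linarith
      then show "x \<in> ball 0 (r + real CARD('n))" by simp
    qed
    have "real (card F) = (\<Sum>m\<in>F. measure lborel (Q m))"
      by (simp add: vol)
    also have "\<dots> = measure lborel (\<Union>m\<in>F. Q m)"
    proof (rule measure_finite_Union[symmetric, OF F(2) _ disj])
      show "emeasure lborel (Q m) \<noteq> \<infinity>" for m
        unfolding Q_def using emeasure_lborel_box_finite by (metis less_irrefl infinity_ennreal_def)
    qed (auto simp: Q_def)
    also have "\<dots> \<le> measure lborel (ball (0 :: real^'n) (r + real CARD('n)))"
      using sub F(2) r
      by (intro measure_mono_fmeasurable) (auto simp: Q_def emeasure_ball intro!: fmeasurableI)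
    also have "\<dots> = B"
      using r by (simp add: measure_ball_omega B_def)
    finally show ?thesis .
  qed
  have "finite {m :: int^'n. norm (multi_idx m) \<le> r} \<and> card {m :: int^'n. norm (multi_idx m) \<le> r} \<le> nat \<lfloor>B\<rfloor>"
  proof (rule finite_if_finite_subsets_card_bdd)
    fix G :: "(int^'n) set" assume "G \<subseteq> {m. norm (multi_idx m) \<le> r}" "finite G"
    then have "real (card G) \<le> B" by (rule le)
    then show "card G \<le> nat \<lfloor>B\<rfloor>" by linarith
  qed
  then show "finite {m :: int^'n. norm (multi_idx m) \<le> r}" ..
  from le[OF order_refl this]
  show "real (card {m :: int^'n. norm (multi_idx m) \<le> r}) \<le> B" .
qed

text \<open>Grouping by integer distance leaves polynomially many points on each level against exponential
  decay.\<close>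

lemma exp_lattice_sum_bounded:
  assumes b: "b > 0"
  obtains E where "\<And>F. finite F \<Longrightarrow> (\<Sum>m\<in>F. exp (- b * norm (multi_idx (m :: int^'n)))) \<le> E"
proof -
  let ?w = "omega_ball TYPE('n)" and ?d = "CARD('n)"
  define u where "u j = ?w * ((real j + (1 + real ?d)) ^ ?d * exp (- b * real j))" for j :: nat
  have "(\<lambda>j. real j ^ 2 * ((real j + (1 + real ?d)) ^ ?d * exp (- b * real j))) \<longlonglongrightarrow> 0"
    using b by real_asymp
  then have "Bseq (\<lambda>j. real j ^ 2 * ((real j + (1 + real ?d)) ^ ?d * exp (- b * real j)))"
    by (intro convergent_imp_Bseq convergentI)
  then obtain K where K: "\<And>j. norm (real j ^ 2 * ((real j + (1 + real ?d)) ^ ?d * exp (- b * real j))) \<le> K"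
    by (auto simp: Bseq_def)
  have "summable u"
  proof (rule summable_comparison_test[rotated])
    show "summable (\<lambda>j. ?w * (K * inverse (real j ^ 2)))"
      by (intro summable_mult inverse_power_summable) simp
    show "\<exists>N. \<forall>j\<ge>N. norm (u j) \<le> ?w * (K * inverse (real j ^ 2))"
    proof (intro exI allI impI)
      fix j :: nat assume "j \<ge> 1"
      then have j: "real j ^ 2 > 0" by simp
      have nn: "0 \<le> (real j + (1 + real ?d)) ^ ?d * exp (- b * real j)" by simp
      have "real j ^ 2 * ((real j + (1 + real ?d)) ^ ?d * exp (- b * real j)) \<le> K"
        using K[of j] by (simp only: norm_mult real_norm_def abs_of_nonneg[OF nn])
      then have "(real j + (1 + real ?d)) ^ ?d * exp (- b * real j) \<le> K / real j ^ 2"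
        using j by (simp only: pos_le_divide_eq mult.commute)
      then have "?w * ((real j + (1 + real ?d)) ^ ?d * exp (- b * real j)) \<le> ?w * (K / real j ^ 2)"
        using omega_ball_pos[where 'n='n] by (intro mult_left_mono) auto
      moreover have "u j \<ge> 0" unfolding u_def using omega_ball_pos[where 'n='n] by simp
      ultimately show "norm (u j) \<le> ?w * (K * inverse (real j ^ 2))"
        by (simp add: u_def divide_inverse)
    qed
  qed
  have "(\<Sum>m\<in>F. exp (- b * norm (multi_idx m))) \<le> suminf u" if F: "finite F" for F :: "(int^'n) set"
  proof -
    define lev where "lev m = nat \<lfloor>norm (multi_idx m)\<rfloor>" for m :: "int^'n"
    have "(\<Sum>m\<in>F. exp (- b * norm (multi_idx m))) =
        (\<Sum>j\<in>lev ` F. \<Sum>m\<in>{m \<in> F. lev m = j}. exp (- b * norm (multi_idx m)))"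
      using F by (intro sum.group[symmetric]) auto
    also have "\<dots> \<le> (\<Sum>j\<in>lev ` F. u j)"
    proof (rule sum_mono)
      fix j
      have lv: "real j \<le> norm (multi_idx m)" "norm (multi_idx m) \<le> real j + 1" if "lev m = j" for m
        using that norm_ge_zero[of "multi_idx m"] unfolding lev_def by linarith+
      have "(\<Sum>m\<in>{m \<in> F. lev m = j}. exp (- b * norm (multi_idx m))) \<le> (\<Sum>m\<in>{m \<in> F. lev m = j}. exp (- b * real j))"
        using b lv by (intro sum_mono) auto
      also have "\<dots> = real (card {m \<in> F. lev m = j}) * exp (- b * real j)" by simp
      also have "\<dots> \<le> (?w * (real j + 1 + real ?d) ^ ?d) * exp (- b * real j)"
      proof (intro mult_right_mono)
        have "real (card {m \<in> F. lev m = j}) \<le> real (card {m :: int^'n. norm (multi_idx m) \<le> real j + 1})"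
          unfolding of_nat_le_iff using lv by (intro card_mono card_lattice_ball) auto
        also have "\<dots> \<le> ?w * (real j + 1 + real ?d) ^ ?d"
          by (rule card_lattice_ball) simp
        finally show "real (card {m \<in> F. lev m = j}) \<le> ?w * (real j + 1 + real ?d) ^ ?d" .
      qed simp
      finally show "(\<Sum>m\<in>{m \<in> F. lev m = j}. exp (- b * norm (multi_idx m))) \<le> u j"
        by (simp add: u_def mult.assoc add.assoc)
    qed
    also have "\<dots> \<le> suminf u"
    proof (rule sum_le_suminf[OF \<open>summable u\<close>])
      show "0 \<le> u j" for j
        using omega_ball_pos[where 'n='n] by (simp add: u_def)
    qed (use F in auto)
    finally show ?thesis .
  qed
  then show ?thesis using that by blast
qed

lemma exp_powr_sum_bounded:
  assumes "a > 0" "w > 0" "\<tau> > (0::real)"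
  obtains R where "\<And>F. finite F \<Longrightarrow> (\<Sum>n\<in>F. exp (- a * (real n / w) powr \<tau>)) \<le> R"
proof -
  have "(\<lambda>n. real n ^ 2 * exp (- a * (real n / w) powr \<tau>)) \<longlonglongrightarrow> 0"
    using assms by real_asymp
  then have "Bseq (\<lambda>n. real n ^ 2 * exp (- a * (real n / w) powr \<tau>))"
    by (intro convergent_imp_Bseq convergentI)
  then obtain K where K: "\<And>n. norm (real n ^ 2 * exp (- a * (real n / w) powr \<tau>)) \<le> K"
    by (auto simp: Bseq_def)
  have "summable (\<lambda>n. exp (- a * (real n / w) powr \<tau>))"
  proof (rule summable_comparison_test[rotated])
    show "summable (\<lambda>n. K * inverse (real n ^ 2))"
      by (intro summable_mult inverse_power_summable) simp
    show "\<exists>N. \<forall>n\<ge>N. norm (exp (- a * (real n / w) powr \<tau>)) \<le> K * inverse (real n ^ 2)"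
    proof (intro exI allI impI)
      fix n :: nat assume "n \<ge> 1"
      then have n: "real n ^ 2 > 0" by simp
      have "real n ^ 2 * exp (- a * (real n / w) powr \<tau>) \<le> K"
        using K[of n] by (simp only: norm_mult) simp
      then have "exp (- a * (real n / w) powr \<tau>) \<le> K / real n ^ 2"
        using n by (simp only: pos_le_divide_eq mult.commute)
      then show "norm (exp (- a * (real n / w) powr \<tau>)) \<le> K * inverse (real n ^ 2)"
        by (simp add: divide_inverse)
    qed
  qed
  then have "(\<Sum>n\<in>F. exp (- a * (real n / w) powr \<tau>)) \<le> (\<Sum>n. exp (- a * (real n / w) powr \<tau>))" if "finite F" for F
    using that by (intro sum_le_suminf) auto
  then show ?thesis using that by blast
qed

section \<open>Counting the retained matrix entries\<close>

lemma power_Suc_diff_ge: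
  fixes a b :: real
  assumes "0 \<le> b" "b \<le> a"
  shows "(real d + 1) * b ^ d * (a - b) \<le> a ^ Suc d - b ^ Suc d"
proof (induction d)
  case (Suc d)
  have "(real (Suc d) + 1) * b ^ Suc d * (a - b) = b * ((real d + 1) * b ^ d * (a - b)) + b ^ Suc d * (a - b)"
    by (simp add: algebra_simps)
  also have "\<dots> \<le> a * (a ^ Suc d - b ^ Suc d) + b ^ Suc d * (a - b)"
  proof -
    have "0 \<le> (real d + 1) * b ^ d * (a - b)" using assms by simp
    then show ?thesis using assms Suc by (intro add_right_mono mult_mono) auto
  qed
  also have "\<dots> = a ^ Suc (Suc d) - b ^ Suc (Suc d)"
    by (simp add: algebra_simps)
  finally show ?case .
qed simp

text \<open>A Riemann sum for \<open>\<integral>\<^sub>0\<^sup>1 (1 - y)\<^sup>d dy = 1 / (d + 1)\<close>, estimated by a telescoping sum.\<close>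

lemma sum_one_minus_power_le:
  fixes X :: real
  assumes X: "X > 0"
  shows "(\<Sum>n\<le>nat \<lfloor>X\<rfloor>. (1 - real n / X) ^ d) \<le> 1 + X / (real d + 1)"
proof -
  define g where "g n = (1 - real n / X) ^ Suc d" for n :: nat
  define K where "K = nat \<lfloor>X\<rfloor>"
  have KX: "real K \<le> X" using X by (simp add: K_def)
  have step: "(1 - real (Suc n) / X) ^ d \<le> X / (real d + 1) * (g n - g (Suc n))" if "n < K" for n
  proof -
    have "real (Suc n) \<le> X" using that KX by linarith
    then have b: "0 \<le> 1 - real (Suc n) / X" "1 - real (Suc n) / X \<le> 1 - real n / X"
      using X by (auto simp: divide_le_eq divide_right_mono)
    have "(real d + 1) * (1 - real (Suc n) / X) ^ d * ((1 - real n / X) - (1 - real (Suc n) / X)) \<le> g n - g (Suc n)"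
      unfolding g_def by (rule power_Suc_diff_ge[OF b])
    moreover have "(1 - real n / X) - (1 - real (Suc n) / X) = 1 / X"
      using X by (simp add: field_simps)
    ultimately have "(real d + 1) * (1 - real (Suc n) / X) ^ d / X \<le> g n - g (Suc n)"
      by simp
    then show ?thesis using X by (simp add: field_simps)
  qed
  have "(\<Sum>n\<le>K. (1 - real n / X) ^ d) = 1 + (\<Sum>n<K. (1 - real (Suc n) / X) ^ d)"
    by (subst sum.atMost_shift) simp
  also have "\<dots> \<le> 1 + (\<Sum>n<K. X / (real d + 1) * (g n - g (Suc n)))"
    using step by (intro add_left_mono sum_mono) auto
  also have "(\<Sum>n<K. X / (real d + 1) * (g n - g (Suc n))) = X / (real d + 1) * (g 0 - g K)"
    by (subst sum_distrib_left[symmetric]) (simp only: sum_lessThan_telescope')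
  also have "\<dots> \<le> X / (real d + 1) * 1"
  proof (rule mult_left_mono)
    have "g K \<ge> 0" using KX X by (simp add: g_def)
    then show "g 0 - g K \<le> 1" by (simp add: g_def)
  qed (use X in simp)
  finally show ?thesis by (simp add: K_def)
qed

text \<open>The entries kept for precision \<open>J\<close> are those whose exponential weight is at most \<open>\<eta> * J\<close>,
  counted by the position \<open>n\<close> in the decreasing rearrangement and the offset \<open>m\<close> from the diagonal.
  The bound behaves like a Beta integral; as \<open>\<tau> \<le> 1\<close>, its integrand is dominated by \<open>(1 - y)\<^sup>d\<close>.\<close>

lemma card_retained_le:
  fixes \<eta> \<eta>\<^sub>L \<tau> J :: real
  defines "\<omega> \<equiv> omega_ball TYPE('n::finite)" and "d \<equiv> CARD('n)"
  defines "R \<equiv> {(n, m :: int^'n). \<eta>\<^sub>L * norm (multi_idx m) + \<eta> * (real n / \<omega>) powr \<tau> \<le> \<eta> * J}"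
    and "J' \<equiv> J + real d * \<eta>\<^sub>L / \<eta>"
  assumes \<eta>: "\<eta> > 0" "\<eta>\<^sub>L > 0" and \<tau>: "0 < \<tau>" "\<tau> \<le> 1" and J: "J \<ge> 0"
  shows "finite R" and "real (card R) \<le> \<omega> * (\<eta> / \<eta>\<^sub>L * J') ^ d * (1 + \<omega> * J' powr (1 / \<tau>) / (real d + 1))"
proof -
  define \<theta> where "\<theta> = \<eta> / \<eta>\<^sub>L"
  define X where "X = \<omega> * J' powr (1 / \<tau>)"
  have \<omega>: "\<omega> > 0" by (simp add: \<omega>_def omega_ball_pos)
  have \<theta>: "\<theta> > 0" using \<eta> by (simp add: \<theta>_def)
  have d: "d > 0" by (simp add: d_def)
  have J': "J' > J" "J' > 0" using J d \<eta> by (auto simp: J'_def intro: add_nonneg_pos)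
  have X: "X > 0" using \<omega> J' by (simp add: X_def)
  define S where "S = {n :: nat. (real n / \<omega>) powr \<tau> \<le> J}"
  define G where "G n = {m :: int^'n. norm (multi_idx m) \<le> \<theta> * (J - (real n / \<omega>) powr \<tau>)}" for n :: nat
  have SX: "S \<subseteq> {..nat \<lfloor>X\<rfloor>}"
  proof
    fix n assume "n \<in> S"
    then have "((real n / \<omega>) powr \<tau>) powr (1 / \<tau>) \<le> J' powr (1 / \<tau>)"
      using J' \<tau> by (intro powr_mono2) (auto simp: S_def)
    then have "real n / \<omega> \<le> J' powr (1 / \<tau>)"
      using \<tau> \<omega> by (simp add: powr_powr)
    then have "real n \<le> X" using \<omega> by (simp add: X_def field_simps)
    then show "n \<in> {..nat \<lfloor>X\<rfloor>}" by (simp add: le_nat_floor)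
  qed
  then have finS: "finite S" using finite_subset by blast
  have R: "R \<subseteq> Sigma S G"
  proof
    fix p assume "p \<in> R"
    then obtain n m where p: "p = (n, m)" and le: "\<eta>\<^sub>L * norm (multi_idx m) + \<eta> * (real n / \<omega>) powr \<tau> \<le> \<eta> * J"
      by (auto simp: R_def)
    have "0 \<le> \<eta>\<^sub>L * norm (multi_idx m)" using \<eta> by simp
    then have "\<eta> * (real n / \<omega>) powr \<tau> \<le> \<eta> * J" using le by linarith
    then have "n \<in> S" using \<eta> by (simp add: S_def)
    moreover have "\<eta>\<^sub>L * norm (multi_idx m) \<le> \<eta> * (J - (real n / \<omega>) powr \<tau>)"
      using le by (simp add: right_diff_distrib)
    then have "norm (multi_idx m) \<le> \<theta> * (J - (real n / \<omega>) powr \<tau>)"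
      using \<eta> by (simp add: \<theta>_def field_simps)
    ultimately show "p \<in> Sigma S G" by (simp add: p G_def)
  qed
  have G: "finite (G n)" "real (card (G n)) \<le> \<omega> * (\<theta> * J') ^ d * (1 - real n / X) ^ d" if n: "n \<in> S" for n
  proof -
    have nn: "0 \<le> \<theta> * (J - (real n / \<omega>) powr \<tau>)" using n \<theta> by (simp add: S_def)
    show "finite (G n)" unfolding G_def by (rule card_lattice_ball[OF nn])
    have nX: "real n \<le> X" using n SX X by (auto simp: le_nat_iff le_floor_iff)
    have "real n / X \<le> (real n / X) powr \<tau>"
    proof (cases "n = 0")
      case False
      then have "(real n / X) powr 1 \<le> (real n / X) powr \<tau>"
        using nX X \<tau> by (intro powr_mono') auto
      then show ?thesis using X by simp
    qed simp
    also have "(real n / X) powr \<tau> = (real n / \<omega>) powr \<tau> / J'"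
    proof -
      have "real n / X = (real n / \<omega>) / J' powr (1 / \<tau>)" by (simp add: X_def)
      then have "(real n / X) powr \<tau> = (real n / \<omega>) powr \<tau> / (J' powr (1 / \<tau>)) powr \<tau>"
        using \<omega> by (simp only: powr_divide)
      then show ?thesis using \<tau> J' by (simp add: powr_powr)
    qed
    finally have "J' * (real n / X) \<le> (real n / \<omega>) powr \<tau>"
      using J' by (simp add: field_simps)
    then have up: "J' - (real n / \<omega>) powr \<tau> \<le> J' * (1 - real n / X)"
      by (simp add: algebra_simps)
    \<comment> \<open>The enlargement of the radius in the lattice point count becomes the shift from \<open>J\<close> to \<open>J'\<close>.\<close>
    have eq: "\<theta> * (J - (real n / \<omega>) powr \<tau>) + real d = \<theta> * (J' - (real n / \<omega>) powr \<tau>)"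
      using \<eta> by (simp add: \<theta>_def J'_def field_simps)
    have "real (card (G n)) \<le> \<omega> * (\<theta> * (J - (real n / \<omega>) powr \<tau>) + real d) ^ d"
      unfolding G_def \<omega>_def d_def by (rule card_lattice_ball[OF nn[unfolded \<omega>_def]])
    also have "\<dots> = \<omega> * (\<theta> * (J' - (real n / \<omega>) powr \<tau>)) ^ d"
      by (simp only: eq)
    also have "\<dots> \<le> \<omega> * (\<theta> * (J' * (1 - real n / X))) ^ d"
    proof -
      have "0 \<le> \<theta> * (J' - (real n / \<omega>) powr \<tau>)"
        using nn by (simp add: eq[symmetric])
      then show ?thesis
        using \<omega> \<theta> up by (intro mult_left_mono power_mono) auto
    qed
    finally show "real (card (G n)) \<le> \<omega> * (\<theta> * J') ^ d * (1 - real n / X) ^ d"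
      by (simp add: power_mult_distrib mult_ac)
  qed
  have finSG: "finite (Sigma S G)" using finS G by blast
  show "finite R" by (rule finite_subset[OF R finSG])
  have "real (card R) \<le> real (card (Sigma S G))"
    using card_mono[OF finSG R] by simp
  also have "\<dots> = (\<Sum>n\<in>S. real (card (G n)))"
    using finS G by simp
  also have "\<dots> \<le> (\<Sum>n\<in>S. \<omega> * (\<theta> * J') ^ d * (1 - real n / X) ^ d)"
    by (intro sum_mono G)
  also have "\<dots> \<le> (\<Sum>n\<le>nat \<lfloor>X\<rfloor>. \<omega> * (\<theta> * J') ^ d * (1 - real n / X) ^ d)"
  proof (rule sum_mono2)
    fix n assume "n \<in> {..nat \<lfloor>X\<rfloor>} - S"
    then have "real n \<le> X" using X by (auto simp: le_nat_iff le_floor_iff)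
    then have "0 \<le> 1 - real n / X" using X by simp
    then show "0 \<le> \<omega> * (\<theta> * J') ^ d * (1 - real n / X) ^ d"
      using \<omega> \<theta> J' by simp
  qed (use SX in auto)
  also have "\<dots> = \<omega> * (\<theta> * J') ^ d * (\<Sum>n\<le>nat \<lfloor>X\<rfloor>. (1 - real n / X) ^ d)"
    by (simp add: sum_distrib_left)
  also have "\<dots> \<le> \<omega> * (\<theta> * J') ^ d * (1 + X / (real d + 1))"
    using \<omega> \<theta> J' by (intro mult_left_mono sum_one_minus_power_le[OF X]) auto
  finally show "real (card R) \<le> \<omega> * (\<eta> / \<eta>\<^sub>L * J') ^ d * (1 + \<omega> * J' powr (1 / \<tau>) / (real d + 1))"
    by (simp add: \<theta>_def X_def)
qed

text \<open>With \<open>y = N powr (1 / D)\<close>, \<open>D = d + s\<close> and cutoff \<open>J = g * y\<close>, the count of the retained entries is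
  asymptotically a constant multiple of \<open>N\<close>; the shift \<open>c\<close> and the additive \<open>1\<close> are of lower order.\<close>

lemma retained_count_limit:
  fixes g c s w \<theta> :: real
  assumes "s > 0" "g > 0"
  shows "((\<lambda>y. w * (\<theta> * (g * y + c)) ^ d * (1 + w * (g * y + c) powr s / (real d + 1)) / y powr (real d + s))
    \<longlongrightarrow> w\<^sup>2 * \<theta> ^ d / (real d + 1) * g powr (real d + s)) at_top"
proof -
  have "((\<lambda>y. w * (g * y + c) ^ d * (1 + w * (g * y + c) powr s / (real d + 1)) / y powr (real d + s))
    \<longlongrightarrow> w * g ^ d * (w * g powr s * inverse (real d + 1))) at_top"
    using assms by real_asymp
  then have "((\<lambda>y. \<theta> ^ d * (w * (g * y + c) ^ d * (1 + w * (g * y + c) powr s / (real d + 1)) / y powr (real d + s)))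
    \<longlongrightarrow> \<theta> ^ d * (w * g ^ d * (w * g powr s * inverse (real d + 1)))) at_top"
    by (rule tendsto_mult_left)
  moreover have "\<theta> ^ d * (w * g ^ d * (w * g powr s * inverse (real d + 1))) = w\<^sup>2 * \<theta> ^ d / (real d + 1) * g powr (real d + s)"
    using assms by (simp add: powr_add powr_realpow divide_inverse power2_eq_square mult_ac)
  ultimately show ?thesis
    by (simp add: power_mult_distrib mult_ac)
qed

section \<open>Decreasing rearrangement\<close>

text \<open>Ranks are assigned by decreasing size, with ties broken by an enumeration, so they are
  injective and an element of rank \<open>r\<close> has at least \<open>r\<close> others of at least its size.\<close>

lemma decreasing_rank:
  fixes V :: "'a::countable \<Rightarrow> real"
  assumes fin: "\<And>k. V k > 0 \<Longrightarrow> finite {k'. V k' \<ge> V k}"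
  obtains r :: "'a \<Rightarrow> nat" where "inj_on r {k. V k > 0}"
    "\<And>k (\<Lambda> :: 'a set). V k > 0 \<Longrightarrow> finite \<Lambda> \<Longrightarrow> card \<Lambda> = r k \<Longrightarrow> \<exists>k'. k' \<notin> \<Lambda> \<and> V k \<le> V k'"
proof -
  define B where "B k = {k'. V k' > V k \<or> V k' = V k \<and> to_nat k' < to_nat k}" for k
  have finB: "finite (B k)" if "V k > 0" for k
    by (rule finite_subset[OF _ fin[OF that]]) (auto simp: B_def)
  have less: "card (B k) < card (B k')" if "k \<in> B k'" "V k' > 0" for k k'
  proof (rule psubset_card_mono[OF finB[OF that(2)]])
    show "B k \<subset> B k'"
      using that(1) by (auto simp: B_def)
  qed
  show ?thesis
  proof (rule that[of "\<lambda>k. card (B k)"])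
    show "inj_on (\<lambda>k. card (B k)) {k. V k > 0}"
    proof (rule inj_onI, rule ccontr)
      fix k k' assume *: "k \<in> {k. V k > 0}" "k' \<in> {k. V k > 0}" "card (B k) = card (B k')" "k \<noteq> k'"
      have "k \<in> B k' \<or> k' \<in> B k"
        using \<open>k \<noteq> k'\<close> by (auto simp: B_def) (metis linorder_neqE to_nat_split inj_to_nat injD)+
      then show False using less[of k k'] less[of k' k] * by auto
    qed
    fix k and \<Lambda> :: "'a set" assume k: "V k > 0" and \<Lambda>: "finite \<Lambda>" "card \<Lambda> = card (B k)"
    have "card (insert k (B k)) = Suc (card (B k))"
      using finB[OF k] by (simp add: B_def)
    then have "\<not> insert k (B k) \<subseteq> \<Lambda>"
      using card_mono[OF \<Lambda>(1), of "insert k (B k)"] \<Lambda>(2) by auto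
    then show "\<exists>k'. k' \<notin> \<Lambda> \<and> V k \<le> V k'"
      by (auto simp: B_def)
  qed
qed


section \<open>Best approximation errors and the exponential classes\<close>

lemma infinite_int_vec: "infinite (UNIV :: (int^'n) set)"
proof -
  have "inj (\<lambda>z. axis (undefined :: 'n) (z :: int))"
    by (auto simp: inj_def axis_eq_axis)
  then show ?thesis
    using finite_imageD[of "\<lambda>z. axis (undefined :: 'n) (z :: int)" UNIV] infinite_UNIV_int
    by (meson finite_subset subset_UNIV)
qed

lemma obtain_index_superset:
  fixes A :: "(int^'n) set"
  assumes "finite A" "card A \<le> N"
  obtains \<Lambda> where "A \<subseteq> \<Lambda>" "finite \<Lambda>" "card \<Lambda> = N"
proof -
  have "infinite (UNIV - A)"
    using assms infinite_int_vec Diff_infinite_finite by blast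
  then obtain T where T: "finite T" "card T = N - card A" "T \<subseteq> UNIV - A"
    using infinite_arbitrarily_large by blast
  show ?thesis
  proof (rule that[of "A \<union> T"])
    show "card (A \<union> T) = N"
      using assms T by (subst card_Un_disjoint) auto
  qed (use assms T in auto)
qed

lemma best_err_le:
  fixes P :: "(int^'n) set \<Rightarrow> 'v::minus \<Rightarrow> 'v"
  assumes "\<And>u. 0 \<le> nrm u" "finite \<Lambda>" "card \<Lambda> = N"
  shows "best_err nrm P N v \<le> nrm (v - P \<Lambda> v)"
  unfolding best_err_def using assms by (intro cInf_lower bdd_belowI[of _ 0]) auto

lemma best_err_ge:
  fixes P :: "(int^'n) set \<Rightarrow> 'v::minus \<Rightarrow> 'v"
  assumes "\<And>\<Lambda>. finite \<Lambda> \<Longrightarrow> card \<Lambda> = N \<Longrightarrow> c \<le> nrm (v - P \<Lambda> v)"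
  shows "c \<le> best_err nrm P N v"
  unfolding best_err_def
proof (rule cInf_greatest)
  obtain \<Lambda> :: "(int^'n) set" where "finite \<Lambda>" "card \<Lambda> = N"
    using obtain_index_superset[of "{}" N] by auto
  then show "{nrm (v - P \<Lambda> v) |\<Lambda>. finite \<Lambda> \<and> card \<Lambda> = N} \<noteq> {}" by blast
qed (use assms in auto)

lemma Hm1norm_nonneg: "0 \<le> Hm1norm f"
  by (simp add: Hm1norm_def infsum_nonneg)

lemma omega_powr_scale:
  "omega_ball TYPE('n::finite) powr - (t / d) * real N powr (t / d) = (real N / omega_ball TYPE('n)) powr (t / d)"
  using omega_ball_pos[where 'n='n] by (simp add: powr_divide powr_minus_divide)

text \<open>The extended real suprema that define the classes are turned into error bounds for all \<open>N\<close>. As the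
  class norm \<open>M\<close> enters linearly, it may vanish.\<close>

lemma (in torus_form) exp_class_transfer:
  assumes C: "C > 0"
    and main: "\<And>v M. v \<in> H1p \<Longrightarrow> M \<ge> 0 \<Longrightarrow>
      (\<And>N. best_err H1norm proj_fun N v \<le>
        M * exp (- \<eta> * (real N / omega_ball TYPE('n)) powr (t / real CARD('n)))) \<Longrightarrow>
      (\<And>N. best_err Hm1norm proj_form N (Lop \<nu> \<sigma> v) \<le>
        C * M * exp (- \<eta>' * (real N / omega_ball TYPE('n)) powr (t' / real CARD('n))))"
  shows "\<forall>v \<in> AG \<eta> t. Lop \<nu> \<sigma> v \<in> AG_form \<eta>' t' \<and>
    AG_form_norm \<eta>' t' (Lop \<nu> \<sigma> v) \<le> ennreal C * AG_norm \<eta> t v"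
proof
  fix v :: "real^'n \<Rightarrow> complex" assume "v \<in> AG \<eta> t"
  then have v: "v \<in> H1p" and fin: "AG_norm \<eta> t v < \<infinity>" by (auto simp: AG_def)
  define M where "M = enn2real (AG_norm \<eta> t v)"
  have AGM: "AG_norm \<eta> t v = ennreal M" and M: "M \<ge> 0"
    using fin by (auto simp: M_def)
  have "best_err H1norm proj_fun N v \<le>
      M * exp (- \<eta> * (real N / omega_ball TYPE('n)) powr (t / real CARD('n)))" for N
  proof -
    let ?x = "\<eta> * (real N / omega_ball TYPE('n)) powr (t / real CARD('n))"
    have "ennreal (best_err H1norm proj_fun N v * exp ?x) \<le> AG_norm \<eta> t v"
      unfolding AG_norm_def exp_norm_def
      by (rule SUP_upper2[of N]) (simp_all add: mult.assoc omega_powr_scale)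
    then have "best_err H1norm proj_fun N v * exp ?x \<le> M"
      using M by (simp add: AGM)
    then have "best_err H1norm proj_fun N v * exp ?x * exp (- ?x) \<le> M * exp (- ?x)"
      by (intro mult_right_mono) auto
    then show ?thesis
      by (simp add: mult.assoc exp_add[symmetric])
  qed
  note err = main[OF v M this]
  have "AG_form_norm \<eta>' t' (Lop \<nu> \<sigma> v) \<le> ennreal (C * M)"
    unfolding AG_form_norm_def exp_norm_def
  proof (rule SUP_least)
    fix N
    let ?y = "\<eta>' * (real N / omega_ball TYPE('n)) powr (t' / real CARD('n))"
    have "best_err Hm1norm proj_form N (Lop \<nu> \<sigma> v) * exp ?y \<le> C * M * exp (- ?y) * exp ?y"
      using err[of N] by (intro mult_right_mono) auto
    then have "best_err Hm1norm proj_form N (Lop \<nu> \<sigma> v) * exp ?y \<le> C * M"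
      by (simp add: mult.assoc exp_add[symmetric])
    then show "ennreal (best_err Hm1norm proj_form N (Lop \<nu> \<sigma> v) *
        exp (\<eta>' * omega_ball TYPE('n) powr (- t' / real CARD('n)) * real N powr (t' / real CARD('n)))) \<le> ennreal (C * M)"
      by (intro ennreal_leI) (simp add: mult.assoc omega_powr_scale)
  qed
  also have le: "ennreal (C * M) = ennreal C * AG_norm \<eta> t v"
    using C M by (simp add: AGM ennreal_mult)
  finally have "AG_form_norm \<eta>' t' (Lop \<nu> \<sigma> v) \<le> ennreal C * AG_norm \<eta> t v" .
  moreover from this have "AG_form_norm \<eta>' t' (Lop \<nu> \<sigma> v) < \<infinity>"
    using fin by (auto simp: le[symmetric] intro: le_less_trans)
  ultimately show "Lop \<nu> \<sigma> v \<in> AG_form \<eta>' t' \<and> AG_form_norm \<eta>' t' (Lop \<nu> \<sigma> v) \<le> ennreal C * AG_norm \<eta> t v"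
    using Lop_Hm1[OF v] by (simp add: AG_form_def)
qed

section \<open>Banded matrices\<close>

text \<open>Concavity of \<open>x powr \<tau>\<close>; it absorbs the rounding of \<open>N / B\<close> to an integer into a constant.\<close>

lemma powr_subadditive:
  fixes x y \<tau> :: real
  assumes "0 \<le> x" "0 \<le> y" "0 < \<tau>" "\<tau> \<le> 1"
  shows "(x + y) powr \<tau> \<le> x powr \<tau> + y powr \<tau>"
proof (cases "x + y = 0")
  case False
  then have s: "x + y > 0" using assms by linarith
  have *: "z / (x + y) \<le> z powr \<tau> / (x + y) powr \<tau>" if "0 \<le> z" "z \<le> x + y" for z
  proof (cases "z = 0")
    case False
    then have "(z / (x + y)) powr 1 \<le> (z / (x + y)) powr \<tau>"
      using assms s that by (intro powr_mono') auto
    then show ?thesis using s that by (simp add: powr_divide)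
  qed simp
  have "1 = x / (x + y) + y / (x + y)"
    using s by (simp add: add_divide_distrib[symmetric])
  also have "\<dots> \<le> x powr \<tau> / (x + y) powr \<tau> + y powr \<tau> / (x + y) powr \<tau>"
    using assms by (intro add_mono *) auto
  finally show ?thesis
    using s by (simp add: add_divide_distrib[symmetric] le_divide_eq)
qed (use assms in simp)

context torus_form
begin

lemma norm_aform_phi: "cmod (aform \<nu> \<sigma> (phi k) (phi l)) = cw l * cw k * cmod (stiffness \<nu> \<sigma> l k)"
  using cw_pos[of k] cw_pos[of l] by (simp add: stiffness_def norm_divide norm_mult)

text \<open>Outside the index set swept out by the diagonals from \<open>\<Lambda>\<close>, the form sees only the part of
  the function that the projection discards.\<close>

lemma best_err_banded:
  assumes B: "finite (nonzero_diagonals (stiffness \<nu> \<sigma>))" "card (nonzero_diagonals (stiffness \<nu> \<sigma>)) = B"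
    and M: "M > 0" "\<And>u v. u \<in> H1p \<Longrightarrow> v \<in> H1p \<Longrightarrow> cmod (aform \<nu> \<sigma> u v) \<le> M * (H1norm u * H1norm v)"
    and v: "v \<in> H1p" and N: "n * B \<le> N"
  shows "best_err Hm1norm proj_form N (Lop \<nu> \<sigma> v) \<le> M * best_err H1norm proj_fun n v"
proof -
  let ?D = "nonzero_diagonals (stiffness \<nu> \<sigma>)"
  have "best_err Hm1norm proj_form N (Lop \<nu> \<sigma> v) / M \<le> best_err H1norm proj_fun n v"
  proof (rule best_err_ge)
    fix \<Lambda> :: "(int^'n) set" assume \<Lambda>: "finite \<Lambda>" "card \<Lambda> = n"
    let ?A = "(\<lambda>(k, m). k + m) ` (\<Lambda> \<times> ?D)"
    have "card ?A \<le> n * B"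
      using card_image_le[of "\<Lambda> \<times> ?D" "\<lambda>(k, m). k + m"] \<Lambda> B by (simp add: card_cartesian_product)
    then have "card ?A \<le> N" using N by linarith
    moreover have "finite ?A" using \<Lambda> B by simp
    ultimately obtain \<Lambda>' where \<Lambda>': "?A \<subseteq> \<Lambda>'" "finite \<Lambda>'" "card \<Lambda>' = N"
      using obtain_index_superset by blast
    let ?w = "v - proj_fun \<Lambda> v"
    have w: "?w \<in> H1p" by (rule proj_fun_remainder[OF v \<Lambda>(1)])
    have eq: "aform \<nu> \<sigma> v (phi l) = aform \<nu> \<sigma> ?w (phi l)" if l: "l \<notin> \<Lambda>'" for l
    proof -
      have "aform \<nu> \<sigma> (phi k) (phi l) = 0" if k: "k \<in> \<Lambda>" for k
      proof -
        have "l - k \<notin> ?D"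
        proof
          assume "l - k \<in> ?D"
          then have "k + (l - k) \<in> ?A" using k by (intro image_eqI[of _ _ "(k, l - k)"]) auto
          then show False using l \<Lambda>' by auto
        qed
        then have "stiffness \<nu> \<sigma> l k = 0"
          unfolding nonzero_diagonals_def by blast
        then show ?thesis using norm_aform_phi[of k l] by simp
      qed
      then show ?thesis
        by (simp add: aform_remainder[OF v H1p_phi \<Lambda>(1)])
    qed
    have "Hm1norm (Lop \<nu> \<sigma> v - proj_form \<Lambda>' (Lop \<nu> \<sigma> v)) \<le> M * H1norm ?w"
    proof (rule Hm1norm_remainder_le[OF \<Lambda>'(2)])
      show "0 \<le> M * H1norm ?w" using M by (simp add: H1norm_nonneg)
      fix F :: "(int^'n) set" assume F: "finite F" "F \<inter> \<Lambda>' = {}"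
      have "(\<Sum>l\<in>F. (cmod (Lop \<nu> \<sigma> v (phi l)) / cw l)\<^sup>2) = (\<Sum>l\<in>F. (cmod (aform \<nu> \<sigma> ?w (phi l)) / cw l)\<^sup>2)"
      proof (rule sum.cong)
        fix l assume "l \<in> F"
        then have "l \<notin> \<Lambda>'" using F by blast
        from eq[OF this] show "(cmod (Lop \<nu> \<sigma> v (phi l)) / cw l)\<^sup>2 = (cmod (aform \<nu> \<sigma> ?w (phi l)) / cw l)\<^sup>2"
          unfolding Lop_def by simp
      qed simp
      also have "\<dots> \<le> (M * H1norm ?w)\<^sup>2"
        by (rule aform_dual_bound[OF M w F(1)])
      finally show "(\<Sum>l\<in>F. (cmod (Lop \<nu> \<sigma> v (phi l)) / cw l)\<^sup>2) \<le> (M * H1norm ?w)\<^sup>2" .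
    qed
    moreover have "best_err Hm1norm proj_form N (Lop \<nu> \<sigma> v) \<le> Hm1norm (Lop \<nu> \<sigma> v - proj_form \<Lambda>' (Lop \<nu> \<sigma> v))"
      by (rule best_err_le[OF Hm1norm_nonneg \<Lambda>'(2,3)])
    ultimately show "best_err Hm1norm proj_form N (Lop \<nu> \<sigma> v) / M \<le> H1norm ?w"
      using M by (simp add: divide_le_eq mult.commute)
  qed
  then show ?thesis using M by (simp add: divide_le_eq mult.commute)
qed

text \<open>Keeping \<open>N div B\<close> indices of the function, where \<open>B\<close> is the number of diagonals, leads to at most \<open>N\<close>
  indices of the form; the quotient \<open>N / B\<close> in the exponent gives the factor in the new rate.\<close>

lemma banded_case:
  assumes bd: "banded p (stiffness \<nu> \<sigma>)" and \<eta>: "\<eta> > 0" and t: "0 < t" "t \<le> real CARD('n)"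
  shows "\<exists>C>0. \<forall>v \<in> AG \<eta> t. Lop \<nu> \<sigma> v \<in> AG_form (\<eta> / (2 * real p + 1) powr (t / real CARD('n))) t \<and>
    AG_form_norm (\<eta> / (2 * real p + 1) powr (t / real CARD('n))) t (Lop \<nu> \<sigma> v) \<le> ennreal C * AG_norm \<eta> t v"
proof -
  define \<tau> where "\<tau> = t / real CARD('n)"
  define \<omega> where "\<omega> = omega_ball TYPE('n)"
  define B where "B = 2 * p + 1"
  have \<tau>: "0 < \<tau>" "\<tau> \<le> 1" using t by (simp_all add: \<tau>_def)
  have \<omega>: "\<omega> > 0" by (simp add: \<omega>_def omega_ball_pos)
  have rB: "2 * real p + 1 = real B" "B > 0" by (simp_all add: B_def)
  obtain M where M: "M > 0"
    "\<And>u v. u \<in> H1p \<Longrightarrow> v \<in> H1p \<Longrightarrow> cmod (aform \<nu> \<sigma> u v) \<le> M * (H1norm u * H1norm v)"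
    using aform_bounded by blast
  define C where "C = M * exp (\<eta> * (1 / \<omega>) powr \<tau>)"
  have C: "C > 0" using M by (simp add: C_def)
  have "\<forall>v \<in> AG \<eta> t. Lop \<nu> \<sigma> v \<in> AG_form (\<eta> / real B powr \<tau>) t \<and>
    AG_form_norm (\<eta> / real B powr \<tau>) t (Lop \<nu> \<sigma> v) \<le> ennreal C * AG_norm \<eta> t v"
  proof (rule exp_class_transfer[OF C])
    fix v :: "real^'n \<Rightarrow> complex" and K :: real and N
    assume v: "v \<in> H1p" and K: "K \<ge> 0"
      and err: "\<And>N. best_err H1norm proj_fun N v \<le> K * exp (- \<eta> * (real N / omega_ball TYPE('n)) powr (t / real CARD('n)))"
    define n where "n = N div B"
    have "best_err Hm1norm proj_form N (Lop \<nu> \<sigma> v) \<le> M * best_err H1norm proj_fun n v"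
    proof (rule best_err_banded[OF _ _ M v])
      show "n * B \<le> N" by (simp add: n_def)
    qed (use bd in \<open>auto simp: banded_def B_def\<close>)
    also have "\<dots> \<le> M * (K * exp (- \<eta> * (real n / \<omega>) powr \<tau>))"
      using M err[of n] by (intro mult_left_mono) (auto simp: \<omega>_def \<tau>_def)
    also have "\<dots> \<le> M * (K * exp (\<eta> * (1 / \<omega>) powr \<tau> - \<eta> / real B powr \<tau> * (real N / \<omega>) powr \<tau>))"
    proof -
      have "N \<le> (n + 1) * B"
        unfolding n_def using rB(2) by (metis add.commute dividend_less_times_div less_imp_le mult.commute plus_1_eq_Suc mult_Suc_right)
      then have "real N \<le> real ((n + 1) * B)" by (simp only: of_nat_le_iff)
      then have "real N / \<omega> / real B \<le> real n / \<omega> + 1 / \<omega>"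
        using rB \<omega> by (simp add: field_simps)
      then have "(real N / \<omega> / real B) powr \<tau> \<le> (real n / \<omega> + 1 / \<omega>) powr \<tau>"
        using \<tau> \<omega> by (intro powr_mono2) auto
      also have "\<dots> \<le> (real n / \<omega>) powr \<tau> + (1 / \<omega>) powr \<tau>"
        using \<tau> \<omega> by (intro powr_subadditive) auto
      finally have "\<eta> * ((real N / \<omega>) powr \<tau> / real B powr \<tau>) \<le> \<eta> * ((real n / \<omega>) powr \<tau> + (1 / \<omega>) powr \<tau>)"
        using \<eta> \<omega> by (intro mult_left_mono) (auto simp: powr_divide powr_mult)
      then have "- \<eta> * (real n / \<omega>) powr \<tau> \<le> \<eta> * (1 / \<omega>) powr \<tau> - \<eta> / real B powr \<tau> * (real N / \<omega>) powr \<tau>"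
        by (simp add: algebra_simps)
      then show ?thesis
        using M K by (intro mult_left_mono) auto
    qed
    also have "\<dots> = C * K * exp (- (\<eta> / real B powr \<tau>) * (real N / \<omega>) powr \<tau>)"
      by (simp add: C_def exp_diff exp_minus field_simps)
    finally show "best_err Hm1norm proj_form N (Lop \<nu> \<sigma> v) \<le>
        C * K * exp (- (\<eta> / real B powr \<tau>) * (real N / omega_ball TYPE('n)) powr (t / real CARD('n)))"
      by (simp add: \<omega>_def \<tau>_def)
  qed
  then show ?thesis
    using C unfolding rB \<tau>_def by blast
qed

end

section \<open>Matrices with exponential decay\<close>

text \<open>An index set with as many elements as the rank of \<open>k\<close> misses an index whose coefficient is at least
  as large as the one at \<open>k\<close>, whatever the set.\<close>

lemma coefficient_rank:
  fixes v :: "real^'n \<Rightarrow> complex"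
  assumes v: "v \<in> H1p"
  obtains r :: "int^'n \<Rightarrow> nat" where "inj_on r {k. cw k * cmod (fcoef v k) > 0}"
    "\<And>k. cw k * cmod (fcoef v k) > 0 \<Longrightarrow> cw k * cmod (fcoef v k) \<le> best_err H1norm proj_fun (r k) v"
proof -
  define V where "V k = cw k * cmod (fcoef v k)" for k :: "int^'n"
  have fin: "finite {k'. V k' \<ge> V k}" if k: "V k > 0" for k
  proof -
    have "card G \<le> nat \<lfloor>(H1norm v)\<^sup>2 / (V k)\<^sup>2\<rfloor>" if G: "G \<subseteq> {k'. V k' \<ge> V k}" "finite G" for G
    proof -
      have "real (card G) * (V k)\<^sup>2 = (\<Sum>k'\<in>G. (V k)\<^sup>2)" by simp
      also have "\<dots> \<le> (\<Sum>k'\<in>G. (V k')\<^sup>2)"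
        using G k by (intro sum_mono power_mono) auto
      also have "\<dots> \<le> (H1norm v)\<^sup>2"
        unfolding V_def by (rule has_sum_mono_neutral[OF has_sum_finite[OF G(2)] H1norm_has_sum(1)[OF v]]) auto
      finally have "real (card G) \<le> (H1norm v)\<^sup>2 / (V k)\<^sup>2"
        using k by (simp add: le_divide_eq)
      then show ?thesis by (simp add: le_nat_floor)
    qed
    then show ?thesis
      using finite_if_finite_subsets_card_bdd by blast
  qed
  obtain r where r: "inj_on r {k. V k > 0}"
    "\<And>k \<Lambda>. V k > 0 \<Longrightarrow> finite \<Lambda> \<Longrightarrow> card \<Lambda> = r k \<Longrightarrow> \<exists>k'. k' \<notin> \<Lambda> \<and> V k \<le> V k'"
    using decreasing_rank[of V, OF fin] by metis
  have "V k \<le> best_err H1norm proj_fun (r k) v" if k: "V k > 0" for k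
  proof (rule best_err_ge)
    fix \<Lambda> :: "(int^'n) set" assume \<Lambda>: "finite \<Lambda>" "card \<Lambda> = r k"
    then obtain k' where "k' \<notin> \<Lambda>" "V k \<le> V k'" using r(2)[OF k] by blast
    then show "V k \<le> H1norm (v - proj_fun \<Lambda> v)"
      using H1norm_remainder(2)[OF v \<Lambda>(1), of k'] by (simp add: V_def)
  qed
  with r(1) show ?thesis
    unfolding V_def by (rule that)
qed

context torus_form
begin

text \<open>The discarded entries have exponential weight larger than \<open>x\<close>. A share \<open>\<epsilon>\<close> of the weight makes
  the double sum over positions and offsets converge; the rest yields the decay.\<close>

lemma discarded_sum_le:
  fixes r :: "int^'n \<Rightarrow> nat"
  assumes A: "\<And>l k. cmod (stiffness \<nu> \<sigma> l k) \<le> c * exp (- \<eta>\<^sub>L * norm (multi_idx (l - k)))"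
    and v: "v \<in> H1p" and r: "inj_on r {k. cw k * cmod (fcoef v k) > 0}"
    and V: "\<And>k. cw k * cmod (fcoef v k) > 0 \<Longrightarrow> cw k * cmod (fcoef v k) \<le> M * exp (- \<eta> * (real (r k) / \<omega>) powr \<tau>)"
    and c: "c > 0" and M: "M \<ge> 0" and \<epsilon>: "0 < \<epsilon>" "\<epsilon> < 1"
    and E: "\<And>F. finite F \<Longrightarrow> (\<Sum>m\<in>F. exp (- (\<epsilon> * \<eta>\<^sub>L) * norm (multi_idx (m :: int^'n)))) \<le> E"
    and R: "\<And>F. finite F \<Longrightarrow> (\<Sum>n\<in>F. exp (- (\<epsilon> * \<eta>) * (real n / \<omega>) powr \<tau>)) \<le> R"
    and F: "finite F"
    and x: "\<And>l k. l \<in> F \<Longrightarrow> cw k * cmod (fcoef v k) > 0 \<Longrightarrow>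
      x \<le> \<eta>\<^sub>L * norm (multi_idx (l - k)) + \<eta> * (real (r k) / \<omega>) powr \<tau>"
  shows "(\<Sum>l\<in>F. cmod (aform \<nu> \<sigma> v (phi l)) / cw l) \<le> c * M * exp (- (1 - \<epsilon>) * x) * (E * R)"
proof -
  let ?S = "{k. cw k * cmod (fcoef v k) > 0}"
  define Z where "Z = c * M * exp (- (1 - \<epsilon>) * x)"
  have Z0: "Z \<ge> 0" using c M by (simp add: Z_def)
  have E0: "E \<ge> 0" using E[of "{}"] by simp
  define e where "e m = exp (- (\<epsilon> * \<eta>\<^sub>L) * norm (multi_idx m))" for m :: "int^'n"
  define h where "h n = exp (- (\<epsilon> * \<eta>) * (real n / \<omega>) powr \<tau>)" for n
  have entry: "cmod (fcoef v k * aform \<nu> \<sigma> (phi k) (phi l)) / cw l \<le> (if k \<in> ?S then Z * (e (l - k) * h (r k)) else 0)"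
    if l: "l \<in> F" for l k
  proof -
    have eq: "cmod (fcoef v k * aform \<nu> \<sigma> (phi k) (phi l)) / cw l = cmod (stiffness \<nu> \<sigma> l k) * (cw k * cmod (fcoef v k))"
      using cw_pos[of l] by (simp add: norm_mult norm_aform_phi)
    show ?thesis
    proof (cases "k \<in> ?S")
      case True
      let ?q = "\<eta>\<^sub>L * norm (multi_idx (l - k)) + \<eta> * (real (r k) / \<omega>) powr \<tau>"
      have "cmod (stiffness \<nu> \<sigma> l k) * (cw k * cmod (fcoef v k)) \<le>
          (c * exp (- \<eta>\<^sub>L * norm (multi_idx (l - k)))) * (M * exp (- \<eta> * (real (r k) / \<omega>) powr \<tau>))"
        using True c by (intro mult_mono A V) auto
      also have "\<dots> = c * M * exp (- ?q)"
        by (simp add: exp_add exp_diff exp_minus field_simps)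
      also have "\<dots> \<le> c * M * exp (- (1 - \<epsilon>) * x - \<epsilon> * ?q)"
      proof -
        have "(1 - \<epsilon>) * x \<le> (1 - \<epsilon>) * ?q"
          using x[OF l] True \<epsilon> by (intro mult_left_mono) auto
        then have "- ?q \<le> - (1 - \<epsilon>) * x - \<epsilon> * ?q"
          by (simp add: algebra_simps)
        then show ?thesis using c M by (intro mult_left_mono) auto
      qed
      also have "\<dots> = Z * (e (l - k) * h (r k))"
        by (simp add: Z_def e_def h_def exp_add[symmetric] mult.assoc) (simp add: algebra_simps)
      finally show ?thesis using True by (simp add: eq)
    next
      case False
      then have "cw k * cmod (fcoef v k) \<le> 0" by simp
      moreover have "cw k * cmod (fcoef v k) \<ge> 0" using cw_pos[of k] by simp
      ultimately have "cw k * cmod (fcoef v k) = 0" by linarith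
      then show ?thesis using False by (simp only: eq) simp
    qed
  qed
  have finite_bound: "(\<Sum>l\<in>F. cmod (\<Sum>k\<in>K. fcoef v k * aform \<nu> \<sigma> (phi k) (phi l)) / cw l) \<le> Z * (E * R)"
    if K: "finite K" for K
  proof -
    have "(\<Sum>l\<in>F. cmod (\<Sum>k\<in>K. fcoef v k * aform \<nu> \<sigma> (phi k) (phi l)) / cw l) \<le>
        (\<Sum>l\<in>F. \<Sum>k\<in>K. cmod (fcoef v k * aform \<nu> \<sigma> (phi k) (phi l)) / cw l)"
      unfolding sum_divide_distrib[symmetric]
      by (intro sum_mono divide_right_mono norm_sum less_imp_le[OF cw_pos])
    also have "\<dots> \<le> (\<Sum>l\<in>F. \<Sum>k\<in>K. if k \<in> ?S then Z * (e (l - k) * h (r k)) else 0)"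
      by (intro sum_mono entry)
    also have "\<dots> = (\<Sum>l\<in>F. \<Sum>k\<in>K \<inter> ?S. Z * (e (l - k) * h (r k)))"
      using K by (simp only: sum.inter_restrict[OF K])
    also have "\<dots> = Z * (\<Sum>k\<in>K \<inter> ?S. h (r k) * (\<Sum>l\<in>F. e (l - k)))"
      by (subst sum.swap) (simp add: sum_distrib_left mult_ac)
    also have "\<dots> \<le> Z * (\<Sum>k\<in>K \<inter> ?S. h (r k) * E)"
    proof (rule mult_left_mono[OF _ Z0], rule sum_mono, rule mult_left_mono)
      fix k
      have "(\<Sum>l\<in>F. e (l - k)) = (\<Sum>m\<in>(\<lambda>l. l - k) ` F. e m)"
        by (subst sum.reindex) (auto simp: inj_on_def)
      also have "\<dots> \<le> E" unfolding e_def using F by (intro E) simp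
      finally show "(\<Sum>l\<in>F. e (l - k)) \<le> E" .
    qed (simp add: h_def)
    also have "\<dots> = Z * (E * (\<Sum>n\<in>r ` (K \<inter> ?S). h n))"
      by (subst sum.reindex) (auto intro: inj_on_subset[OF r] simp: sum_distrib_left mult_ac)
    also have "\<dots> \<le> Z * (E * R)"
      unfolding h_def using K by (intro mult_left_mono R Z0 E0) auto
    finally show ?thesis .
  qed
  have "((\<lambda>K. \<Sum>l\<in>F. cmod (\<Sum>k\<in>K. fcoef v k * aform \<nu> \<sigma> (phi k) (phi l)) / cw l) \<longlongrightarrow>
      (\<Sum>l\<in>F. cmod (aform \<nu> \<sigma> v (phi l)) / cw l)) (finite_subsets_at_top UNIV)"
    using aform_has_sum[OF v H1p_phi] unfolding has_sum_def
    by (intro tendsto_sum tendsto_divide tendsto_norm tendsto_const) (auto simp: less_imp_neq[OF cw_pos, symmetric])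
  then have "(\<Sum>l\<in>F. cmod (aform \<nu> \<sigma> v (phi l)) / cw l) \<le> Z * (E * R)"
    by (rule tendsto_upperbound) (auto intro!: eventually_finite_subsets_at_top_weakI finite_bound)
  then show ?thesis by (simp add: Z_def)
qed


text \<open>An entry is retained if its exponential weight is at most \<open>x\<close>. The row indices of the retained
  entries are at most as many as the entries, and off these rows only discarded entries contribute.\<close>

lemma best_err_decay:
  fixes r :: "int^'n \<Rightarrow> nat"
  assumes A: "\<And>l k. cmod (stiffness \<nu> \<sigma> l k) \<le> c * exp (- \<eta>\<^sub>L * norm (multi_idx (l - k)))"
    and v: "v \<in> H1p" and r: "inj_on r {k. cw k * cmod (fcoef v k) > 0}"
    and V: "\<And>k. cw k * cmod (fcoef v k) > 0 \<Longrightarrow> cw k * cmod (fcoef v k) \<le> M * exp (- \<eta> * (real (r k) / \<omega>) powr \<tau>)"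
    and c: "c > 0" and M: "M \<ge> 0" and \<epsilon>: "0 < \<epsilon>" "\<epsilon> < 1"
    and E: "\<And>F. finite F \<Longrightarrow> (\<Sum>m\<in>F. exp (- (\<epsilon> * \<eta>\<^sub>L) * norm (multi_idx (m :: int^'n)))) \<le> E"
    and R: "\<And>F. finite F \<Longrightarrow> (\<Sum>n\<in>F. exp (- (\<epsilon> * \<eta>) * (real n / \<omega>) powr \<tau>)) \<le> R"
    and fin: "finite {(n, m :: int^'n). \<eta>\<^sub>L * norm (multi_idx m) + \<eta> * (real n / \<omega>) powr \<tau> \<le> x}"
    and card: "card {(n, m :: int^'n). \<eta>\<^sub>L * norm (multi_idx m) + \<eta> * (real n / \<omega>) powr \<tau> \<le> x} \<le> N"
  shows "best_err Hm1norm proj_form N (Lop \<nu> \<sigma> v) \<le> c * M * exp (- (1 - \<epsilon>) * x) * (E * R)"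
proof -
  let ?S = "{k. cw k * cmod (fcoef v k) > 0}"
  let ?Q = "{(n, m :: int^'n). \<eta>\<^sub>L * norm (multi_idx m) + \<eta> * (real n / \<omega>) powr \<tau> \<le> x}"
  define \<Lambda>0 where "\<Lambda>0 = {l. \<exists>k\<in>?S. \<eta>\<^sub>L * norm (multi_idx (l - k)) + \<eta> * (real (r k) / \<omega>) powr \<tau> \<le> x}"
  have sub: "\<Lambda>0 \<subseteq> (\<lambda>(n, m). inv_into ?S r n + m) ` ?Q"
  proof
    fix l assume "l \<in> \<Lambda>0"
    then obtain k where k: "k \<in> ?S" "\<eta>\<^sub>L * norm (multi_idx (l - k)) + \<eta> * (real (r k) / \<omega>) powr \<tau> \<le> x"
      by (auto simp: \<Lambda>0_def)
    then have "(r k, l - k) \<in> ?Q" by simp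
    moreover have "inv_into ?S r (r k) + (l - k) = l"
      using inv_into_f_f[OF r k(1)] by simp
    ultimately show "l \<in> (\<lambda>(n, m). inv_into ?S r n + m) ` ?Q"
      by (intro image_eqI[of _ _ "(r k, l - k)"]) auto
  qed
  have fin0: "finite \<Lambda>0"
    using finite_subset[OF sub] fin by blast
  have "card \<Lambda>0 \<le> card ?Q"
    using fin by (intro order_trans[OF card_mono[OF _ sub] card_image_le]) auto
  then have "card \<Lambda>0 \<le> N" using card by linarith
  then obtain \<Lambda> where \<Lambda>: "\<Lambda>0 \<subseteq> \<Lambda>" "finite \<Lambda>" "card \<Lambda> = N"
    using obtain_index_superset[OF fin0] by blast
  define Y where "Y = c * M * exp (- (1 - \<epsilon>) * x) * (E * R)"
  have "Y \<ge> 0"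
    using E[of "{}"] R[of "{}"] c M by (simp add: Y_def)
  have "Hm1norm (Lop \<nu> \<sigma> v - proj_form \<Lambda> (Lop \<nu> \<sigma> v)) \<le> Y"
  proof (rule Hm1norm_remainder_le[OF \<Lambda>(2) \<open>Y \<ge> 0\<close>])
    fix F :: "(int^'n) set" assume F: "finite F" "F \<inter> \<Lambda> = {}"
    have x: "x \<le> \<eta>\<^sub>L * norm (multi_idx (l - k)) + \<eta> * (real (r k) / \<omega>) powr \<tau>"
      if "l \<in> F" "cw k * cmod (fcoef v k) > 0" for l k
    proof -
      have "l \<notin> \<Lambda>0" using that F \<Lambda> by blast
      then show ?thesis using that by (force simp: \<Lambda>0_def)
    qed
    have "sqrt (\<Sum>l\<in>F. (cmod (Lop \<nu> \<sigma> v (phi l)) / cw l)\<^sup>2) \<le> (\<Sum>l\<in>F. cmod (Lop \<nu> \<sigma> v (phi l)) / cw l)"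
      unfolding L2_set_def[symmetric] by (intro L2_set_le_sum divide_nonneg_pos cw_pos norm_ge_zero)
    also have "\<dots> \<le> Y"
      unfolding Y_def Lop_def by (rule discarded_sum_le[OF A v r V c M \<epsilon> E R F(1) x])
    finally have "(sqrt (\<Sum>l\<in>F. (cmod (Lop \<nu> \<sigma> v (phi l)) / cw l)\<^sup>2))\<^sup>2 \<le> Y\<^sup>2"
      by (intro power_mono) (auto simp: sum_nonneg)
    then show "(\<Sum>l\<in>F. (cmod (Lop \<nu> \<sigma> v (phi l)) / cw l)\<^sup>2) \<le> Y\<^sup>2"
      by (simp add: sum_nonneg)
  qed
  then show ?thesis
    using best_err_le[of Hm1norm, OF Hm1norm_nonneg \<Lambda>(2,3), of proj_form "Lop \<nu> \<sigma> v"]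
    by (simp add: Y_def)
qed

text \<open>The cutoff is chosen so that the number of retained entries stays just below \<open>N\<close>. The leading
  coefficient \<open>K * g powr D\<close> of their number is kept below \<open>1\<close> with a cutoff larger than the rate
  demands by the factor \<open>\<rho>\<close>, and this surplus pays for the share \<open>\<epsilon>\<close> that the convergence of the error
  sum consumes.\<close>

lemma dense_case:
  assumes De: "stiffness \<nu> \<sigma> \<in> De \<eta>\<^sub>L" and \<eta>: "\<eta> > 0" "\<eta>\<^sub>L > 0" and t: "0 < t" "t \<le> real CARD('n)"
    and less: "\<eta> < \<eta>\<^sub>L * omega_ball TYPE('n) powr (t / real CARD('n))"
  shows "\<exists>C>0. \<forall>v \<in> AG \<eta> t. Lop \<nu> \<sigma> v \<in> AG_form (zeta_exp TYPE('n) t * \<eta>) (t / (1 + t)) \<and>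
    AG_form_norm (zeta_exp TYPE('n) t * \<eta>) (t / (1 + t)) (Lop \<nu> \<sigma> v) \<le> ennreal C * AG_norm \<eta> t v"
proof -
  define d where "d = CARD('n)"
  define \<omega> where "\<omega> = omega_ball TYPE('n)"
  define \<tau> where "\<tau> = t / real d"
  define s where "s = 1 / \<tau>"
  define D where "D = real d + s"
  define \<theta> where "\<theta> = \<eta> / \<eta>\<^sub>L"
  define q where "q = ((1 + t) / \<omega> powr (2 + t)) powr (1 / D)"
  define K where "K = \<omega>\<^sup>2 * \<theta> ^ d / (real d + 1)"
  have d: "d > 0" "t \<le> real d" using t by (simp_all add: d_def)
  have \<omega>: "\<omega> > 0" by (simp add: \<omega>_def omega_ball_pos)
  have \<tau>: "0 < \<tau>" "\<tau> \<le> 1" using t d by (simp_all add: \<tau>_def)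
  have s: "s > 0" and D: "D > 0" using \<tau> by (simp_all add: s_def D_def add_pos_pos add_nonneg_pos)
  have \<theta>: "\<theta> > 0" using \<eta> by (simp add: \<theta>_def)
  have q: "q > 0" using t \<omega> by (simp add: q_def)
  have K: "K > 0" using \<omega> \<theta> by (simp add: K_def)
  have rate: "t / (1 + t) / real d = 1 / D"
    using t d by (simp add: D_def s_def \<tau>_def field_simps)
  \<comment> \<open>The strict gap between \<open>\<eta>\<close> and \<open>\<eta>\<^sub>L * \<omega> powr \<tau>\<close> makes the leading coefficient of the entry count
    strictly smaller than the one permitted by the claimed rate.\<close>
  have Kq: "K * q powr D < 1"
  proof -
    have "\<theta> < \<omega> powr \<tau>"
      using less \<eta> by (simp add: \<theta>_def \<omega>_def \<tau>_def d_def field_simps)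
    then have "\<theta> ^ d < (\<omega> powr \<tau>) ^ d"
      using \<theta> d by (intro power_strict_mono) auto
    also have "(\<omega> powr \<tau>) ^ d = \<omega> powr t"
      using \<omega> d by (simp add: powr_realpow[symmetric] powr_powr \<tau>_def)
    finally have th: "\<theta> ^ d < \<omega> powr t" .
    have "q powr D = (1 + t) / \<omega> powr (2 + t)"
      using D t \<omega> by (simp add: q_def powr_powr)
    moreover have "\<omega> powr (2 + t) = \<omega>\<^sup>2 * \<omega> powr t"
      using \<omega> by (simp add: powr_add)
    ultimately have "K * q powr D = \<theta> ^ d / \<omega> powr t * ((1 + t) / (real d + 1))"
    proof -
      have "\<omega>\<^sup>2 * \<theta> ^ d / (real d + 1) * ((1 + t) / (\<omega>\<^sup>2 * W)) = \<theta> ^ d / W * ((1 + t) / (real d + 1))" if "W > 0" for W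
        using \<omega> that by simp
      then show ?thesis
        using \<open>q powr D = _\<close> \<open>\<omega> powr (2 + t) = _\<close> \<omega> by (simp only: K_def) simp
    qed
    also have "\<dots> \<le> \<theta> ^ d / \<omega> powr t * 1"
      using \<theta> \<omega> d t by (intro mult_left_mono) auto
    also have "\<dots> < 1" using th \<omega> by simp
    finally show ?thesis .
  qed
  \<comment> \<open>With this exponent \<open>K * (q * \<rho>) powr D\<close> becomes the square root of \<open>K * q powr D\<close>.\<close>
  define \<rho> where "\<rho> = (K * q powr D) powr (- 1 / (2 * D))"
  have \<rho>: "\<rho> > 1"
  proof -
    have "1 powr (- 1 / (2 * D)) < \<rho>"
      unfolding \<rho>_def using Kq K q D by (intro powr_less_mono2_neg) auto
    then show ?thesis by simp
  qed
  define g where "g = q * \<rho>"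
  define \<epsilon> where "\<epsilon> = 1 - 1 / \<rho>"
  have \<epsilon>: "0 < \<epsilon>" "\<epsilon> < 1" using \<rho> by (simp_all add: \<epsilon>_def)
  have g: "g > 0" "(1 - \<epsilon>) * g = q" using \<rho> q by (simp_all add: g_def \<epsilon>_def)
  have Kg: "K * g powr D < 1"
  proof -
    have "\<rho> powr D = (K * q powr D) powr (- 1 / 2)"
      using D by (simp add: \<rho>_def powr_powr)
    then have "K * g powr D = (K * q powr D) powr 1 * (K * q powr D) powr (- 1 / 2)"
      using q \<rho> K by (simp add: g_def powr_mult)
    also have "\<dots> = (K * q powr D) powr (1 / 2)"
      by (simp only: powr_add[symmetric]) simp
    also have "\<dots> < 1 powr (1 / 2)"
      using Kq K q by (intro powr_less_mono2) auto
    finally show ?thesis by simp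
  qed
  define cnt where "cnt y = \<omega> * (\<theta> * (g * y + real d * \<eta>\<^sub>L / \<eta>)) ^ d *
    (1 + \<omega> * (g * y + real d * \<eta>\<^sub>L / \<eta>) powr s / (real d + 1)) / y powr D" for y
  have "(cnt \<longlongrightarrow> K * g powr D) at_top"
    unfolding cnt_def D_def K_def by (rule retained_count_limit[OF s g(1)])
  then have "eventually (\<lambda>y. cnt y < 1) at_top"
    using Kg by (rule order_tendstoD)
  moreover have "filterlim (\<lambda>N. real N powr (1 / D)) at_top sequentially"
    using D by real_asymp
  ultimately have "eventually (\<lambda>N. cnt (real N powr (1 / D)) < 1) sequentially"
    by (rule eventually_compose_filterlim)
  then obtain N0 where N0: "\<And>N. N \<ge> N0 \<Longrightarrow> cnt (real N powr (1 / D)) < 1"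
    by (auto simp: eventually_sequentially)
  obtain c where c: "c > 0" and A: "\<And>l k. cmod (stiffness \<nu> \<sigma> l k) \<le> c * exp (- \<eta>\<^sub>L * norm (multi_idx (l - k)))"
    using De by (auto simp: De_def)
  obtain E where E: "\<And>F. finite F \<Longrightarrow> (\<Sum>m\<in>F. exp (- (\<epsilon> * \<eta>\<^sub>L) * norm (multi_idx (m :: int^'n)))) \<le> E"
    using exp_lattice_sum_bounded[of "\<epsilon> * \<eta>\<^sub>L"] \<epsilon> \<eta> by (metis mult_pos_pos)
  obtain R where R: "\<And>F. finite F \<Longrightarrow> (\<Sum>n\<in>F. exp (- (\<epsilon> * \<eta>) * (real n / \<omega>) powr \<tau>)) \<le> R"
    using exp_powr_sum_bounded[of "\<epsilon> * \<eta>" \<omega> \<tau>] \<epsilon> \<eta> \<omega> \<tau> by (metis mult_pos_pos)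
  have ER: "E > 0" "R > 0"
    using E[of "{0}"] R[of "{0}"] by (auto simp: \<tau> intro: less_le_trans[OF exp_gt_zero])
  \<comment> \<open>The exponential factors cover the finitely many small \<open>N\<close>, for which no entry is retained.\<close>
  define C where "C = c * (E * R) * exp (1 - \<epsilon>) * exp (\<eta> * q * real N0 powr (1 / D))"
  have C: "C > 0" using c ER by (simp add: C_def)
  have target: "zeta_exp TYPE('n) t * \<eta> * (real N / \<omega>) powr (1 / D) = \<eta> * q * real N powr (1 / D)" for N
  proof -
    have z1: "zeta_exp TYPE('n) t = ((1 + t) / \<omega> powr (1 + t)) powr (1 / D)"
      using rate by (simp add: zeta_exp_def \<omega>_def d_def mult.commute)
    have z2: "((1 + t) / \<omega> powr (1 + t)) powr (1 / D) * (real N / \<omega>) powr (1 / D) =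
        ((1 + t) / \<omega> powr (1 + t) * (1 / \<omega>)) powr (1 / D) * real N powr (1 / D)"
      using \<omega> t by (simp add: powr_mult powr_divide)
    have z3: "(1 + t) / \<omega> powr (1 + t) * (1 / \<omega>) = (1 + t) / \<omega> powr (2 + t)"
    proof -
      have "\<omega> powr (2 + t) = \<omega> powr (1 + t) * \<omega> powr 1"
        by (simp only: powr_add[symmetric]) (simp add: add.commute)
      then show ?thesis using \<omega> by simp
    qed
    have "zeta_exp TYPE('n) t * \<eta> * (real N / \<omega>) powr (1 / D) =
        \<eta> * (((1 + t) / \<omega> powr (1 + t)) powr (1 / D) * (real N / \<omega>) powr (1 / D))"
      by (simp only: z1 mult_ac)
    also have "\<dots> = \<eta> * (q * real N powr (1 / D))"
      by (simp only: z2 z3 q_def)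
    finally show ?thesis by (simp only: mult.assoc)
  qed
  have "\<forall>v \<in> AG \<eta> t. Lop \<nu> \<sigma> v \<in> AG_form (zeta_exp TYPE('n) t * \<eta>) (t / (1 + t)) \<and>
    AG_form_norm (zeta_exp TYPE('n) t * \<eta>) (t / (1 + t)) (Lop \<nu> \<sigma> v) \<le> ennreal C * AG_norm \<eta> t v"
  proof (rule exp_class_transfer[OF C])
    fix v :: "real^'n \<Rightarrow> complex" and M :: real and N
    assume v: "v \<in> H1p" and M: "M \<ge> 0"
      and err: "\<And>N. best_err H1norm proj_fun N v \<le> M * exp (- \<eta> * (real N / omega_ball TYPE('n)) powr (t / real CARD('n)))"
    obtain r where r: "inj_on r {k. cw k * cmod (fcoef v k) > 0}"
      and rV: "\<And>k. cw k * cmod (fcoef v k) > 0 \<Longrightarrow> cw k * cmod (fcoef v k) \<le> best_err H1norm proj_fun (r k) v"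
      using coefficient_rank[OF v] by blast
    have V: "cw k * cmod (fcoef v k) \<le> M * exp (- \<eta> * (real (r k) / \<omega>) powr \<tau>)"
      if "cw k * cmod (fcoef v k) > 0" for k
      using order_trans[OF rV[OF that] err[of "r k"]] by (simp add: \<omega>_def \<tau>_def d_def)
    have decay: "best_err Hm1norm proj_form N (Lop \<nu> \<sigma> v) \<le> c * M * exp (- (1 - \<epsilon>) * x) * (E * R)"
      if "finite {(n, m :: int^'n). \<eta>\<^sub>L * norm (multi_idx m) + \<eta> * (real n / \<omega>) powr \<tau> \<le> x}"
        "card {(n, m :: int^'n). \<eta>\<^sub>L * norm (multi_idx m) + \<eta> * (real n / \<omega>) powr \<tau> \<le> x} \<le> N" for x
      by (rule best_err_decay[OF A v r V c M \<epsilon> E R that])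
    define y where "y = real N powr (1 / D)"
    have "best_err Hm1norm proj_form N (Lop \<nu> \<sigma> v) \<le> C * M * exp (- (\<eta> * q * y))"
    proof (cases "N \<ge> N0 \<and> N > 0")
      case True
      then have y: "y > 0" "y powr D = real N" using D by (simp_all add: y_def powr_powr)
      have gy: "g * y \<ge> 0" using g y by simp
      let ?Q = "{(n, m :: int^'n). \<eta>\<^sub>L * norm (multi_idx m) + \<eta> * (real n / \<omega>) powr \<tau> \<le> \<eta> * (g * y)}"
      have Q: "finite ?Q" "real (card ?Q) \<le> \<omega> * (\<theta> * (g * y + real d * \<eta>\<^sub>L / \<eta>)) ^ d *
          (1 + \<omega> * (g * y + real d * \<eta>\<^sub>L / \<eta>) powr s / (real d + 1))"
        unfolding \<omega>_def \<theta>_def d_def s_def using card_retained_le[OF \<eta> \<tau> gy, where 'n='n] by auto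
      note Q(2)
      also have "\<omega> * (\<theta> * (g * y + real d * \<eta>\<^sub>L / \<eta>)) ^ d *
          (1 + \<omega> * (g * y + real d * \<eta>\<^sub>L / \<eta>) powr s / (real d + 1)) = cnt y * real N"
        using y True by (simp add: cnt_def)
      also have "\<dots> \<le> 1 * real N"
        using N0[of N] True by (intro mult_right_mono) (auto simp: y_def)
      finally have "card ?Q \<le> N" by simp
      then have "best_err Hm1norm proj_form N (Lop \<nu> \<sigma> v) \<le> c * M * exp (- (1 - \<epsilon>) * (\<eta> * (g * y))) * (E * R)"
        by (rule decay[OF Q(1)])
      also have "- (1 - \<epsilon>) * (\<eta> * (g * y)) = - (\<eta> * q * y)"
        unfolding g(2)[symmetric] by (simp add: algebra_simps)
      also have "c * M * exp (- (\<eta> * q * y)) * (E * R) = c * (E * R) * 1 * 1 * (M * exp (- (\<eta> * q * y)))"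
        by simp
      also have "\<dots> \<le> C * (M * exp (- (\<eta> * q * y)))"
        unfolding C_def using c ER M \<epsilon> \<eta> q
        by (intro mult_right_mono mult_mono) auto
      finally show ?thesis by (simp add: mult.assoc)
    next
      case False
      then have "N \<le> N0" by auto
      then have yN0: "y \<le> real N0 powr (1 / D)"
        using D by (auto simp: y_def intro!: powr_mono2)
      \<comment> \<open>Weights are nonnegative, so the cutoff \<open>-1\<close> retains nothing.\<close>
      have none: "{(n, m :: int^'n). \<eta>\<^sub>L * norm (multi_idx m) + \<eta> * (real n / \<omega>) powr \<tau> \<le> - 1} = {}"
      proof -
        have "0 \<le> \<eta>\<^sub>L * norm (multi_idx m) + \<eta> * (real n / \<omega>) powr \<tau>" for n and m :: "int^'n"
          using \<eta> by (intro add_nonneg_nonneg mult_nonneg_nonneg) auto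
        then show ?thesis by (auto simp: not_le intro: less_le_trans[of _ 0])
      qed
      have "best_err Hm1norm proj_form N (Lop \<nu> \<sigma> v) \<le> c * M * exp (- (1 - \<epsilon>) * (- 1)) * (E * R)"
        by (rule decay) (simp_all add: none)
      also have "\<dots> = c * (E * R) * exp (1 - \<epsilon>) * M * 1" by simp
      also have "\<dots> \<le> c * (E * R) * exp (1 - \<epsilon>) * M * exp (\<eta> * q * real N0 powr (1 / D) - \<eta> * q * y)"
        using c ER M \<eta> q yN0 by (intro mult_left_mono) auto
      also have "\<dots> = C * M * exp (- (\<eta> * q * y))"
        by (simp add: C_def exp_diff exp_minus field_simps)
      finally show ?thesis .
    qed
    then show "best_err Hm1norm proj_form N (Lop \<nu> \<sigma> v) \<le> C * M *
        exp (- (zeta_exp TYPE('n) t * \<eta>) * (real N / omega_ball TYPE('n)) powr (t / (1 + t) / real CARD('n)))"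
      using target[of N] rate unfolding \<omega>_def d_def y_def by (simp only: mult_minus_left)
  qed
  then show ?thesis using C by blast
qed

end

theorem proposition5p3:
  fixes \<nu> \<sigma> :: "real^'n \<Rightarrow> real" and \<eta>\<^sub>L \<eta> t \<tau> \<eta>' t' :: real and p :: nat
  assumes "admissible_coeff \<nu>" and "admissible_coeff \<sigma>"
    and "\<eta>\<^sub>L > 0" and "stiffness \<nu> \<sigma> \<in> De \<eta>\<^sub>L"
    and "\<eta> > 0" and "0 < t" and "t \<le> real CARD('n)" and "\<tau> = t / real CARD('n)"
    and "(banded p (stiffness \<nu> \<sigma>) \<and> \<eta>' = \<eta> / (2 * real p + 1) powr \<tau> \<and> t' = t) \<or>
         (dense_matrix (stiffness \<nu> \<sigma>) \<and> \<eta> < \<eta>\<^sub>L * omega_ball TYPE('n) powr \<tau> \<and>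
            \<eta>' = zeta_exp TYPE('n) t * \<eta> \<and> t' = t / (1 + t))"
  shows "\<exists>C>0. \<forall>v \<in> AG \<eta> t. Lop \<nu> \<sigma> v \<in> AG_form \<eta>' t' \<and>
           AG_form_norm \<eta>' t' (Lop \<nu> \<sigma> v) \<le> ennreal C * AG_norm \<eta> t v"
proof -
  interpret torus_form \<nu> \<sigma>
    by standard fact+
  show ?thesis
    using assms(9) banded_case[of p \<eta> t] dense_case[of \<eta>\<^sub>L \<eta> t] assms(3-8) by auto
qed

end
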